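(* In the mismatched side information problem, $\liminf_{\epsilon\to0}R^m_{lb}(\mathbf{D}+\epsilon\mathbf{1})\ge R^M(\mathbf{D})$ and $R_{ach}(\mathbf{D})\le R^M(\mathbf{D})$, where $R^M(\mathbf{D})=\min\max\{R^M_1,R^M_2\}$ with $R^M_1=I(X_1;W_1|Y_{11})+I(X_2;W_2|Y_{12})+I(X_1;U_1|Y_{11},W_1)+I(X_2;U_2|Y_{22},W_2)$, $R^M_2=I(X_1;W_1|Y_{21})+I(X_2;W_2|Y_{22})+I(X_1;U_1|Y_{11},W_1)+I(X_2;U_2|Y_{22},W_2)$, the minimum being over finite-alphabet $W_1,W_2,U_1,U_2$ such that (1) $(W_i,U_i)\leftrightarrow X_i\leftrightarrow(Y_{1i},Y_{2i})$ for $i=1,2$; (2) $(W_1,U_1,X_1,Y_{11},Y_{21})$ is independent of $(W_2,U_2,X_2,Y_{12},Y_{22})$; (3) there are functions with $\widehat X_{11}=g_{11}(W_1,U_1,Y_{11})$, $\widehat X_{12}=g_{12}(W_2,Y_{12})$, $\widehat X_{21}=g_{21}(W_1,Y_{21})$, $\widehat X_{22}=g_{22}(W_2,U_2,Y_{22})$ satisfying $E[d_{ji}(X_i,\widehat X_{ji})]\le D_{ji}$ for $i,j\in\{1,2\}$; (4) $|\mathcal{W}_i|\le|\mathcal{X}_i|+3$ and $|\mathcal{U}_i|\le|\mathcal{X}_i|(|\mathcal{X}_i|+3)+1$.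
   Context: Mismatched side information problem (finite alphabets): source $\mathbf{X}=(X_1,X_2)$, two decoders with side information $\mathbf{Y_1}=(Y_{11},Y_{12})$ and $\mathbf{Y_2}=(Y_{21},Y_{22})$, where $(X_1,Y_{11},Y_{21})$ is independent of $(X_2,Y_{12},Y_{22})$, and $X_1\leftrightarrow Y_{11}\leftrightarrow Y_{21}$, $X_2\leftrightarrow Y_{22}\leftrightarrow Y_{12}$ are Markov chains. Decoder $j\in\{1,2\}$ reconstructs $X_i$ as $\widehat X_{ji}$, $i\in\{1,2\}$, with distortion constraint $E[d_{ji}(X_i,\widehat X_{ji})]\le D_{ji}$. $\mathbf{D}$ collects the $D_{ji}$. $R^m_{lb}(\mathbf{D}+\epsilon\mathbf{1})=\sup_{\bar P}\inf_{\bar C}\bar R_{lb}-\epsilon$ where for $m=2$ decoders $\bar R_{lb}=\max_\sigma[I(\mathbf{X};V,U_{Y_{\sigma(1)}}|\mathbf{Y}_{\sigma(1)})+I(\mathbf{X};U_{Y_{\sigma(2)}}|V,U_{Y_{\sigma(1)}},\mathbf{Y_1},\mathbf{Y_2})]$ over permutations $\sigma$ of $\{1,2\}$; $\bar P$ is the set of joint distributions of $(\mathbf{X},\mathbf{Y_1},\mathbf{Y_2})$ with the given pairwise marginals $p(\mathbf{x},\mathbf{y_i})$; $\bar C$ is the set of $(V,U_{Y_1},U_{Y_2})$ with $(\mathbf{Y_1},\mathbf{Y_2})\leftrightarrow\mathbf{X}\leftrightarrow(V,U_{Y_1},U_{Y_2})$ such that decoder $j$ can meet all its distortion constraints (each increased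 by $\epsilon$) with functions of $(V,U_{Y_j},\mathbf{Y_j})$. $R_{ach}(\mathbf{D})$ is the lower convex envelope in $\mathbf{D}$ of $\min_v\inf_p\inf\sum_j R_{\mathcal{S}_j}$, where $v$ orders the nonempty subsets $\mathcal{S}$ of $\{1,2\}$, $p$ ranges over laws of finite-alphabet $(U_\mathcal{S})_\mathcal{S}$ with $(\mathbf{X},\mathbf{Y_1},\mathbf{Y_2})$ having the given law, $(U_\mathcal{S})_\mathcal{S}\leftrightarrow\mathbf{X}\leftrightarrow(\mathbf{Y_1},\mathbf{Y_2})$, and decoder $l$ meeting its constraints with functions of $(U_{\mathcal{D}_l},\mathbf{Y_l})$; and the inner infimum is over nonnegative $R_{\mathcal{S}_j},R'_{\mathcal{S}_j}$ with $R_{\mathcal{S}_j}+R'_{\mathcal{S}_j}\ge I(\mathbf{X},U^-_{\mathcal{S}_j};U_{\mathcal{S}_j})$ and $\sum_{\mathcal{S}_j\in\mathcal{D}'_l}R'_{\mathcal{S}_j}\le\sum_{\mathcal{S}_j\in\mathcal{D}'_l}H(U_{\mathcal{S}_j})-H(U_{\mathcal{D}'_l}|U_{\mathcal{D}_l\setminus\mathcal{D}'_l},\mathbf{Y_l})$ for all $l$ and nonempty $\mathcal{D}'_l\subseteq\mathcal{D}_l$, with $\mathcal{D}_l=\{\mathcal{S}:l\in\mathcal{S}\}$, $U^-_{\mathcal{S}_j}=\{U_{\mathcal{S}_i}:i<j\}$. *)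

theory Defs
  imports "HOL-Probability.Probability"
begin

text \<open>All random variables are functions of the outcome of a joint pmf M.
  Logarithms are to base 2.  All pmfs used below have finite support.\<close>

definition mis_pr :: "'o pmf \<Rightarrow> ('o \<Rightarrow> 'a) \<Rightarrow> 'a \<Rightarrow> real" where
  "mis_pr M A a = measure_pmf.prob M {\<omega>. A \<omega> = a}"

definition mis_H :: "'o pmf \<Rightarrow> ('o \<Rightarrow> 'a) \<Rightarrow> real" where
  "mis_H M A = - (\<Sum>a \<in> A ` set_pmf M. mis_pr M A a * log 2 (mis_pr M A a))"

definition mis_condH :: "'o pmf \<Rightarrow> ('o \<Rightarrow> 'a) \<Rightarrow> ('o \<Rightarrow> 'c) \<Rightarrow> real" where
  "mis_condH M A C = - (\<Sum>t \<in> (\<lambda>\<omega>. (A \<omega>, C \<omega>)) ` set_pmf M.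
      mis_pr M (\<lambda>\<omega>. (A \<omega>, C \<omega>)) t * log 2 (mis_pr M (\<lambda>\<omega>. (A \<omega>, C \<omega>)) t / mis_pr M C (snd t)))"

definition mis_I :: "'o pmf \<Rightarrow> ('o \<Rightarrow> 'a) \<Rightarrow> ('o \<Rightarrow> 'b) \<Rightarrow> ('o \<Rightarrow> 'c) \<Rightarrow> real" where
  "mis_I M A B C = (\<Sum>t \<in> (\<lambda>\<omega>. (A \<omega>, B \<omega>, C \<omega>)) ` set_pmf M.
      (case t of (a, b, c) \<Rightarrow>
        mis_pr M (\<lambda>\<omega>. (A \<omega>, B \<omega>, C \<omega>)) (a, b, c) *
        log 2 (mis_pr M (\<lambda>\<omega>. (A \<omega>, B \<omega>, C \<omega>)) (a, b, c) * mis_pr M C c /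
               (mis_pr M (\<lambda>\<omega>. (A \<omega>, C \<omega>)) (a, c) * mis_pr M (\<lambda>\<omega>. (B \<omega>, C \<omega>)) (b, c)))))"

definition mis_markov :: "'o pmf \<Rightarrow> ('o \<Rightarrow> 'a) \<Rightarrow> ('o \<Rightarrow> 'b) \<Rightarrow> ('o \<Rightarrow> 'c) \<Rightarrow> bool" where
  "mis_markov M A B C \<longleftrightarrow> (\<forall>a b c.
      mis_pr M (\<lambda>\<omega>. (A \<omega>, B \<omega>, C \<omega>)) (a, b, c) * mis_pr M B b =
      mis_pr M (\<lambda>\<omega>. (A \<omega>, B \<omega>)) (a, b) * mis_pr M (\<lambda>\<omega>. (B \<omega>, C \<omega>)) (b, c))"

definition mis_src ::
  "('x1 \<times> 'y11 \<times> 'y21) pmf \<Rightarrow> ('x2 \<times> 'y12 \<times> 'y22) pmf \<Rightarrow>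
   (('x1 \<times> 'x2) \<times> ('y11 \<times> 'y12) \<times> ('y21 \<times> 'y22)) pmf" where
  "mis_src P1 P2 = map_pmf (\<lambda>((x1, y11, y21), (x2, y12, y22)). ((x1, x2), (y11, y12), (y21, y22)))
                          (pair_pmf P1 P2)"

text \<open>Outcome: ((X1,Y11,Y21,W1,U1),(X2,Y12,Y22,W2,U2)).\<close>
definition "mX1 \<omega> = fst (fst \<omega>)"
definition "mY11 \<omega> = fst (snd (fst \<omega>))"
definition "mY21 \<omega> = fst (snd (snd (fst \<omega>)))"
definition "mW1 \<omega> = fst (snd (snd (snd (fst \<omega>))))"
definition "mU1 \<omega> = snd (snd (snd (snd (fst \<omega>))))"
definition "mX2 \<omega> = fst (snd \<omega>)"
definition "mY12 \<omega> = fst (snd (snd \<omega>))"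
definition "mY22 \<omega> = fst (snd (snd (snd \<omega>)))"
definition "mW2 \<omega> = fst (snd (snd (snd (snd \<omega>))))"
definition "mU2 \<omega> = snd (snd (snd (snd (snd \<omega>))))"

definition RM_feasible ::
  "('x1::finite \<times> 'y11 \<times> 'y21) pmf \<Rightarrow> ('x2::finite \<times> 'y12 \<times> 'y22) pmf \<Rightarrow>
   ('x1 \<Rightarrow> 'z11 \<Rightarrow> real) \<Rightarrow> ('x2 \<Rightarrow> 'z12 \<Rightarrow> real) \<Rightarrow>
   ('x1 \<Rightarrow> 'z21 \<Rightarrow> real) \<Rightarrow> ('x2 \<Rightarrow> 'z22 \<Rightarrow> real) \<Rightarrow> (nat \<Rightarrow> nat \<Rightarrow> real) \<Rightarrow>
   (('x1 \<times> 'y11 \<times> 'y21 \<times> nat \<times> nat) \<times> ('x2 \<times> 'y12 \<times> 'y22 \<times> nat \<times> nat)) pmf \<Rightarrow> bool" where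
  "RM_feasible P1 P2 d11 d12 d21 d22 D Q \<longleftrightarrow>
     map_pmf (\<lambda>(x, y, y', w, u). (x, y, y')) (map_pmf fst Q) = P1 \<and>
     map_pmf (\<lambda>(x, y, y', w, u). (x, y, y')) (map_pmf snd Q) = P2 \<and>
     \<comment> \<open>(1) Markov chains\<close>
     mis_markov Q (\<lambda>\<omega>. (mW1 \<omega>, mU1 \<omega>)) mX1 (\<lambda>\<omega>. (mY11 \<omega>, mY21 \<omega>)) \<and>
     mis_markov Q (\<lambda>\<omega>. (mW2 \<omega>, mU2 \<omega>)) mX2 (\<lambda>\<omega>. (mY12 \<omega>, mY22 \<omega>)) \<and>
     \<comment> \<open>(2) independence of the two components\<close>
     Q = pair_pmf (map_pmf fst Q) (map_pmf snd Q) \<and>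
     \<comment> \<open>(3) distortion constraints\<close>
     (\<exists>g11 :: nat \<Rightarrow> nat \<Rightarrow> 'y11 \<Rightarrow> 'z11.
        measure_pmf.expectation Q (\<lambda>\<omega>. d11 (mX1 \<omega>) (g11 (mW1 \<omega>) (mU1 \<omega>) (mY11 \<omega>))) \<le> D 1 1) \<and>
     (\<exists>g12 :: nat \<Rightarrow> 'y12 \<Rightarrow> 'z12.
        measure_pmf.expectation Q (\<lambda>\<omega>. d12 (mX2 \<omega>) (g12 (mW2 \<omega>) (mY12 \<omega>))) \<le> D 1 2) \<and>
     (\<exists>g21 :: nat \<Rightarrow> 'y21 \<Rightarrow> 'z21.
        measure_pmf.expectation Q (\<lambda>\<omega>. d21 (mX1 \<omega>) (g21 (mW1 \<omega>) (mY21 \<omega>))) \<le> D 2 1) \<and>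
     (\<exists>g22 :: nat \<Rightarrow> nat \<Rightarrow> 'y22 \<Rightarrow> 'z22.
        measure_pmf.expectation Q (\<lambda>\<omega>. d22 (mX2 \<omega>) (g22 (mW2 \<omega>) (mU2 \<omega>) (mY22 \<omega>))) \<le> D 2 2) \<and>
     \<comment> \<open>(4) cardinality bounds: alphabets are initial segments of nat\<close>
     (\<forall>\<omega> \<in> set_pmf Q.
        mW1 \<omega> < CARD('x1) + 3 \<and> mU1 \<omega> < CARD('x1) * (CARD('x1) + 3) + 1 \<and>
        mW2 \<omega> < CARD('x2) + 3 \<and> mU2 \<omega> < CARD('x2) * (CARD('x2) + 3) + 1)"

definition RM_1 :: "(('x1 \<times> 'y11 \<times> 'y21 \<times> nat \<times> nat) \<times> ('x2 \<times> 'y12 \<times> 'y22 \<times> nat \<times> nat)) pmf \<Rightarrow> real" where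
  "RM_1 Q = mis_I Q mX1 mW1 mY11 + mis_I Q mX2 mW2 mY12
          + mis_I Q mX1 mU1 (\<lambda>\<omega>. (mY11 \<omega>, mW1 \<omega>)) + mis_I Q mX2 mU2 (\<lambda>\<omega>. (mY22 \<omega>, mW2 \<omega>))"

definition RM_2 :: "(('x1 \<times> 'y11 \<times> 'y21 \<times> nat \<times> nat) \<times> ('x2 \<times> 'y12 \<times> 'y22 \<times> nat \<times> nat)) pmf \<Rightarrow> real" where
  "RM_2 Q = mis_I Q mX1 mW1 mY21 + mis_I Q mX2 mW2 mY22
          + mis_I Q mX1 mU1 (\<lambda>\<omega>. (mY11 \<omega>, mW1 \<omega>)) + mis_I Q mX2 mU2 (\<lambda>\<omega>. (mY22 \<omega>, mW2 \<omega>))"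

definition RM ::
  "('x1::finite \<times> 'y11 \<times> 'y21) pmf \<Rightarrow> ('x2::finite \<times> 'y12 \<times> 'y22) pmf \<Rightarrow>
   ('x1 \<Rightarrow> 'z11 \<Rightarrow> real) \<Rightarrow> ('x2 \<Rightarrow> 'z12 \<Rightarrow> real) \<Rightarrow>
   ('x1 \<Rightarrow> 'z21 \<Rightarrow> real) \<Rightarrow> ('x2 \<Rightarrow> 'z22 \<Rightarrow> real) \<Rightarrow> (nat \<Rightarrow> nat \<Rightarrow> real) \<Rightarrow> ereal" where
  "RM P1 P2 d11 d12 d21 d22 D =
     (INF Q \<in> {Q. RM_feasible P1 P2 d11 d12 d21 d22 D Q}. ereal (max (RM_1 Q) (RM_2 Q)))"

text \<open>Outcome: ((X, Y1, Y2), (a, b, c)) with X = (X1,X2), Y1 = (Y11,Y12), Y2 = (Y21,Y22),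
  and three nat-valued auxiliary variables.\<close>
definition "lX \<omega> = fst (fst \<omega>)"
definition "lY1 \<omega> = fst (snd (fst \<omega>))"
definition "lY2 \<omega> = snd (snd (fst \<omega>))"
definition "lA \<omega> = fst (snd \<omega>)"
definition "lB \<omega> = fst (snd (snd \<omega>))"
definition "lC \<omega> = snd (snd (snd \<omega>))"

definition Pbar ::
  "('x1 \<times> 'y11 \<times> 'y21) pmf \<Rightarrow> ('x2 \<times> 'y12 \<times> 'y22) pmf \<Rightarrow>
   (('x1 \<times> 'x2) \<times> ('y11 \<times> 'y12) \<times> ('y21 \<times> 'y22)) pmf set" where
  "Pbar P1 P2 = {Pb.
     map_pmf (\<lambda>(x, y1, y2). (x, y1)) Pb = map_pmf (\<lambda>(x, y1, y2). (x, y1)) (mis_src P1 P2) \<and>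
     map_pmf (\<lambda>(x, y1, y2). (x, y2)) Pb = map_pmf (\<lambda>(x, y1, y2). (x, y2)) (mis_src P1 P2)}"

text \<open>Cbar: V = lA, U_Y1 = lB, U_Y2 = lC; constraints relaxed to D + eps.\<close>
definition Cbar ::
  "('x1 \<Rightarrow> 'z11 \<Rightarrow> real) \<Rightarrow> ('x2 \<Rightarrow> 'z12 \<Rightarrow> real) \<Rightarrow>
   ('x1 \<Rightarrow> 'z21 \<Rightarrow> real) \<Rightarrow> ('x2 \<Rightarrow> 'z22 \<Rightarrow> real) \<Rightarrow> (nat \<Rightarrow> nat \<Rightarrow> real) \<Rightarrow> real \<Rightarrow>
   (('x1 \<times> 'x2) \<times> ('y11 \<times> 'y12) \<times> ('y21 \<times> 'y22)) pmf \<Rightarrow>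
   ((('x1 \<times> 'x2) \<times> ('y11 \<times> 'y12) \<times> ('y21 \<times> 'y22)) \<times> (nat \<times> nat \<times> nat)) pmf set" where
  "Cbar d11 d12 d21 d22 D \<epsilon> Pb = {Q.
     finite (set_pmf Q) \<and> map_pmf fst Q = Pb \<and>
     mis_markov Q (\<lambda>\<omega>. (lY1 \<omega>, lY2 \<omega>)) lX snd \<and>
     (\<exists>g11 :: nat \<Rightarrow> nat \<Rightarrow> 'y11 \<times> 'y12 \<Rightarrow> 'z11.
        measure_pmf.expectation Q (\<lambda>\<omega>. d11 (fst (lX \<omega>)) (g11 (lA \<omega>) (lB \<omega>) (lY1 \<omega>))) \<le> D 1 1 + \<epsilon>) \<and>
     (\<exists>g12 :: nat \<Rightarrow> nat \<Rightarrow> 'y11 \<times> 'y12 \<Rightarrow> 'z12.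
        measure_pmf.expectation Q (\<lambda>\<omega>. d12 (snd (lX \<omega>)) (g12 (lA \<omega>) (lB \<omega>) (lY1 \<omega>))) \<le> D 1 2 + \<epsilon>) \<and>
     (\<exists>g21 :: nat \<Rightarrow> nat \<Rightarrow> 'y21 \<times> 'y22 \<Rightarrow> 'z21.
        measure_pmf.expectation Q (\<lambda>\<omega>. d21 (fst (lX \<omega>)) (g21 (lA \<omega>) (lC \<omega>) (lY2 \<omega>))) \<le> D 2 1 + \<epsilon>) \<and>
     (\<exists>g22 :: nat \<Rightarrow> nat \<Rightarrow> 'y21 \<times> 'y22 \<Rightarrow> 'z22.
        measure_pmf.expectation Q (\<lambda>\<omega>. d22 (snd (lX \<omega>)) (g22 (lA \<omega>) (lC \<omega>) (lY2 \<omega>))) \<le> D 2 2 + \<epsilon>)}"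

text \<open>Rbar_lb: maximum over the two permutations sigma of {1,2}.\<close>
definition Rbar_lb ::
  "((('x1 \<times> 'x2) \<times> ('y11 \<times> 'y12) \<times> ('y21 \<times> 'y22)) \<times> (nat \<times> nat \<times> nat)) pmf \<Rightarrow> real" where
  "Rbar_lb Q = max
     (mis_I Q lX (\<lambda>\<omega>. (lA \<omega>, lB \<omega>)) lY1 +
      mis_I Q lX lC (\<lambda>\<omega>. (lA \<omega>, lB \<omega>, lY1 \<omega>, lY2 \<omega>)))
     (mis_I Q lX (\<lambda>\<omega>. (lA \<omega>, lC \<omega>)) lY2 +
      mis_I Q lX lB (\<lambda>\<omega>. (lA \<omega>, lC \<omega>, lY1 \<omega>, lY2 \<omega>)))"

text \<open>Rlb ... D eps  represents  R^m_lb(D + eps 1).\<close>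
definition Rlb ::
  "('x1 \<times> 'y11 \<times> 'y21) pmf \<Rightarrow> ('x2 \<times> 'y12 \<times> 'y22) pmf \<Rightarrow>
   ('x1 \<Rightarrow> 'z11 \<Rightarrow> real) \<Rightarrow> ('x2 \<Rightarrow> 'z12 \<Rightarrow> real) \<Rightarrow>
   ('x1 \<Rightarrow> 'z21 \<Rightarrow> real) \<Rightarrow> ('x2 \<Rightarrow> 'z22 \<Rightarrow> real) \<Rightarrow> (nat \<Rightarrow> nat \<Rightarrow> real) \<Rightarrow> real \<Rightarrow> ereal" where
  "Rlb P1 P2 d11 d12 d21 d22 D \<epsilon> =
     (SUP Pb \<in> Pbar P1 P2. INF Q \<in> Cbar d11 d12 d21 d22 D \<epsilon> Pb. ereal (Rbar_lb Q)) - ereal \<epsilon>"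

text \<open>Nonempty subsets of {1,2}; U_{1} = lA, U_{2} = lB, U_{1,2} = lC.\<close>
definition subsets12 :: "nat set set" where
  "subsets12 = {{1}, {2}, {1, 2}}"

definition Dset :: "nat \<Rightarrow> nat set set" where
  "Dset l = {S \<in> subsets12. l \<in> S}"

definition usel :: "nat set \<Rightarrow> 'o \<times> (nat \<times> nat \<times> nat) \<Rightarrow> nat" where
  "usel S \<omega> = (if S = {1} then lA \<omega> else if S = {2} then lB \<omega> else lC \<omega>)"

definition UU :: "nat set set \<Rightarrow> 'o \<times> (nat \<times> nat \<times> nat) \<Rightarrow> (nat set \<Rightarrow> nat)" where
  "UU T \<omega> = restrict (\<lambda>S. usel S \<omega>) T"

definition Rach_feasible ::
  "('x1 \<times> 'y11 \<times> 'y21) pmf \<Rightarrow> ('x2 \<times> 'y12 \<times> 'y22) pmf \<Rightarrow>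
   ('x1 \<Rightarrow> 'z11 \<Rightarrow> real) \<Rightarrow> ('x2 \<Rightarrow> 'z12 \<Rightarrow> real) \<Rightarrow>
   ('x1 \<Rightarrow> 'z21 \<Rightarrow> real) \<Rightarrow> ('x2 \<Rightarrow> 'z22 \<Rightarrow> real) \<Rightarrow> (nat \<Rightarrow> nat \<Rightarrow> real) \<Rightarrow>
   ((('x1 \<times> 'x2) \<times> ('y11 \<times> 'y12) \<times> ('y21 \<times> 'y22)) \<times> (nat \<times> nat \<times> nat)) pmf \<Rightarrow> bool" where
  "Rach_feasible P1 P2 d11 d12 d21 d22 D Q \<longleftrightarrow>
     finite (set_pmf Q) \<and> map_pmf fst Q = mis_src P1 P2 \<and>
     mis_markov Q (UU subsets12) lX (\<lambda>\<omega>. (lY1 \<omega>, lY2 \<omega>)) \<and>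
     \<comment> \<open>decoder 1 uses (U_{1}, U_{1,2}, Y1); decoder 2 uses (U_{2}, U_{1,2}, Y2)\<close>
     (\<exists>g11 :: nat \<Rightarrow> nat \<Rightarrow> 'y11 \<times> 'y12 \<Rightarrow> 'z11.
        measure_pmf.expectation Q (\<lambda>\<omega>. d11 (fst (lX \<omega>)) (g11 (lA \<omega>) (lC \<omega>) (lY1 \<omega>))) \<le> D 1 1) \<and>
     (\<exists>g12 :: nat \<Rightarrow> nat \<Rightarrow> 'y11 \<times> 'y12 \<Rightarrow> 'z12.
        measure_pmf.expectation Q (\<lambda>\<omega>. d12 (snd (lX \<omega>)) (g12 (lA \<omega>) (lC \<omega>) (lY1 \<omega>))) \<le> D 1 2) \<and>
     (\<exists>g21 :: nat \<Rightarrow> nat \<Rightarrow> 'y21 \<times> 'y22 \<Rightarrow> 'z21.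
        measure_pmf.expectation Q (\<lambda>\<omega>. d21 (fst (lX \<omega>)) (g21 (lB \<omega>) (lC \<omega>) (lY2 \<omega>))) \<le> D 2 1) \<and>
     (\<exists>g22 :: nat \<Rightarrow> nat \<Rightarrow> 'y21 \<times> 'y22 \<Rightarrow> 'z22.
        measure_pmf.expectation Q (\<lambda>\<omega>. d22 (snd (lX \<omega>)) (g22 (lB \<omega>) (lC \<omega>) (lY2 \<omega>))) \<le> D 2 2)"

definition Rach_rates ::
  "nat set list \<Rightarrow> ((('x1 \<times> 'x2) \<times> ('y11 \<times> 'y12) \<times> ('y21 \<times> 'y22)) \<times> (nat \<times> nat \<times> nat)) pmf \<Rightarrow>
   (nat set \<Rightarrow> real) \<Rightarrow> (nat set \<Rightarrow> real) \<Rightarrow> bool" where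
  "Rach_rates v Q R R' \<longleftrightarrow>
     (\<forall>S \<in> subsets12. 0 \<le> R S \<and> 0 \<le> R' S) \<and>
     (\<forall>j < length v. R (v ! j) + R' (v ! j) \<ge>
        mis_I Q (\<lambda>\<omega>. (lX \<omega>, UU (set (take j v)) \<omega>)) (usel (v ! j)) (\<lambda>_. ())) \<and>
     (\<forall>D'. D' \<subseteq> Dset 1 \<and> D' \<noteq> {} \<longrightarrow>
        (\<Sum>S \<in> D'. R' S) \<le> (\<Sum>S \<in> D'. mis_H Q (usel S))
          - mis_condH Q (UU D') (\<lambda>\<omega>. (UU (Dset 1 - D') \<omega>, lY1 \<omega>))) \<and>
     (\<forall>D'. D' \<subseteq> Dset 2 \<and> D' \<noteq> {} \<longrightarrow>
        (\<Sum>S \<in> D'. R' S) \<le> (\<Sum>S \<in> D'. mis_H Q (usel S))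
          - mis_condH Q (UU D') (\<lambda>\<omega>. (UU (Dset 2 - D') \<omega>, lY2 \<omega>)))"

definition Rach0 ::
  "('x1 \<times> 'y11 \<times> 'y21) pmf \<Rightarrow> ('x2 \<times> 'y12 \<times> 'y22) pmf \<Rightarrow>
   ('x1 \<Rightarrow> 'z11 \<Rightarrow> real) \<Rightarrow> ('x2 \<Rightarrow> 'z12 \<Rightarrow> real) \<Rightarrow>
   ('x1 \<Rightarrow> 'z21 \<Rightarrow> real) \<Rightarrow> ('x2 \<Rightarrow> 'z22 \<Rightarrow> real) \<Rightarrow> (nat \<Rightarrow> nat \<Rightarrow> real) \<Rightarrow> ereal" where
  "Rach0 P1 P2 d11 d12 d21 d22 D =
     (INF v \<in> {v. distinct v \<and> set v = subsets12}.
        INF Q \<in> {Q. Rach_feasible P1 P2 d11 d12 d21 d22 D Q}.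
          INF RR \<in> {(R, R'). Rach_rates v Q R R'}. ereal (\<Sum>S \<in> subsets12. fst RR S))"

definition lower_convex_envelope ::
  "((nat \<Rightarrow> nat \<Rightarrow> real) \<Rightarrow> ereal) \<Rightarrow> (nat \<Rightarrow> nat \<Rightarrow> real) \<Rightarrow> ereal" where
  "lower_convex_envelope f D = Inf {(\<Sum>t<k. ereal (lam t) * f (Ds t)) | (k::nat) lam Ds.
       (\<forall>t<k. 0 \<le> lam t) \<and> (\<Sum>t<k. lam t) = 1 \<and>
       (\<forall>j \<in> {1, 2}. \<forall>i \<in> {1, 2}. (\<Sum>t<k. lam t * Ds t j i) = D j i)}"

definition Rach ::
  "('x1 \<times> 'y11 \<times> 'y21) pmf \<Rightarrow> ('x2 \<times> 'y12 \<times> 'y22) pmf \<Rightarrow>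
   ('x1 \<Rightarrow> 'z11 \<Rightarrow> real) \<Rightarrow> ('x2 \<Rightarrow> 'z12 \<Rightarrow> real) \<Rightarrow>
   ('x1 \<Rightarrow> 'z21 \<Rightarrow> real) \<Rightarrow> ('x2 \<Rightarrow> 'z22 \<Rightarrow> real) \<Rightarrow> (nat \<Rightarrow> nat \<Rightarrow> real) \<Rightarrow> ereal" where
  "Rach P1 P2 d11 d12 d21 d22 D = lower_convex_envelope (Rach0 P1 P2 d11 d12 d21 d22) D"

end

theory Submission
  imports Defs
begin

text \<open>
  Converse: take the given law itself in the supremum. For \<open>(V, U\<^sub>1, U\<^sub>2)\<close> admissible in the lower
  bound put \<open>W\<^sub>1 = (V, U\<^sub>2, Y\<^sub>2\<^sub>2)\<close>, \<open>U\<^sub>1' = (U\<^sub>1, Y\<^sub>1\<^sub>2)\<close> and \<open>W\<^sub>2 = (V, U\<^sub>1, Y\<^sub>1\<^sub>1)\<close>, \<open>U\<^sub>2' = (U\<^sub>2, Y\<^sub>2\<^sub>1)\<close>.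
  Degradedness and independence of the components turn the chain rule for the two orders of decoding
  into \<open>R\<^sup>M\<^sub>1\<close> and \<open>R\<^sup>M\<^sub>2\<close> of these variables, and both are sums over the components, so the components
  may be made independent. Cardinalities are reduced by reweighting with a density that depends on
  \<open>W\<close> (then on \<open>U\<close>) only: conditional entropies given \<open>W\<close> are linear in it, so a basic solution of a
  linear program does the job. For bounded alphabets everything is continuous on a compact set, which
  lets the slack in the distortions tend to 0.

  Achievability: \<open>U{1,2} = (W\<^sub>1, W\<^sub>2)\<close>, \<open>U{1} = U\<^sub>1\<close>, \<open>U{2} = U\<^sub>2\<close>, encoded in this order,
  with binning rates \<open>min (I(W; Y\<^sub>1)) (I(W; Y\<^sub>2))\<close>, \<open>I(U\<^sub>1; W, Y\<^sub>1)\<close> and \<open>I(U\<^sub>2; W, Y\<^sub>2)\<close>.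
\<close>

text \<open>Constraint (3) dictates the auxiliary variables of the converse. In each component the
  weaker decoder must reconstruct from \<open>W\<close> and its own side information alone, so
  \<open>W\<close> receives everything else this decoder sees, and \<open>U\<close> receives the
  rest of what the stronger decoder sees. The entries taken from the other component respect (1)
  because the components of the source are independent. Both \<open>W\<close>'s contain
  \<open>V\<close> and are in general dependent; only the two component marginals are kept, and no
  rate term or distortion is lost, since each of them lives in one component.

  The cardinality bounds do more than shorten the alphabets: they do not depend on the slack, and
  that is what confines all laws to one compact set. The decoders vary with the slack as well, but
  on bounded alphabets there are only finitely many of them. A limit law with exact distortions
  exists in this way, so distortions that are attainable only up to every positive slack are covered
  too.

  In the coding scheme both decoders recover the layer (W1, W2), so its binning rate is limited by
  the worse of them. This minimum, subtracted from I(X; W), is the origin of the maximum in the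
  bound.\<close>

section \<open>Entropy of kernels\<close>

text \<open>Entropy depends on a variable only through the equivalence relation of having the same value.
  Joint variables are intersections of such relations, so entropies of tuples of variables
  of different types are identified by rewriting modulo associativity, commutativity and
  idempotence of intersection.\<close>

definition rker :: "('o \<Rightarrow> 'a) \<Rightarrow> ('o \<times> 'o) set" where
  "rker A = {(\<omega>, \<omega>'). A \<omega> = A \<omega>'}"

definition Hker :: "'o pmf \<Rightarrow> ('o \<times> 'o) set \<Rightarrow> real" where
  "Hker M K = - (\<Sum>\<omega>\<in>set_pmf M. pmf M \<omega> * log 2 (measure_pmf.prob M (K `` {\<omega>})))"

lemma rker_pair [simp]: "rker (\<lambda>\<omega>. (A \<omega>, B \<omega>)) = rker A \<inter> rker B"
  by (auto simp: rker_def)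

lemma rker_const [simp]: "rker (\<lambda>_. c) = UNIV"
  by (auto simp: rker_def)

lemma equiv_rker [simp]: "equiv UNIV (rker A)"
  by (auto simp: rker_def equiv_def refl_on_def sym_def trans_def)

lemma equiv_UNIV_Int [simp]: "equiv UNIV K \<Longrightarrow> equiv UNIV L \<Longrightarrow> equiv UNIV (K \<inter> L)"
  by (simp add: equiv_def refl_on_Int[of UNIV _ UNIV, simplified] sym_Int trans_Int)

lemma equiv_UNIV_UNIV [simp]: "equiv UNIV UNIV"
  by (auto simp: equiv_def refl_on_def sym_def trans_def)

text \<open>Every equivalence relation is the kernel of its class map. Inequalities proved for
  random variables thereby hold for arbitrary relations, without a variable to represent
  them.\<close>

lemma rker_class: "equiv UNIV K \<Longrightarrow> rker (\<lambda>\<omega>. K `` {\<omega>}) = K"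
  by (auto simp: rker_def eq_equiv_class_iff[of UNIV K])

lemma Image_rker: "rker A `` {\<omega>} = {\<omega>'. A \<omega>' = A \<omega>}"
  by (auto simp: rker_def)

lemma mis_pr_rker: "mis_pr M A (A \<omega>) = measure_pmf.prob M (rker A `` {\<omega>})"
  by (simp add: mis_pr_def Image_rker)

lemma mis_pr_nonneg [simp]: "0 \<le> mis_pr M A a"
  by (simp add: mis_pr_def)

lemma mis_pr_sum:
  assumes "finite (set_pmf M)"
  shows "mis_pr M A a = (\<Sum>\<omega>\<in>{\<omega>\<in>set_pmf M. A \<omega> = a}. pmf M \<omega>)"
proof -
  \<comment> \<open>The outcome type may be infinite; intersecting with the support makes the event
    finite.\<close>
  have "mis_pr M A a = measure_pmf.prob M ({\<omega>. A \<omega> = a} \<inter> set_pmf M)"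
    by (simp add: mis_pr_def measure_Int_set_pmf)
  also have "\<dots> = (\<Sum>\<omega>\<in>{\<omega>. A \<omega> = a} \<inter> set_pmf M. pmf M \<omega>)"
    using assms by (intro measure_measure_pmf_finite) auto
  also have "{\<omega>. A \<omega> = a} \<inter> set_pmf M = {\<omega>\<in>set_pmf M. A \<omega> = a}" by auto
  finally show ?thesis .
qed

lemma mis_pr_pos: "\<omega> \<in> set_pmf M \<Longrightarrow> 0 < mis_pr M A (A \<omega>)"
  unfolding mis_pr_def by (rule measure_pmf_posI) auto

lemma prob_class_pos: "equiv UNIV K \<Longrightarrow> \<omega> \<in> set_pmf M \<Longrightarrow> 0 < measure_pmf.prob M (K `` {\<omega>})"
  by (rule measure_pmf_posI) (auto simp: equiv_def refl_on_def)

lemma mis_pr_eq_0: "a \<notin> A ` set_pmf M \<Longrightarrow> mis_pr M A a = 0"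
  by (auto simp: mis_pr_def measure_pmf_zero_iff)

lemma sum_mis_pr:
  assumes "finite (set_pmf M)"
  shows "(\<Sum>a\<in>A ` set_pmf M. mis_pr M A a * f a) = (\<Sum>\<omega>\<in>set_pmf M. pmf M \<omega> * f (A \<omega>))"
  by (subst sum.image_gen[OF assms, of _ A])
    (auto intro!: sum.cong simp: mis_pr_sum[OF assms] sum_distrib_right)

lemma sum_mis_pr_1:
  assumes "finite (set_pmf M)"
  shows "(\<Sum>a\<in>A ` set_pmf M. mis_pr M A a) = 1"
  using sum_mis_pr[OF assms, of A "\<lambda>_. 1"] by (simp add: sum_pmf_eq_1 assms)

lemma mis_pr_marginal:
  assumes "finite (set_pmf M)"
  shows "(\<Sum>a\<in>A ` set_pmf M. mis_pr M (\<lambda>\<omega>. (A \<omega>, C \<omega>)) (a, c)) = mis_pr M C c"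
proof -
  have "(\<Sum>a\<in>A ` set_pmf M. mis_pr M (\<lambda>\<omega>. (A \<omega>, C \<omega>)) (a, c))
      = (\<Sum>a\<in>A ` set_pmf M. \<Sum>\<omega>\<in>{\<omega> \<in> {\<omega>\<in>set_pmf M. C \<omega> = c}. A \<omega> = a}. pmf M \<omega>)"
    unfolding mis_pr_sum[OF assms] by (intro sum.cong) auto
  also have "\<dots> = mis_pr M C c"
    unfolding mis_pr_sum[OF assms] using assms by (intro sum.group) auto
  finally show ?thesis .
qed

lemma mis_H_Hker:
  assumes "finite (set_pmf M)"
  shows "mis_H M A = Hker M (rker A)"
  unfolding mis_H_def Hker_def sum_mis_pr[OF assms] by (simp add: mis_pr_rker)

lemma mis_condH_Hker:
  assumes "finite (set_pmf M)"
  shows "mis_condH M A C = Hker M (rker A \<inter> rker C) - Hker M (rker C)"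
proof -
  have "mis_condH M A C = - (\<Sum>\<omega>\<in>set_pmf M. pmf M \<omega> *
      log 2 (mis_pr M (\<lambda>\<omega>. (A \<omega>, C \<omega>)) (A \<omega>, C \<omega>) / mis_pr M C (C \<omega>)))"
    unfolding mis_condH_def sum_mis_pr[OF assms] by simp
  also have "\<dots> = - (\<Sum>\<omega>\<in>set_pmf M. pmf M \<omega> * log 2 (mis_pr M (\<lambda>\<omega>. (A \<omega>, C \<omega>)) (A \<omega>, C \<omega>))
      - pmf M \<omega> * log 2 (mis_pr M C (C \<omega>)))"
  proof (intro arg_cong[of _ _ uminus] sum.cong refl)
    fix \<omega> assume "\<omega> \<in> set_pmf M"
    from mis_pr_pos[OF this, of C] mis_pr_pos[OF this, of "\<lambda>\<omega>. (A \<omega>, C \<omega>)"]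
    show "pmf M \<omega> * log 2 (mis_pr M (\<lambda>\<omega>. (A \<omega>, C \<omega>)) (A \<omega>, C \<omega>) / mis_pr M C (C \<omega>))
      = pmf M \<omega> * log 2 (mis_pr M (\<lambda>\<omega>. (A \<omega>, C \<omega>)) (A \<omega>, C \<omega>)) - pmf M \<omega> * log 2 (mis_pr M C (C \<omega>))"
      by (simp add: log_divide_pos algebra_simps)
  qed
  also have "\<dots> = Hker M (rker A \<inter> rker C) - Hker M (rker C)"
    unfolding Hker_def rker_pair[symmetric] mis_pr_rker[symmetric] by (simp add: sum_subtractf)
  finally show ?thesis .
qed

text \<open>Conditional mutual information of \<open>K\<close> and \<open>L\<close> given
  \<open>N\<close>, as a combination of entropies. Chain rules become linear identities between
  \<open>Hker\<close> terms once the intersections are normalised.\<close>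

definition Iker :: "'o pmf \<Rightarrow> ('o \<times> 'o) set \<Rightarrow> ('o \<times> 'o) set \<Rightarrow> ('o \<times> 'o) set \<Rightarrow> real" where
  "Iker M K L N = Hker M (K \<inter> N) + Hker M (L \<inter> N) - Hker M (K \<inter> L \<inter> N) - Hker M N"

lemma mis_I_Iker:
  assumes "finite (set_pmf M)"
  shows "mis_I M A B C = Iker M (rker A) (rker B) (rker C)"
proof -
  let ?T = "\<lambda>\<omega>. (A \<omega>, B \<omega>, C \<omega>)"
  let ?l = "\<lambda>A \<omega>. log 2 (mis_pr M A (A \<omega>))"
  have "mis_I M A B C = (\<Sum>t\<in>?T ` set_pmf M. mis_pr M ?T t * (case t of (a, b, c) \<Rightarrow>
        log 2 (mis_pr M ?T (a, b, c) * mis_pr M C c /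
               (mis_pr M (\<lambda>\<omega>. (A \<omega>, C \<omega>)) (a, c) * mis_pr M (\<lambda>\<omega>. (B \<omega>, C \<omega>)) (b, c)))))"
    unfolding mis_I_def by (intro sum.cong) (auto split: prod.splits)
  also have "\<dots> = (\<Sum>\<omega>\<in>set_pmf M. pmf M \<omega> * log 2 (mis_pr M ?T (?T \<omega>) * mis_pr M C (C \<omega>) /
      (mis_pr M (\<lambda>\<omega>. (A \<omega>, C \<omega>)) (A \<omega>, C \<omega>) * mis_pr M (\<lambda>\<omega>. (B \<omega>, C \<omega>)) (B \<omega>, C \<omega>))))"
    unfolding sum_mis_pr[OF assms] by simp
  also have "\<dots> = (\<Sum>\<omega>\<in>set_pmf M. pmf M \<omega> * ?l ?T \<omega> + pmf M \<omega> * ?l C \<omega>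
      - pmf M \<omega> * ?l (\<lambda>\<omega>. (A \<omega>, C \<omega>)) \<omega> - pmf M \<omega> * ?l (\<lambda>\<omega>. (B \<omega>, C \<omega>)) \<omega>)"
  proof (intro sum.cong refl)
    fix \<omega> assume w: "\<omega> \<in> set_pmf M"
    have "mis_pr M ?T (?T \<omega>) > 0" "mis_pr M C (C \<omega>) > 0"
      "mis_pr M (\<lambda>\<omega>. (A \<omega>, C \<omega>)) (A \<omega>, C \<omega>) > 0" "mis_pr M (\<lambda>\<omega>. (B \<omega>, C \<omega>)) (B \<omega>, C \<omega>) > 0"
      using mis_pr_pos[OF w, of ?T] mis_pr_pos[OF w, of C] mis_pr_pos[OF w, of "\<lambda>\<omega>. (A \<omega>, C \<omega>)"]
        mis_pr_pos[OF w, of "\<lambda>\<omega>. (B \<omega>, C \<omega>)"] by auto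
    then show "pmf M \<omega> * log 2 (mis_pr M ?T (?T \<omega>) * mis_pr M C (C \<omega>) /
      (mis_pr M (\<lambda>\<omega>. (A \<omega>, C \<omega>)) (A \<omega>, C \<omega>) * mis_pr M (\<lambda>\<omega>. (B \<omega>, C \<omega>)) (B \<omega>, C \<omega>)))
      = pmf M \<omega> * ?l ?T \<omega> + pmf M \<omega> * ?l C \<omega>
      - pmf M \<omega> * ?l (\<lambda>\<omega>. (A \<omega>, C \<omega>)) \<omega> - pmf M \<omega> * ?l (\<lambda>\<omega>. (B \<omega>, C \<omega>)) \<omega>"
      by (simp add: log_divide_pos log_mult_pos algebra_simps)
  qed
  also have "\<dots> = Iker M (rker A) (rker B) (rker C)"
  proof -
    have T: "rker A \<inter> rker B \<inter> rker C = rker ?T" by (simp add: Int_assoc)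
    show ?thesis
      unfolding Iker_def T Hker_def rker_pair[of A C, symmetric] rker_pair[of B C, symmetric] mis_pr_rker[symmetric]
      by (simp add: sum_subtractf sum.distrib)
  qed
  finally show ?thesis .
qed

text \<open>Gibbs' inequality: \<open>ln 2 * I\<close> is the sum over all triples of the pointwise nonnegative
  quantities \<open>p ln (p / q) - p + q\<close>, each of which vanishes only for \<open>p = q\<close>.\<close>

lemma mis_I_gibbs:
  assumes fin: "finite (set_pmf M)"
  shows mis_I_nonneg: "0 \<le> mis_I M A B C"
    and mis_I_eq_0_imp_markov: "mis_I M A B C = 0 \<Longrightarrow> mis_markov M A C B"
proof -
  let ?S = "set_pmf M"
  let ?T = "\<lambda>\<omega>. (A \<omega>, B \<omega>, C \<omega>)"
  define p where "p = mis_pr M ?T"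
  define ac where "ac = mis_pr M (\<lambda>\<omega>. (A \<omega>, C \<omega>))"
  define bc where "bc = mis_pr M (\<lambda>\<omega>. (B \<omega>, C \<omega>))"
  define r where "r = mis_pr M C"
  define q where "q = (\<lambda>(a, b, c). ac (a, c) * bc (b, c) / r c)"
  \<comment> \<open>The sum runs over the product of the three ranges and not only over the triples
    of positive probability: there \<open>q\<close> has total mass exactly 1, and a vanishing sum
    also forces \<open>q = 0\<close> at the triples that never occur, as the Markov property
    requires.\<close>
  define Bx where "Bx = A ` ?S \<times> B ` ?S \<times> C ` ?S"
  define dl where "dl t = p t * ln (p t / q t) - p t + q t" for t
  have finB: "finite Bx" using fin by (simp add: Bx_def)
  have TB: "?T ` ?S \<subseteq> Bx" by (auto simp: Bx_def)
  have p0: "p t = 0" if "t \<notin> ?T ` ?S" for t using that by (simp add: p_def mis_pr_eq_0)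
  have q0: "0 \<le> q t" for t by (auto simp: q_def ac_def bc_def r_def split: prod.splits)
  have pn: "0 \<le> p t" for t by (simp add: p_def)
  have qpos: "0 < q t" "0 < p t" "0 < r (snd (snd t))" if "t \<in> ?T ` ?S" for t
  proof -
    from that obtain \<omega> where w: "\<omega> \<in> ?S" "t = ?T \<omega>" by auto
    show "0 < q t" "0 < p t" "0 < r (snd (snd t))"
      using mis_pr_pos[OF w(1), of ?T] mis_pr_pos[OF w(1), of C] mis_pr_pos[OF w(1), of "\<lambda>\<omega>. (A \<omega>, C \<omega>)"]
        mis_pr_pos[OF w(1), of "\<lambda>\<omega>. (B \<omega>, C \<omega>)"]
      by (auto simp: q_def ac_def bc_def r_def p_def w(2))
  qed
  have dl_nonneg: "0 \<le> dl t" and dl_zero: "dl t = 0 \<Longrightarrow> p t = q t" for t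
  proof -
    have "0 \<le> dl t \<and> (dl t = 0 \<longrightarrow> p t = q t)"
    proof (cases "t \<in> ?T ` ?S")
      case False
      then show ?thesis using p0[OF False] q0[of t] by (simp add: dl_def)
    next
      case True
      note pos = qpos[OF True]
      have l: "ln (p t / q t) = - ln (q t / p t)" using pos by (simp add: ln_div)
      have "ln (q t / p t) \<le> q t / p t - 1" using pos by (intro ln_le_minus_one) simp
      then have "p t * ln (q t / p t) \<le> p t * (q t / p t - 1)" using pos by (intro mult_left_mono) auto
      then have 1: "0 \<le> dl t" using pos by (simp add: dl_def l algebra_simps)
      have "p t = q t" if "dl t = 0"
      proof -
        have "p t * ln (q t / p t) = p t * (q t / p t - 1)"
          using that pos by (simp add: dl_def l algebra_simps)
        then have "ln (q t / p t) = q t / p t - 1" using pos by simp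
        then have "q t / p t = 1" using pos by (intro ln_eq_minus_one) auto
        then show ?thesis using pos by simp
      qed
      with 1 show ?thesis by simp
    qed
    then show "0 \<le> dl t" "dl t = 0 \<Longrightarrow> p t = q t" by auto
  qed
  have sp: "(\<Sum>t\<in>Bx. p t) = 1"
  proof -
    have "(\<Sum>t\<in>Bx. p t) = (\<Sum>t\<in>?T ` ?S. p t)"
      using finB TB p0 by (intro sum.mono_neutral_right) auto
    then show ?thesis using sum_mis_pr_1[OF fin, of ?T] by (simp add: p_def)
  qed
  have sq: "(\<Sum>t\<in>Bx. q t) = 1"
  proof -
    have "(\<Sum>t\<in>Bx. q t) = (\<Sum>a\<in>A ` ?S. \<Sum>b\<in>B ` ?S. \<Sum>c\<in>C ` ?S. ac (a, c) * bc (b, c) / r c)"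
      by (simp add: Bx_def sum.cartesian_product q_def)
    also have "\<dots> = (\<Sum>a\<in>A ` ?S. \<Sum>c\<in>C ` ?S. \<Sum>b\<in>B ` ?S. ac (a, c) * bc (b, c) / r c)"
      by (intro sum.cong sum.swap refl)
    also have "\<dots> = (\<Sum>c\<in>C ` ?S. \<Sum>a\<in>A ` ?S. \<Sum>b\<in>B ` ?S. ac (a, c) * bc (b, c) / r c)"
      by (rule sum.swap)
    also have "\<dots> = (\<Sum>c\<in>C ` ?S. (\<Sum>a\<in>A ` ?S. ac (a, c)) * (\<Sum>b\<in>B ` ?S. bc (b, c)) / r c)"
      by (simp add: sum_product sum_divide_distrib)
    also have "\<dots> = (\<Sum>c\<in>C ` ?S. r c)"
      unfolding ac_def bc_def mis_pr_marginal[OF fin] r_def by (intro sum.cong) auto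
    also have "\<dots> = 1" using sum_mis_pr_1[OF fin] by (simp add: r_def)
    finally show ?thesis .
  qed
  have I: "ln 2 * mis_I M A B C = (\<Sum>t\<in>Bx. dl t)"
  proof -
    have "ln 2 * mis_I M A B C = (\<Sum>t\<in>?T ` ?S. p t * ln (p t / q t))"
      unfolding mis_I_def sum_distrib_left
    proof (intro sum.cong refl)
      fix t assume t: "t \<in> ?T ` ?S"
      obtain a b c where abc: "t = (a, b, c)" by (cases t)
      have "p t / q t = p t * r c / (ac (a, c) * bc (b, c))" by (simp add: q_def abc)
      then show "ln 2 * (case t of (a, b, c) \<Rightarrow>
        mis_pr M ?T (a, b, c) * log 2 (mis_pr M ?T (a, b, c) * mis_pr M C c /
               (mis_pr M (\<lambda>\<omega>. (A \<omega>, C \<omega>)) (a, c) * mis_pr M (\<lambda>\<omega>. (B \<omega>, C \<omega>)) (b, c))))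
        = p t * ln (p t / q t)"
        by (simp add: abc p_def r_def ac_def bc_def log_def)
    qed
    also have "\<dots> = (\<Sum>t\<in>Bx. p t * ln (p t / q t))"
      using finB TB p0 by (intro sum.mono_neutral_left) auto
    also have "\<dots> = (\<Sum>t\<in>Bx. dl t)"
      using sp sq by (simp add: dl_def sum.distrib sum_subtractf)
    finally show ?thesis .
  qed
  have "0 \<le> ln 2 * mis_I M A B C" unfolding I by (intro sum_nonneg dl_nonneg)
  then show "0 \<le> mis_I M A B C" by (simp add: zero_le_mult_iff)
  assume "mis_I M A B C = 0"
  with I have "(\<Sum>t\<in>Bx. dl t) = 0" by simp
  then have "\<forall>t\<in>Bx. dl t = 0" using finB dl_nonneg by (simp add: sum_nonneg_eq_0_iff)
  then have pq: "p t = q t" if "t \<in> Bx" for t using that dl_zero by auto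
  have swap: "mis_pr M (\<lambda>\<omega>. (A \<omega>, C \<omega>, B \<omega>)) (a, c, b) = p (a, b, c)"
       "mis_pr M (\<lambda>\<omega>. (C \<omega>, B \<omega>)) (c, b) = bc (b, c)" for a b c
    unfolding p_def bc_def mis_pr_def by (auto intro!: arg_cong[of _ _ "measure_pmf.prob M"])
  show "mis_markov M A C B"
    unfolding mis_markov_def swap ac_def[symmetric] r_def[symmetric]
  proof (intro allI)
    fix a c b
    show "p (a, b, c) * r c = ac (a, c) * bc (b, c)"
    \<comment> \<open>Outside \<open>Bx\<close> one of the three values never occurs, and both sides
      of the Markov equation vanish.\<close>
    proof (cases "(a, b, c) \<in> Bx")
      case True
      then have "r c > 0" using mis_pr_pos[of _ M C] by (auto simp: Bx_def r_def)
      then show ?thesis using pq[OF True] by (simp add: q_def)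
    next
      case False
      then have "p (a, b, c) = 0" using p0 TB by blast
      moreover have "ac (a, c) = 0 \<or> bc (b, c) = 0"
      proof (cases "a \<in> A ` ?S \<and> c \<in> C ` ?S")
        case True
        with False have "b \<notin> B ` ?S" by (auto simp: Bx_def)
        then show ?thesis unfolding bc_def by (intro disjI2 mis_pr_eq_0) auto
      next
        case False
        then show ?thesis unfolding ac_def by (intro disjI1 mis_pr_eq_0) auto
      qed
      ultimately show ?thesis by auto
    qed
  qed
qed

lemma mis_markov_imp_mis_I:
  assumes "mis_markov M A C B"
  shows "mis_I M A B C = 0"
  unfolding mis_I_def
proof (intro sum.neutral ballI)
  let ?T = "\<lambda>\<omega>. (A \<omega>, B \<omega>, C \<omega>)"
  fix t assume "t \<in> ?T ` set_pmf M"
  then obtain \<omega> where w: "\<omega> \<in> set_pmf M" "t = ?T \<omega>" by auto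
  have swap: "mis_pr M (\<lambda>\<omega>. (A \<omega>, C \<omega>, B \<omega>)) (a, c, b) = mis_pr M ?T (a, b, c)"
       "mis_pr M (\<lambda>\<omega>. (C \<omega>, B \<omega>)) (c, b) = mis_pr M (\<lambda>\<omega>. (B \<omega>, C \<omega>)) (b, c)" for a b c
    unfolding mis_pr_def by (auto intro!: arg_cong[of _ _ "measure_pmf.prob M"])
  have "mis_pr M ?T (?T \<omega>) * mis_pr M C (C \<omega>) =
      mis_pr M (\<lambda>\<omega>. (A \<omega>, C \<omega>)) (A \<omega>, C \<omega>) * mis_pr M (\<lambda>\<omega>. (B \<omega>, C \<omega>)) (B \<omega>, C \<omega>)"
    using assms unfolding mis_markov_def swap by simp
  moreover have "mis_pr M (\<lambda>\<omega>. (A \<omega>, C \<omega>)) (A \<omega>, C \<omega>) > 0"  "mis_pr M (\<lambda>\<omega>. (B \<omega>, C \<omega>)) (B \<omega>, C \<omega>) > 0"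
    using mis_pr_pos[OF w(1), of "\<lambda>\<omega>. (A \<omega>, C \<omega>)"] mis_pr_pos[OF w(1), of "\<lambda>\<omega>. (B \<omega>, C \<omega>)"] by auto
  ultimately show "(case t of (a, b, c) \<Rightarrow>
        mis_pr M ?T (a, b, c) * log 2 (mis_pr M ?T (a, b, c) * mis_pr M C c /
               (mis_pr M (\<lambda>\<omega>. (A \<omega>, C \<omega>)) (a, c) * mis_pr M (\<lambda>\<omega>. (B \<omega>, C \<omega>)) (b, c)))) = 0"
    by (simp add: w(2))
qed

text \<open>The bridge between the two languages: a Markov chain is a vanishing conditional mutual
  information. The middle variable of \<open>mis_markov\<close> becomes the last argument of
  \<open>Iker\<close>.\<close>

lemma mis_markov_iff_Iker:
  assumes "finite (set_pmf M)"
  shows "mis_markov M A C B \<longleftrightarrow> Iker M (rker A) (rker B) (rker C) = 0"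
  using mis_I_eq_0_imp_markov[OF assms, of A B C] mis_markov_imp_mis_I[of M A C B]
  unfolding mis_I_Iker[OF assms] by blast

lemma Iker_nonneg:
  assumes "finite (set_pmf M)" "equiv UNIV K" "equiv UNIV L" "equiv UNIV N"
  shows "0 \<le> Iker M K L N"
  using mis_I_nonneg[OF assms(1), of "\<lambda>\<omega>. K `` {\<omega>}" "\<lambda>\<omega>. L `` {\<omega>}" "\<lambda>\<omega>. N `` {\<omega>}"]
  by (simp add: mis_I_Iker[OF assms(1)] rker_class assms)

lemma Hker_UNIV [simp]: "Hker M UNIV = 0"
proof -
  have "(UNIV :: ('a \<times> 'a) set) `` {\<omega>} = UNIV" for \<omega> by auto
  then show ?thesis by (simp add: Hker_def)
qed

lemma Iker_sym: "Iker M K L N = Iker M L K N"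
  by (simp add: Iker_def Int_commute[of L K])

text \<open>The chain rule splits the vanishing information into three nonnegative terms, so each of
  them vanishes. \<open>L''\<close> is the part to be discarded and \<open>L'\<close> the part to be
  moved into the condition.\<close>

lemma Iker_zero_mono:
  assumes "finite (set_pmf M)" "equiv UNIV K" "equiv UNIV L" "equiv UNIV L'" "equiv UNIV L''" "equiv UNIV N"
    and "Iker M K (L \<inter> L' \<inter> L'') N = 0"
  shows "Iker M K L (L' \<inter> N) = 0"
proof -
  have "0 \<le> Iker M K L (L' \<inter> N)" "0 \<le> Iker M K L' N" "0 \<le> Iker M K L'' (L \<inter> L' \<inter> N)"
    using assms by (auto intro!: Iker_nonneg)
  moreover have "Iker M K (L \<inter> L' \<inter> L'') N = Iker M K L (L' \<inter> N) + Iker M K L' N + Iker M K L'' (L \<inter> L' \<inter> N)"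
    by (simp add: Iker_def Int_ac)
  ultimately show ?thesis using assms(7) by linarith
qed

text \<open>Functions of independent variables remain independent: a coarser relation is a function
  of the finer one.\<close>

lemma Iker_zero_mono_both:
  assumes "finite (set_pmf M)" "equiv UNIV K" "equiv UNIV K'" "equiv UNIV L" "equiv UNIV L'" "equiv UNIV N"
    and "Iker M K' L' N = 0" and "K' \<subseteq> K" "L' \<subseteq> L"
  shows "Iker M K L N = 0"
proof -
  have "Iker M K' L N = 0"
    using Iker_zero_mono[of M K' L UNIV L' N] assms by (simp add: Int_absorb1)
  then have "Iker M L K' N = 0" by (subst Iker_sym)
  then have "Iker M L K N = 0"
    using Iker_zero_mono[of M L K UNIV K' N] assms by (simp add: Int_absorb1)
  then show ?thesis by (subst Iker_sym)
qed

section \<open>The converse inequality\<close>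

text \<open>The chain rule gives I(y1; x2, y2, a | x1) = I(y1; x2, y2 | x1) + I(y1; a | x1, x2, y2).
  The first term vanishes by independence of the components, the second because \<open>a\<close> is
  produced from the source alone.\<close>

lemma component_markov:
  assumes fin: "finite (set_pmf M)"
    and eq: "equiv UNIV x1" "equiv UNIV y1" "equiv UNIV x2" "equiv UNIV y2" "equiv UNIV a"
    and ind: "Iker M (x1 \<inter> y1) (x2 \<inter> y2) UNIV = 0"
    and mk: "Iker M (y1 \<inter> y2) a (x1 \<inter> x2) = 0"
  shows "Iker M y1 (x2 \<inter> y2 \<inter> a) x1 = 0"
proof -
  have "Iker M (x2 \<inter> y2) (y1 \<inter> x1 \<inter> UNIV) UNIV = 0"
    using ind by (subst Iker_sym) (simp add: Int_ac)
  then have "Iker M (x2 \<inter> y2) y1 (x1 \<inter> UNIV) = 0"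
    by (rule Iker_zero_mono[rotated -1]) (use fin eq in auto)
  then have 1: "Iker M y1 (x2 \<inter> y2) x1 = 0" by (subst Iker_sym) simp
  have "Iker M a (y1 \<inter> y2 \<inter> UNIV) (x1 \<inter> x2) = 0"
    using mk by (subst Iker_sym) simp
  then have "Iker M a y1 (y2 \<inter> (x1 \<inter> x2)) = 0"
    by (rule Iker_zero_mono[rotated -1]) (use fin eq in auto)
  then have 2: "Iker M y1 a (y2 \<inter> (x1 \<inter> x2)) = 0" by (subst Iker_sym) simp
  have "Iker M y1 (x2 \<inter> y2 \<inter> a) x1 = Iker M y1 (x2 \<inter> y2) x1 + Iker M y1 a (y2 \<inter> (x1 \<inter> x2))"
    by (simp add: Iker_def Int_ac)
  with 1 2 show ?thesis by simp
qed

text \<open>By the chain rule I(z; x, a | y) = I(z; x | y) + I(z; a | x, y). Degradedness kills the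
  first term and the Markov chain through \<open>x\<close> the second, so the weaker side
  information \<open>z\<close> tells nothing new once \<open>y\<close> is known.\<close>

lemma degraded_markov:
  assumes fin: "finite (set_pmf M)"
    and eq: "equiv UNIV x" "equiv UNIV y" "equiv UNIV z" "equiv UNIV a"
    and mk: "Iker M (y \<inter> z) a x = 0" and dg: "Iker M x z y = 0"
  shows "Iker M z (x \<inter> a) y = 0"
proof -
  have "Iker M a (z \<inter> y \<inter> UNIV) x = 0"
    using mk by (subst Iker_sym) (simp add: Int_ac)
  then have "Iker M a z (y \<inter> x) = 0"
    by (rule Iker_zero_mono[rotated -1]) (use fin eq in auto)
  then have 1: "Iker M z a (y \<inter> x) = 0" by (subst Iker_sym) simp
  have "Iker M z (x \<inter> a) y = Iker M x z y + Iker M z a (y \<inter> x)"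
    by (simp add: Iker_def Int_ac)
  with 1 dg show ?thesis by simp
qed

text \<open>On the right, the chain rule takes \<open>x2\<close> before \<open>x1\<close>,
  conditioning on \<open>x2\<close> for the latter. The \<open>x2\<close> terms then dominate the
  first two summands on the left. Adjoining \<open>x2\<close>, \<open>y12\<close>,
  \<open>y22\<close> and \<open>y21\<close> to the \<open>x1\<close> terms costs nothing and makes
  them I(x1; v, u1, u2, x2, y12, y21, y22 | y11), which dominates the last two summands: these add
  up to I(x1; v, u1, u2, y12, y22 | y11).\<close>

lemma converse_inequality:
  assumes fin: "finite (set_pmf M)"
    and eq: "equiv UNIV x1" "equiv UNIV y11" "equiv UNIV y21" "equiv UNIV x2" "equiv UNIV y12" "equiv UNIV y22"
      "equiv UNIV v" "equiv UNIV u1" "equiv UNIV u2"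
    and ind: "Iker M (x1 \<inter> (y11 \<inter> y21)) (x2 \<inter> (y12 \<inter> y22)) UNIV = 0"
    and mk: "Iker M ((y11 \<inter> y21) \<inter> (y12 \<inter> y22)) (v \<inter> u1 \<inter> u2) (x1 \<inter> x2) = 0"
    and dg1: "Iker M x1 y21 y11 = 0" and dg2: "Iker M x2 y12 y22 = 0"
  shows "Iker M x2 (v \<inter> u1 \<inter> y11) y12 + Iker M x2 (u2 \<inter> y21) (y22 \<inter> (v \<inter> u1 \<inter> y11))
       + (Iker M x1 (v \<inter> u2 \<inter> y22) y11 + Iker M x1 (u1 \<inter> y12) (y11 \<inter> (v \<inter> u2 \<inter> y22)))
     \<le> Iker M (x1 \<inter> x2) (v \<inter> u1) (y11 \<inter> y12)
       + Iker M (x1 \<inter> x2) u2 (v \<inter> u1 \<inter> y11 \<inter> y12 \<inter> y21 \<inter> y22)"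
proof -
  let ?a = "v \<inter> u1 \<inter> u2"
  have m1: "Iker M (y11 \<inter> y21) (x2 \<inter> (y12 \<inter> y22) \<inter> ?a) x1 = 0"
    by (rule component_markov[OF fin _ _ _ _ _ ind mk]) (use eq in auto)
  have ind': "Iker M (x2 \<inter> (y12 \<inter> y22)) (x1 \<inter> (y11 \<inter> y21)) UNIV = 0"
    using ind by (subst Iker_sym)
  have mk': "Iker M ((y12 \<inter> y22) \<inter> (y11 \<inter> y21)) ?a (x2 \<inter> x1) = 0"
    using mk by (simp add: Int_ac)
  have m1': "Iker M (y12 \<inter> y22) (x1 \<inter> (y11 \<inter> y21) \<inter> ?a) x2 = 0"
    by (rule component_markov[OF fin _ _ _ _ _ ind' mk']) (use eq in auto)
  have m2: "Iker M y21 (x1 \<inter> (x2 \<inter> (y12 \<inter> y22) \<inter> ?a)) y11 = 0"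
    by (rule degraded_markov[OF fin _ _ _ _ m1 dg1]) (use eq in auto)
  have m2': "Iker M y12 (x2 \<inter> (x1 \<inter> (y11 \<inter> y21) \<inter> ?a)) y22 = 0"
    by (rule degraded_markov[OF fin _ _ _ _ _ dg2]) (use eq m1' in \<open>auto simp: Int_ac\<close>)
  note nn = Iker_nonneg[OF fin]

  \<comment> \<open>The right side minus the left side is a combination of the six vanishing terms
    established here and the two nonnegative terms at the end; the remaining identity between
    entropies is linear.\<close>
  have "Iker M x2 y11 y12 = 0"
  proof -
    have "Iker M (x1 \<inter> (y11 \<inter> y21)) (x2 \<inter> y12 \<inter> y22) UNIV = 0" using ind by (simp add: Int_ac)
    then have "Iker M (x1 \<inter> (y11 \<inter> y21)) x2 (y12 \<inter> UNIV) = 0"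
      by (rule Iker_zero_mono[rotated -1]) (use fin eq in auto)
    then have "Iker M y11 x2 y12 = 0"
      by (intro Iker_zero_mono_both[of M y11 "x1 \<inter> (y11 \<inter> y21)" x2 x2]) (use fin eq in auto)
    then show ?thesis by (subst Iker_sym)
  qed
  moreover have "Iker M y21 x2 (v \<inter> u1 \<inter> y22 \<inter> y11) = 0"
    by (rule Iker_zero_mono[where L'' = "x1 \<inter> y12 \<inter> u2"]) (use fin eq m2 in \<open>auto simp: Int_ac\<close>)
  moreover have "Iker M y12 x2 (v \<inter> u1 \<inter> y11 \<inter> y21 \<inter> y22) = 0"
    by (rule Iker_zero_mono[where L'' = "x1 \<inter> u2"]) (use fin eq m2' in \<open>auto simp: Int_ac\<close>)
  moreover have "Iker M x1 (x2 \<inter> y12) y11 = 0"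
  proof -
    have "Iker M (x2 \<inter> (y12 \<inter> y22)) (x1 \<inter> y11 \<inter> y21) UNIV = 0" using ind' by (simp add: Int_ac)
    then have "Iker M (x2 \<inter> (y12 \<inter> y22)) x1 (y11 \<inter> UNIV) = 0"
      by (rule Iker_zero_mono[rotated -1]) (use fin eq in auto)
    then have "Iker M (x2 \<inter> y12) x1 y11 = 0"
      by (intro Iker_zero_mono_both[of M "x2 \<inter> y12" "x2 \<inter> (y12 \<inter> y22)" x1 x1]) (use fin eq in auto)
    then show ?thesis by (subst Iker_sym)
  qed
  moreover have "Iker M x1 y22 (v \<inter> u1 \<inter> x2 \<inter> y11 \<inter> y12) = 0"
  proof -
    have "Iker M (x1 \<inter> (y11 \<inter> y21) \<inter> ?a) (y22 \<inter> y12 \<inter> UNIV) x2 = 0"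
      using m1' by (subst Iker_sym) (simp add: Int_ac)
    then have "Iker M (x1 \<inter> (y11 \<inter> y21) \<inter> ?a) y22 (y12 \<inter> x2) = 0"
      by (rule Iker_zero_mono[rotated -1]) (use fin eq in auto)
    then have "Iker M y22 (x1 \<inter> (v \<inter> u1 \<inter> y11) \<inter> (y21 \<inter> u2)) (y12 \<inter> x2) = 0"
      by (subst Iker_sym) (simp add: Int_ac)
    then have "Iker M y22 x1 ((v \<inter> u1 \<inter> y11) \<inter> (y12 \<inter> x2)) = 0"
      by (rule Iker_zero_mono[rotated -1]) (use fin eq in auto)
    then show ?thesis by (subst Iker_sym) (simp add: Int_ac)
  qed
  moreover have "Iker M y21 x1 (v \<inter> u1 \<inter> x2 \<inter> y12 \<inter> y22 \<inter> y11) = 0"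
    by (rule Iker_zero_mono[where L'' = "u2"]) (use fin eq m2 in \<open>auto simp: Int_ac\<close>)
  \<comment> \<open>The slack of the inequality: the effect of also conditioning on
    \<open>y12\<close> in the refinement for \<open>x2\<close>, and the loss from dropping
    \<open>x2\<close> and \<open>y21\<close> in the information about \<open>x1\<close>.\<close>
  moreover have "0 \<le> Iker M x2 y12 (u2 \<inter> y21 \<inter> v \<inter> u1 \<inter> y11 \<inter> y22)"
    "0 \<le> Iker M x1 (x2 \<inter> y21) (v \<inter> u1 \<inter> u2 \<inter> y12 \<inter> y22 \<inter> y11)"
    using eq by (auto intro!: nn)
  ultimately show ?thesis
    unfolding Iker_def by (simp only: Int_ac Int_absorb Int_left_absorb)
qed

section \<open>Linear programming and change of density\<close>

text \<open>A homogeneous linear system with more unknowns than equations has a nontrivial solution;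
  the induction is Gaussian elimination.\<close>

lemma null_combination:
  fixes f :: "'i \<Rightarrow> 's \<Rightarrow> real"
  assumes "finite I" "finite S" "card I < card S"
  shows "\<exists>c. (\<exists>s\<in>S. c s \<noteq> 0) \<and> (\<forall>i\<in>I. (\<Sum>s\<in>S. c s * f i s) = 0)"
  using assms
proof (induction I arbitrary: S f rule: finite_induct)
  case empty
  then have "S \<noteq> {}" by auto
  then show ?case by (intro exI[of _ "\<lambda>_. 1"]) auto
next
  case (insert i I)
  show ?case
  proof (cases "\<forall>s\<in>S. f i s = 0")
    case True
    have "card I < card S" using insert by simp
    from insert.IH[OF insert.prems(1) this, of f] obtain c where
      "\<exists>s\<in>S. c s \<noteq> 0" "\<forall>i\<in>I. (\<Sum>s\<in>S. c s * f i s) = 0" by blast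
    then show ?thesis using True by (intro exI[of _ c]) auto
  next
    case False
    then obtain r where r: "r \<in> S" "f i r \<noteq> 0" by auto
    let ?S = "S - {r}"
    \<comment> \<open>Equation \<open>i\<close> is solved for the pivot unknown \<open>r\<close> and
      substituted into the others; \<open>k\<close> below is the value of this unknown obtained by
      back-substitution.\<close>
    define f' where "f' j s = f j s - f i s / f i r * f j r" for j s
    have "card I < card ?S" using insert r by (simp add: card_Diff_singleton)
    from insert.IH[OF _ this, of f'] insert.prems obtain c where
      c: "\<exists>s\<in>?S. c s \<noteq> 0" "\<forall>j\<in>I. (\<Sum>s\<in>?S. c s * f' j s) = 0" by blast
    define k where "k = - (\<Sum>s\<in>?S. c s * f i s) / f i r"
    let ?c = "c(r := k)"
    have sum: "(\<Sum>s\<in>S. ?c s * f j s) = k * f j r + (\<Sum>s\<in>?S. c s * f j s)" for j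
      using insert.prems r by (subst sum.remove[of _ r]) auto
    have "(\<Sum>s\<in>S. ?c s * f j s) = 0" if "j \<in> I" for j
    proof -
      have "(\<Sum>s\<in>?S. c s * f' j s) = (\<Sum>s\<in>?S. c s * f j s) - (\<Sum>s\<in>?S. c s * f i s) / f i r * f j r"
        by (simp add: f'_def algebra_simps sum_subtractf sum_distrib_left sum_divide_distrib)
      then have "k * f j r + (\<Sum>s\<in>?S. c s * f j s) = 0" using c(2) that by (simp add: k_def)
      then show ?thesis unfolding sum .
    qed
    moreover have "(\<Sum>s\<in>S. ?c s * f i s) = 0"
    proof -
      have "k * f i r + (\<Sum>s\<in>?S. c s * f i s) = 0" using r by (simp add: k_def)
      then show ?thesis unfolding sum .
    qed
    moreover have "\<exists>s\<in>S. ?c s \<noteq> 0" using c(1) by auto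
    ultimately show ?thesis by (intro exI[of _ ?c]) auto
  qed
qed

text \<open>Moving along a null direction, in the sense that does not increase the objective, a solution
  with more nonzero entries than constraints loses an entry.\<close>

lemma basic_solution:
  fixes f :: "'i \<Rightarrow> 's \<Rightarrow> real" and h p :: "'s \<Rightarrow> real"
  assumes "finite I" "finite S" "\<And>s. s \<in> S \<Longrightarrow> 0 \<le> p s"
    and pos: "\<And>s. s \<in> S \<Longrightarrow> 0 < (\<Sum>i\<in>I. l i * f i s)"
  shows "\<exists>q. (\<forall>s\<in>S. 0 \<le> q s) \<and> card {s\<in>S. q s \<noteq> 0} \<le> card I \<and>
      (\<forall>i\<in>I. (\<Sum>s\<in>S. q s * f i s) = (\<Sum>s\<in>S. p s * f i s)) \<and>
      (\<Sum>s\<in>S. q s * h s) \<le> (\<Sum>s\<in>S. p s * h s)"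
  using assms(3)
proof (induction "card {s\<in>S. p s \<noteq> 0}" arbitrary: p rule: less_induct)
  case less
  let ?T = "{s\<in>S. p s \<noteq> 0}"
  show ?case
  proof (cases "card ?T \<le> card I")
    case True
    then show ?thesis using less.prems by (intro exI[of _ p]) auto
  next
    case False
    have finT: "finite ?T" using assms by simp
    from null_combination[OF assms(1) finT, of f] False obtain c0 where
      c0: "\<exists>s\<in>?T. c0 s \<noteq> 0" "\<forall>i\<in>I. (\<Sum>s\<in>?T. c0 s * f i s) = 0" by auto
    \<comment> \<open>The sign is chosen so that the objective does not increase in the direction
      \<open>c\<close>.\<close>
    define \<sigma> :: real where "\<sigma> = (if (\<Sum>s\<in>?T. c0 s * h s) \<le> 0 then 1 else -1)"
    define c where "c s = \<sigma> * c0 s" for s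
    have c: "\<exists>s\<in>?T. c s \<noteq> 0" using c0(1) by (auto simp: c_def \<sigma>_def)
    have cf: "(\<Sum>s\<in>?T. c s * f i s) = 0" if "i \<in> I" for i
      using c0(2) that by (simp add: c_def mult.assoc flip: sum_distrib_left)
    have ch: "(\<Sum>s\<in>?T. c s * h s) \<le> 0"
      by (simp add: c_def mult.assoc \<sigma>_def flip: sum_distrib_left)
    \<comment> \<open>A nonzero direction with no negative entry would give a positive value to the
      combination of constraints with multipliers \<open>l\<close>, whose coefficients are all
      positive, whereas every constraint vanishes on \<open>c\<close>.\<close>
    have "\<exists>s\<in>?T. c s < 0"
    proof (rule ccontr)
      assume "\<not> (\<exists>s\<in>?T. c s < 0)"
      then have nn: "0 \<le> c s" if "s \<in> ?T" for s using that by force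
      have "(\<Sum>s\<in>?T. c s * (\<Sum>i\<in>I. l i * f i s)) = (\<Sum>s\<in>?T. \<Sum>i\<in>I. l i * (c s * f i s))"
        by (simp add: sum_distrib_left algebra_simps)
      also have "\<dots> = (\<Sum>i\<in>I. \<Sum>s\<in>?T. l i * (c s * f i s))" by (rule sum.swap)
      also have "\<dots> = (\<Sum>i\<in>I. l i * (\<Sum>s\<in>?T. c s * f i s))" by (simp add: sum_distrib_left)
      also have "\<dots> = 0" using cf by simp
      finally have "(\<Sum>s\<in>?T. c s * (\<Sum>i\<in>I. l i * f i s)) = 0" .
      moreover have "0 \<le> c s * (\<Sum>i\<in>I. l i * f i s)" if "s \<in> ?T" for s
        using nn[OF that] pos[of s] that by (intro mult_nonneg_nonneg) (auto intro: less_imp_le)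
      ultimately have "\<forall>s\<in>?T. c s * (\<Sum>i\<in>I. l i * f i s) = 0"
        using finT by (subst (asm) sum_nonneg_eq_0_iff) auto
      with c pos show False by force
    qed
    then have ne: "{s\<in>?T. c s < 0} \<noteq> {}" by auto
    \<comment> \<open>Ratio test: \<open>t\<close> is the largest step that keeps all entries
      nonnegative, and the minimising entry \<open>r\<close> becomes zero.\<close>
    define g where "g s = p s / (- c s)" for s
    define t where "t = Min (g ` {s\<in>?T. c s < 0})"
    have "t \<in> g ` {s\<in>?T. c s < 0}" unfolding t_def using ne assms(2) by (intro Min_in) auto
    then obtain r where r: "r \<in> S" "p r \<noteq> 0" "c r < 0" "t = g r" by auto
    have t_le: "t \<le> g s" if "s \<in> ?T" "c s < 0" for s
      unfolding t_def using that assms(2) by (intro Min_le) auto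
    have t0: "0 \<le> t" using r less.prems[of r] by (auto simp: g_def divide_le_0_iff)
    define q where "q s = (if s \<in> ?T then p s + t * c s else 0)" for s
    have q0: "0 \<le> q s" if "s \<in> S" for s
    proof (cases "s \<in> ?T \<and> c s < 0")
      case True
      then have "t \<le> p s / (- c s)" using t_le[of s] unfolding g_def by blast
      then have "t * (- c s) \<le> p s" using True pos_le_divide_eq[of "- c s" t "p s"] by simp
      then show ?thesis using True by (simp add: q_def)
    next
      case False
      then show ?thesis using t0 less.prems[OF that] by (auto simp: q_def)
    qed
    have "q r = 0" using r by (simp add: q_def g_def)
    then have "{s\<in>S. q s \<noteq> 0} \<subset> ?T" using r by (auto simp: q_def)
    then have "card {s\<in>S. q s \<noteq> 0} < card ?T" using finT by (intro psubset_card_mono)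
    from less.hyps[OF this q0] obtain q' where
      q': "\<forall>s\<in>S. 0 \<le> q' s" "card {s\<in>S. q' s \<noteq> 0} \<le> card I"
      "\<forall>i\<in>I. (\<Sum>s\<in>S. q' s * f i s) = (\<Sum>s\<in>S. q s * f i s)"
      "(\<Sum>s\<in>S. q' s * h s) \<le> (\<Sum>s\<in>S. q s * h s)" by blast
    have qs: "(\<Sum>s\<in>S. q s * k s) = (\<Sum>s\<in>S. p s * k s) + t * (\<Sum>s\<in>?T. c s * k s)" for k :: "'s \<Rightarrow> real"
    proof -
      have "(\<Sum>s\<in>S. q s * k s) = (\<Sum>s\<in>?T. q s * k s)"
        using assms(2) by (intro sum.mono_neutral_right) (auto simp: q_def)
      also have "\<dots> = (\<Sum>s\<in>?T. p s * k s) + t * (\<Sum>s\<in>?T. c s * k s)"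
        by (simp add: q_def algebra_simps sum.distrib sum_distrib_left)
      also have "(\<Sum>s\<in>?T. p s * k s) = (\<Sum>s\<in>S. p s * k s)"
        using assms(2) by (intro sum.mono_neutral_left) auto
      finally show ?thesis .
    qed
    have "t * (\<Sum>s\<in>?T. c s * h s) \<le> 0" using t0 ch by (simp add: mult_nonneg_nonpos)
    then show ?thesis using q' by (intro exI[of _ q']) (simp add: qs cf)
  qed
qed

section \<open>Reweighting a law by a density in one variable\<close>

lemma pmf_of_weights:
  fixes f :: "'o \<Rightarrow> real"
  assumes "finite S" "\<And>\<omega>. \<omega> \<in> S \<Longrightarrow> 0 \<le> f \<omega>" "\<And>\<omega>. \<omega> \<notin> S \<Longrightarrow> f \<omega> = 0" "(\<Sum>\<omega>\<in>S. f \<omega>) = 1"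
  obtains N where "\<And>\<omega>. pmf N \<omega> = f \<omega>"
proof
  have nn: "0 \<le> f \<omega>" for \<omega> using assms(2,3)[of \<omega>] by (cases "\<omega> \<in> S") auto
  have "(\<integral>\<^sup>+\<omega>. ennreal (f \<omega>) \<partial>count_space UNIV) = (\<Sum>\<omega>\<in>S. ennreal (f \<omega>))"
    using assms by (intro nn_integral_count_space') auto
  also have "\<dots> = 1" using assms nn by (subst sum_ennreal) auto
  finally show "pmf (embed_pmf f) \<omega> = f \<omega>" for \<omega> using nn by (intro pmf_embed_pmf) auto
qed

lemma expectation_sum:
  fixes f :: "'o \<Rightarrow> real"
  assumes "finite S" "set_pmf M \<subseteq> S"
  shows "measure_pmf.expectation M f = (\<Sum>\<omega>\<in>S. pmf M \<omega> * f \<omega>)"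
  using assms by (subst integral_measure_pmf_real[where A = S]) (auto simp: mult.commute)

text \<open>A linear program with one unknown per value of \<open>S\<close>, the density at that
  value; the constant density 1 solves it. The constraints are the point masses of \<open>F\<close>
  and the expectations of the \<open>e i\<close>, and the number of values of \<open>S\<close> that
  survive in a basic solution is at most the number of constraints.\<close>

lemma reweight:
  fixes N :: "'o pmf" and S :: "'o \<Rightarrow> 's" and F :: "'o \<Rightarrow> 'f" and e :: "'i \<Rightarrow> 'o \<Rightarrow> real" and h :: "'o \<Rightarrow> real"
  assumes fin: "finite (set_pmf N)" and I: "finite I"
  obtains N' t where "\<And>\<omega>. pmf N' \<omega> = t (S \<omega>) * pmf N \<omega>" "\<And>s. 0 \<le> t s"
    "map_pmf F N' = map_pmf F N"
    "card (S ` set_pmf N') \<le> card (F ` set_pmf N) + card I"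
    "\<And>i. i \<in> I \<Longrightarrow> measure_pmf.expectation N' (e i) = measure_pmf.expectation N (e i)"
    "measure_pmf.expectation N' h \<le> measure_pmf.expectation N h"
proof -
  let ?O = "set_pmf N"
  define J where "J = F ` ?O <+> I"
  define G where "G k \<omega> = (case k of Inl x \<Rightarrow> of_bool (F \<omega> = x) | Inr i \<Rightarrow> e i \<omega>)" for k \<omega>
  define f where "f g s = (\<Sum>\<omega>\<in>{\<omega>\<in>?O. S \<omega> = s}. pmf N \<omega> * g \<omega>)" for g s
  have finJ: "finite J" using fin I by (simp add: J_def)
  have "\<exists>q. (\<forall>s\<in>S ` ?O. 0 \<le> q s) \<and> card {s\<in>S ` ?O. q s \<noteq> 0} \<le> card J \<and>
      (\<forall>i\<in>J. (\<Sum>s\<in>S ` ?O. q s * f (G i) s) = (\<Sum>s\<in>S ` ?O. 1 * f (G i) s)) \<and>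
      (\<Sum>s\<in>S ` ?O. q s * f h s) \<le> (\<Sum>s\<in>S ` ?O. 1 * f h s)"
  \<comment> \<open>The constraints for the point masses of \<open>F\<close> add up to the mass of
    \<open>S = s\<close> under \<open>N\<close>, which is positive for every \<open>s\<close> in the
    range.\<close>
  proof (rule basic_solution[where l = "\<lambda>k. case k of Inl _ \<Rightarrow> 1 | Inr _ \<Rightarrow> 0"])
    fix s assume s: "s \<in> S ` ?O"
    have "(\<Sum>k\<in>J. (case k of Inl _ \<Rightarrow> 1 | Inr _ \<Rightarrow> 0) * f (G k) s) = (\<Sum>x\<in>F ` ?O. f (G (Inl x)) s)"
      unfolding J_def using fin I by (subst sum.Plus) auto
    also have "\<dots> = (\<Sum>\<omega>\<in>{\<omega>\<in>?O. S \<omega> = s}. \<Sum>x\<in>F ` ?O. pmf N \<omega> * of_bool (F \<omega> = x))"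
      unfolding f_def G_def by (subst sum.swap) simp
    also have "\<dots> = (\<Sum>\<omega>\<in>{\<omega>\<in>?O. S \<omega> = s}. pmf N \<omega>)"
    proof (intro sum.cong refl)
      fix \<omega> assume "\<omega> \<in> {\<omega>\<in>?O. S \<omega> = s}"
      then have "F \<omega> \<in> F ` ?O" by auto
      moreover have "of_bool (F \<omega> = x) = (if F \<omega> = x then 1 else 0 :: real)" for x by simp
      ultimately show "(\<Sum>x\<in>F ` ?O. pmf N \<omega> * of_bool (F \<omega> = x)) = pmf N \<omega>"
        using fin by (simp add: sum.delta' flip: sum_distrib_left)
    qed
    also have "\<dots> > 0" using s fin by (intro sum_pos) (auto simp: pmf_positive)
    finally show "0 < (\<Sum>k\<in>J. (case k of Inl _ \<Rightarrow> 1 | Inr _ \<Rightarrow> 0) * f (G k) s)" .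
  qed (use fin finJ in auto)
  then obtain q where q: "\<forall>s\<in>S ` ?O. 0 \<le> q s" "card {s\<in>S ` ?O. q s \<noteq> 0} \<le> card J"
      "\<forall>i\<in>J. (\<Sum>s\<in>S ` ?O. q s * f (G i) s) = (\<Sum>s\<in>S ` ?O. 1 * f (G i) s)"
      "(\<Sum>s\<in>S ` ?O. q s * f h s) \<le> (\<Sum>s\<in>S ` ?O. 1 * f h s)" by blast
  define t where "t s = (if s \<in> S ` ?O then q s else 0)" for s
  have t0: "0 \<le> t s" for s using q(1) by (auto simp: t_def)
  have grp: "(\<Sum>s\<in>S ` ?O. r s * f g s) = (\<Sum>\<omega>\<in>?O. r (S \<omega>) * pmf N \<omega> * g \<omega>)" for r g
    by (subst sum.image_gen[OF fin, of _ S])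
      (auto intro!: sum.cong simp: f_def sum_distrib_left algebra_simps)
  have tq: "(\<Sum>\<omega>\<in>?O. q (S \<omega>) * pmf N \<omega> * g \<omega>) = (\<Sum>\<omega>\<in>?O. t (S \<omega>) * pmf N \<omega> * g \<omega>)" for g
    by (intro sum.cong) (auto simp: t_def)
  have eqJ: "(\<Sum>\<omega>\<in>?O. t (S \<omega>) * pmf N \<omega> * G k \<omega>) = (\<Sum>\<omega>\<in>?O. pmf N \<omega> * G k \<omega>)" if "k \<in> J" for k
  proof -
    have "(\<Sum>s\<in>S ` ?O. q s * f (G k) s) = (\<Sum>s\<in>S ` ?O. 1 * f (G k) s)" using q(3) that by blast
    then show ?thesis unfolding grp tq by simp
  qed
  \<comment> \<open>The point masses of \<open>F\<close> determine the total mass, so normalisation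
    costs no further constraint.\<close>
  have sumG: "(\<Sum>\<omega>\<in>?O. w \<omega>) = (\<Sum>x\<in>F ` ?O. \<Sum>\<omega>\<in>?O. w \<omega> * G (Inl x) \<omega>)" for w :: "'o \<Rightarrow> real"
  proof -
    have "(\<Sum>x\<in>F ` ?O. \<Sum>\<omega>\<in>?O. w \<omega> * G (Inl x) \<omega>) = (\<Sum>\<omega>\<in>?O. w \<omega> * (\<Sum>x\<in>F ` ?O. (if F \<omega> = x then 1 else 0)))"
      by (subst sum.swap) (auto simp: G_def sum_distrib_left intro!: sum.cong)
    also have "\<dots> = (\<Sum>\<omega>\<in>?O. w \<omega>)" using fin by (intro sum.cong) (auto simp: sum.delta')
    finally show ?thesis by simp
  qed
  have "(\<Sum>\<omega>\<in>?O. t (S \<omega>) * pmf N \<omega>) = (\<Sum>\<omega>\<in>?O. pmf N \<omega>)"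
    unfolding sumG[of "\<lambda>\<omega>. t (S \<omega>) * pmf N \<omega>"] sumG[of "pmf N"]
    by (intro sum.cong refl eqJ) (auto simp: J_def)
  also have "\<dots> = 1" using fin by (simp add: sum_pmf_eq_1)
  finally have "(\<Sum>\<omega>\<in>?O. t (S \<omega>) * pmf N \<omega>) = 1" .
  then obtain N' where N': "\<And>\<omega>. pmf N' \<omega> = t (S \<omega>) * pmf N \<omega>"
    using pmf_of_weights[of ?O "\<lambda>\<omega>. t (S \<omega>) * pmf N \<omega>"] fin t0 by (auto simp: set_pmf_iff)
  have sub: "set_pmf N' \<subseteq> ?O" by (auto simp: set_pmf_iff N')
  have EN': "measure_pmf.expectation N' g = (\<Sum>\<omega>\<in>?O. t (S \<omega>) * pmf N \<omega> * g \<omega>)"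
    and EN: "measure_pmf.expectation N g = (\<Sum>\<omega>\<in>?O. pmf N \<omega> * g \<omega>)" for g
    using expectation_sum[OF fin sub] expectation_sum[OF fin, of N] by (auto simp: N')
  have finN': "finite (set_pmf N')" using sub fin finite_subset by blast
  show thesis
  proof
    show "pmf N' \<omega> = t (S \<omega>) * pmf N \<omega>" for \<omega> by (rule N')
    show "0 \<le> t s" for s by (rule t0)
    show "map_pmf F N' = map_pmf F N"
    proof (rule pmf_eqI)
      fix x
      have pm: "pmf (map_pmf F M) x = measure_pmf.expectation M (\<lambda>\<omega>. of_bool (F \<omega> = x))" for M :: "'o pmf"
      proof -
        have "pmf (map_pmf F M) x = measure_pmf.expectation M (indicator (F -` {x}))"
          by (simp add: pmf_map)
        also have "indicator (F -` {x}) = (\<lambda>\<omega>. of_bool (F \<omega> = x) :: real)"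
          by (auto simp: indicator_def)
        finally show ?thesis .
      qed
      show "pmf (map_pmf F N') x = pmf (map_pmf F N) x"
      proof (cases "x \<in> F ` ?O")
        case True
        then show ?thesis using eqJ[of "Inl x"] unfolding pm EN EN' by (auto simp: J_def G_def)
      next
        case False
        then have "F \<omega> \<noteq> x" if "\<omega> \<in> ?O" for \<omega> using that by auto
        then show ?thesis unfolding pm EN EN' by simp
      qed
    qed
    have "S ` set_pmf N' \<subseteq> {s\<in>S ` ?O. q s \<noteq> 0}" using sub by (auto simp: set_pmf_iff N' t_def)
    then have "card (S ` set_pmf N') \<le> card {s\<in>S ` ?O. q s \<noteq> 0}" using fin by (intro card_mono) auto
    also have "\<dots> \<le> card J" by (rule q(2))
    also have "\<dots> = card (F ` ?O) + card I" unfolding J_def using fin I by (intro card_Plus) auto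
    finally show "card (S ` set_pmf N') \<le> card (F ` ?O) + card I" .
    show "measure_pmf.expectation N' (e i) = measure_pmf.expectation N (e i)" if "i \<in> I" for i
      using eqJ[of "Inr i"] that unfolding EN EN' by (auto simp: J_def G_def)
    show "measure_pmf.expectation N' h \<le> measure_pmf.expectation N h"
      using q(4) unfolding grp tq EN EN' by simp
  qed
qed

section \<open>Entropies and Markov chains under a change of density\<close>

lemma prob_sum:
  assumes "finite S" "set_pmf M \<subseteq> S"
  shows "measure_pmf.prob M A = (\<Sum>\<omega>\<in>A \<inter> S. pmf M \<omega>)"
proof -
  have "measure_pmf.prob M A = measure_pmf.prob M (A \<inter> S)"
    using assms by (intro measure_eq_AE) (auto simp: AE_measure_pmf_iff)
  then show ?thesis using assms by (simp add: measure_measure_pmf_finite)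
qed

lemma mis_pr_eq_pmf: "mis_pr M A a = pmf (map_pmf A M) a"
  by (simp add: mis_pr_def pmf_map vimage_def)

lemma mis_pr_map: "mis_pr (map_pmf f M) A = mis_pr M (\<lambda>\<omega>. A (f \<omega>))"
  by (rule ext) (simp add: mis_pr_eq_pmf map_pmf_comp)

lemma mis_I_map: "mis_I (map_pmf f M) A B C = mis_I M (\<lambda>\<omega>. A (f \<omega>)) (\<lambda>\<omega>. B (f \<omega>)) (\<lambda>\<omega>. C (f \<omega>))"
  by (simp add: mis_I_def mis_pr_map image_image)

lemma mis_markov_map:
  "mis_markov (map_pmf f M) A B C = mis_markov M (\<lambda>\<omega>. A (f \<omega>)) (\<lambda>\<omega>. B (f \<omega>)) (\<lambda>\<omega>. C (f \<omega>))"
  by (simp add: mis_markov_def mis_pr_map)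

lemma Hker_law:
  assumes "finite (set_pmf N)" "finite (set_pmf N')" "map_pmf A N' = map_pmf A N"
  shows "Hker N' (rker A) = Hker N (rker A)"
proof -
  have "mis_pr N' A = mis_pr N A" by (rule ext) (simp add: mis_pr_eq_pmf assms)
  moreover have "A ` set_pmf N' = A ` set_pmf N" using assms(3) by (metis set_map_pmf)
  ultimately show ?thesis
    by (simp add: mis_H_Hker[symmetric] assms(1,2)) (simp add: mis_H_def)
qed

lemma Hker_cong:
  assumes "\<And>\<omega> \<omega>'. \<omega> \<in> set_pmf M \<Longrightarrow> \<omega>' \<in> set_pmf M \<Longrightarrow> (\<omega>, \<omega>') \<in> K \<longleftrightarrow> (\<omega>, \<omega>') \<in> L"
  shows "Hker M K = Hker M L"
  unfolding Hker_def
proof (intro arg_cong[of _ _ uminus] sum.cong refl)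
  fix \<omega> assume "\<omega> \<in> set_pmf M"
  then have "measure_pmf.prob M (K `` {\<omega>}) = measure_pmf.prob M (L `` {\<omega>})"
    using assms by (intro measure_eq_AE) (auto simp: AE_measure_pmf_iff)
  then show "pmf M \<omega> * log 2 (measure_pmf.prob M (K `` {\<omega>}))
    = pmf M \<omega> * log 2 (measure_pmf.prob M (L `` {\<omega>}))" by simp
qed

context
  fixes N N' :: "'o pmf" and t :: "'s \<Rightarrow> real" and S :: "'o \<Rightarrow> 's"
  assumes fin: "finite (set_pmf N)" and dens: "\<And>\<omega>. pmf N' \<omega> = t (S \<omega>) * pmf N \<omega>" and t0: "\<And>s. 0 \<le> t s"
begin

lemma set_pmf_density: "set_pmf N' \<subseteq> set_pmf N"
  by (auto simp: set_pmf_iff dens)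

lemma finite_density: "finite (set_pmf N')"
  using set_pmf_density fin finite_subset by blast

lemma prob_density:
  assumes "K \<subseteq> rker S"
  shows "measure_pmf.prob N' (K `` {\<omega>}) = t (S \<omega>) * measure_pmf.prob N (K `` {\<omega>})"
proof -
  have "(\<Sum>\<omega>'\<in>K `` {\<omega>} \<inter> set_pmf N. pmf N' \<omega>') = (\<Sum>\<omega>'\<in>K `` {\<omega>} \<inter> set_pmf N. t (S \<omega>) * pmf N \<omega>')"
    using assms by (intro sum.cong) (auto simp: dens rker_def)
  then show ?thesis
    unfolding prob_sum[OF fin set_pmf_density] prob_sum[OF fin subset_refl] by (simp add: sum_distrib_left)
qed

text \<open>On a class of a relation that refines \<open>rker S\<close> the density is constant, so
  its probability is multiplied by \<open>t (S \<omega>)\<close>. This factor has the same logarithm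
  for \<open>K\<close> and \<open>L\<close> and cancels, and the difference of entropies becomes the
  expectation of a function that does not depend on the density. Entropies conditioned on
  \<open>S\<close> are linear in the density for this reason.\<close>

lemma Hker_diff_density:
  assumes "equiv UNIV K" "equiv UNIV L" "K \<subseteq> rker S" "L \<subseteq> rker S"
  shows "Hker N' K - Hker N' L = measure_pmf.expectation N'
      (\<lambda>\<omega>. log 2 (measure_pmf.prob N (L `` {\<omega>})) - log 2 (measure_pmf.prob N (K `` {\<omega>})))"
proof -
  have H: "Hker N' K' = - (\<Sum>\<omega>\<in>set_pmf N'. pmf N' \<omega> * log 2 (t (S \<omega>)) + pmf N' \<omega> * log 2 (measure_pmf.prob N (K' `` {\<omega>})))"
    if K': "equiv UNIV K'" "K' \<subseteq> rker S" for K'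
    unfolding Hker_def
  proof (intro arg_cong[of _ _ uminus] sum.cong refl)
    fix \<omega> assume w: "\<omega> \<in> set_pmf N'"
    then have "t (S \<omega>) \<noteq> 0" by (auto simp: set_pmf_iff dens)
    then have "0 < t (S \<omega>)" using t0[of "S \<omega>"] by simp
    moreover have "0 < measure_pmf.prob N (K' `` {\<omega>})"
      using K' w set_pmf_density by (intro prob_class_pos) auto
    ultimately show "pmf N' \<omega> * log 2 (measure_pmf.prob N' (K' `` {\<omega>}))
      = pmf N' \<omega> * log 2 (t (S \<omega>)) + pmf N' \<omega> * log 2 (measure_pmf.prob N (K' `` {\<omega>}))"
      unfolding prob_density[OF K'(2)] by (simp add: log_mult_pos distrib_left)
  qed
  show ?thesis
    unfolding H[OF assms(1,3)] H[OF assms(2,4)] expectation_sum[OF finite_density subset_refl]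
    by (simp add: sum.distrib algebra_simps sum_subtractf)
qed

lemma mis_pr_density:
  assumes "\<And>\<omega>. S \<omega> = s (A \<omega>)"
  shows "mis_pr N' A a = t (s a) * mis_pr N A a"
proof -
  have "mis_pr N' A a = (\<Sum>\<omega>\<in>{\<omega>. A \<omega> = a} \<inter> set_pmf N. pmf N' \<omega>)"
    unfolding mis_pr_def by (rule prob_sum[OF fin set_pmf_density])
  also have "\<dots> = (\<Sum>\<omega>\<in>{\<omega>. A \<omega> = a} \<inter> set_pmf N. t (s a) * pmf N \<omega>)"
    by (intro sum.cong) (auto simp: dens assms)
  also have "\<dots> = t (s a) * mis_pr N A a"
    unfolding mis_pr_def prob_sum[OF fin subset_refl] by (simp add: sum_distrib_left)
  finally show ?thesis .
qed

text \<open>In a chain A - B - C the conditional law of C given A and B depends on B only, and a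
  density in A does not alter it. Keeping the law of B therefore keeps the law of (B, C) and the
  chain itself.\<close>

lemma markov_density:
  assumes mk: "mis_markov N A B C" and SA: "\<And>\<omega>. S \<omega> = s (A \<omega>)" and B: "map_pmf B N' = map_pmf B N"
  shows "map_pmf (\<lambda>\<omega>. (B \<omega>, C \<omega>)) N' = map_pmf (\<lambda>\<omega>. (B \<omega>, C \<omega>)) N" and "mis_markov N' A B C"
proof -
  let ?p = "mis_pr N" and ?p' = "mis_pr N'"
  have mk': "?p (\<lambda>\<omega>. (A \<omega>, B \<omega>, C \<omega>)) (a, b, c) * ?p B b = ?p (\<lambda>\<omega>. (A \<omega>, B \<omega>)) (a, b) * ?p (\<lambda>\<omega>. (B \<omega>, C \<omega>)) (b, c)"
    for a b c using mk by (simp add: mis_markov_def)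
  have ABC: "?p' (\<lambda>\<omega>. (A \<omega>, B \<omega>, C \<omega>)) (a, b, c) = t (s a) * ?p (\<lambda>\<omega>. (A \<omega>, B \<omega>, C \<omega>)) (a, b, c)" for a b c
    using mis_pr_density[of "\<lambda>x. s (fst x)" "\<lambda>\<omega>. (A \<omega>, B \<omega>, C \<omega>)"] SA by simp
  have AB: "?p' (\<lambda>\<omega>. (A \<omega>, B \<omega>)) (a, b) = t (s a) * ?p (\<lambda>\<omega>. (A \<omega>, B \<omega>)) (a, b)" for a b
    using mis_pr_density[of "\<lambda>x. s (fst x)" "\<lambda>\<omega>. (A \<omega>, B \<omega>)"] SA by simp
  have Bp: "?p' B b = ?p B b" for b using B by (simp add: mis_pr_eq_pmf)
  have BC: "?p' (\<lambda>\<omega>. (B \<omega>, C \<omega>)) (b, c) = ?p (\<lambda>\<omega>. (B \<omega>, C \<omega>)) (b, c)" for b c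
  \<comment> \<open>Away from the null case the equation is multiplied by the mass of
    \<open>b\<close>, which turns the sum over \<open>a\<close> of the reweighted Markov equation
    into the marginal of B.\<close>
  proof (cases "?p B b = 0")
    case True
    have z: "mis_pr M (\<lambda>\<omega>. (B \<omega>, C \<omega>)) (b, c) = 0" if "mis_pr M B b = 0" for M :: "'o pmf"
      using that unfolding mis_pr_def measure_pmf_zero_iff by auto
    show ?thesis using z[of N] z[of N'] True Bp by simp
  next
    case False
    have "?p' (\<lambda>\<omega>. (B \<omega>, C \<omega>)) (b, c) * ?p B b
       = (\<Sum>a\<in>A ` set_pmf N'. ?p' (\<lambda>\<omega>. (A \<omega>, B \<omega>, C \<omega>)) (a, b, c)) * ?p B b"
      using mis_pr_marginal[OF finite_density, of A "\<lambda>\<omega>. (B \<omega>, C \<omega>)" "(b, c)"] by simp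
    also have "\<dots> = (\<Sum>a\<in>A ` set_pmf N'. t (s a) * ?p (\<lambda>\<omega>. (A \<omega>, B \<omega>)) (a, b)) * ?p (\<lambda>\<omega>. (B \<omega>, C \<omega>)) (b, c)"
      unfolding sum_distrib_right ABC mult.assoc mk' ..
    also have "\<dots> = ?p' B b * ?p (\<lambda>\<omega>. (B \<omega>, C \<omega>)) (b, c)"
      unfolding AB[symmetric] mis_pr_marginal[OF finite_density] ..
    finally show ?thesis using False Bp by simp
  qed
  show "map_pmf (\<lambda>\<omega>. (B \<omega>, C \<omega>)) N' = map_pmf (\<lambda>\<omega>. (B \<omega>, C \<omega>)) N"
    using BC by (intro pmf_eqI) (auto simp: mis_pr_eq_pmf)
  show "mis_markov N' A B C"
    unfolding mis_markov_def ABC Bp AB BC using mk' by (simp add: mult.assoc)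
qed

end

section \<open>One component of the source\<close>

definition "sX \<omega> = fst \<omega>"
definition "sY \<omega> = fst (snd \<omega>)"
definition "sZ \<omega> = fst (snd (snd \<omega>))"
definition "sW \<omega> = fst (snd (snd (snd \<omega>)))"
definition "sU \<omega> = snd (snd (snd (snd \<omega>)))"

lemmas s_defs = sX_def sY_def sZ_def sW_def sU_def

text \<open>One component of the source: \<open>(X, Y, Z, W, U)\<close> with \<open>Y\<close> the stronger and \<open>Z\<close> the weaker
  side information.  The component enters one of \<open>RM_1\<close> and \<open>RM_2\<close> through \<open>rate_Y\<close> and
  the other through \<open>rate_Z\<close>.\<close>

definition rate_Y :: "('x \<times> 'y \<times> 'z \<times> 'w \<times> 'u) pmf \<Rightarrow> real" where
  "rate_Y N = mis_I N sX sW sY + mis_I N sX sU (\<lambda>\<omega>. (sY \<omega>, sW \<omega>))"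

definition rate_Z :: "('x \<times> 'y \<times> 'z \<times> 'w \<times> 'u) pmf \<Rightarrow> real" where
  "rate_Z N = mis_I N sX sW sZ + mis_I N sX sU (\<lambda>\<omega>. (sY \<omega>, sW \<omega>))"

definition comp_law :: "('x \<times> 'y \<times> 'z) pmf \<Rightarrow> ('x \<times> 'y \<times> 'z \<times> 'w \<times> 'u) pmf \<Rightarrow> bool" where
  "comp_law P N \<longleftrightarrow> finite (set_pmf N) \<and> map_pmf (\<lambda>\<omega>. (sX \<omega>, sY \<omega>, sZ \<omega>)) N = P \<and>
     mis_markov N (\<lambda>\<omega>. (sW \<omega>, sU \<omega>)) sX (\<lambda>\<omega>. (sY \<omega>, sZ \<omega>))"

text \<open>The terms are grouped for \<open>Hker_diff_density\<close>: the leading difference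
  depends on the source law only, the bracketed one compares relations that refine both
  \<open>rker sW\<close> and \<open>rker sU\<close>. The terms in W without U telescope, so
  \<open>rate_Y\<close> is I(X; W, U | Y). They do not telescope in \<open>rate_Z\<close>, whose
  brackets all refine \<open>rker sW\<close>.\<close>

lemma rate_Y_Hker:
  assumes "finite (set_pmf N)"
  shows "rate_Y N = Hker N (rker sX \<inter> rker sY) - Hker N (rker sY)
    + (Hker N (rker sW \<inter> rker sU \<inter> rker sY) - Hker N (rker sX \<inter> rker sW \<inter> rker sU \<inter> rker sY))"
  unfolding rate_Y_def mis_I_Iker[OF assms] Iker_def by (simp add: Int_ac)

lemma rate_Z_Hker:
  assumes "finite (set_pmf N)"
  shows "rate_Z N = Hker N (rker sX \<inter> rker sZ) - Hker N (rker sZ)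
    + ((Hker N (rker sW \<inter> rker sZ) - Hker N (rker sX \<inter> rker sW \<inter> rker sZ))
     + (Hker N (rker sX \<inter> rker sY \<inter> rker sW) - Hker N (rker sY \<inter> rker sW))
     + (Hker N (rker sW \<inter> rker sU \<inter> rker sY) - Hker N (rker sX \<inter> rker sW \<inter> rker sU \<inter> rker sY)))"
  unfolding rate_Z_def mis_I_Iker[OF assms] Iker_def by (simp add: Int_ac)

lemma map_pmf_factor: "map_pmf A N' = map_pmf A N \<Longrightarrow> map_pmf (\<lambda>\<omega>. f (A \<omega>)) N' = map_pmf (\<lambda>\<omega>. f (A \<omega>)) N"
  by (metis map_pmf_comp)

text \<open>The constraints are the law of \<open>X\<close>, \<open>rate_Z\<close> and the two distortions; taking \<open>rate_Y\<close> as
  the objective instead of a further constraint yields the bound \<open>CARD('x) + 3\<close>.\<close>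

lemma reduce_W:
  fixes N :: "('x::finite \<times> 'y \<times> 'z \<times> 'w \<times> 'u) pmf" and \<delta> \<delta>' :: "'x \<times> 'y \<times> 'z \<times> 'w \<times> 'u \<Rightarrow> real"
  assumes N: "comp_law P N"
  obtains N' where "comp_law P N'" "card (sW ` set_pmf N') \<le> CARD('x) + 3"
    "rate_Y N' \<le> rate_Y N" "rate_Z N' = rate_Z N"
    "measure_pmf.expectation N' \<delta> = measure_pmf.expectation N \<delta>"
    "measure_pmf.expectation N' \<delta>' = measure_pmf.expectation N \<delta>'"
proof -
  have fin: "finite (set_pmf N)" and mP: "map_pmf (\<lambda>\<omega>. (sX \<omega>, sY \<omega>, sZ \<omega>)) N = P"
    and mk: "mis_markov N (\<lambda>\<omega>. (sW \<omega>, sU \<omega>)) sX (\<lambda>\<omega>. (sY \<omega>, sZ \<omega>))"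
    using N by (auto simp: comp_law_def)
  define l where "l K L \<omega> = log 2 (measure_pmf.prob N (L `` {\<omega>})) - log 2 (measure_pmf.prob N (K `` {\<omega>}))"
    for K L and \<omega> :: "'x \<times> 'y \<times> 'z \<times> 'w \<times> 'u"
  define \<alpha> where "\<alpha> = l (rker sW \<inter> rker sU \<inter> rker sY) (rker sX \<inter> rker sW \<inter> rker sU \<inter> rker sY)"
  define \<beta> where "\<beta> = l (rker sW \<inter> rker sZ) (rker sX \<inter> rker sW \<inter> rker sZ)"
  define \<gamma> where "\<gamma> = l (rker sX \<inter> rker sY \<inter> rker sW) (rker sY \<inter> rker sW)"
  define e where "e i = (if i = 0 then \<lambda>\<omega>. \<beta> \<omega> + \<gamma> \<omega> + \<alpha> \<omega> else if i = 1 then \<delta> else \<delta>')" for i :: nat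
  obtain N' t where N': "\<And>\<omega>. pmf N' \<omega> = t (sW \<omega>) * pmf N \<omega>" "\<And>s. 0 \<le> t s"
    "map_pmf sX N' = map_pmf sX N"
    "card (sW ` set_pmf N') \<le> card (sX ` set_pmf N) + card {..<3::nat}"
    "\<And>i. i \<in> {..<3::nat} \<Longrightarrow> measure_pmf.expectation N' (e i) = measure_pmf.expectation N (e i)"
    "measure_pmf.expectation N' \<alpha> \<le> measure_pmf.expectation N \<alpha>"
    using reweight[OF fin, where I = "{..<3::nat}" and F = sX and S = sW and e = e and h = \<alpha>] by auto
  have fin': "finite (set_pmf N')" using finite_density[where t = t and S = sW, OF fin N'(1,2)] .
  \<comment> \<open>Only the law of X was imposed as a constraint; the Markov chain restores the law
    of (X, Y, Z).\<close>
  have law': "map_pmf (\<lambda>\<omega>. (sX \<omega>, sY \<omega>, sZ \<omega>)) N' = map_pmf (\<lambda>\<omega>. (sX \<omega>, sY \<omega>, sZ \<omega>)) N"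
    and mk': "mis_markov N' (\<lambda>\<omega>. (sW \<omega>, sU \<omega>)) sX (\<lambda>\<omega>. (sY \<omega>, sZ \<omega>))"
    using markov_density[where t = t and S = sW and s = fst, OF fin N'(1,2) mk _ N'(3)] by simp_all
  have H: "Hker N' (rker (\<lambda>\<omega>. f (sX \<omega>, sY \<omega>, sZ \<omega>))) = Hker N (rker (\<lambda>\<omega>. f (sX \<omega>, sY \<omega>, sZ \<omega>)))"
    for f :: "'x \<times> 'y \<times> 'z \<Rightarrow> 'c"
    by (intro Hker_law fin fin' map_pmf_factor[OF law'])
  have HH: "Hker N' (rker sX \<inter> rker sY) = Hker N (rker sX \<inter> rker sY)"
     "Hker N' (rker sX \<inter> rker sZ) = Hker N (rker sX \<inter> rker sZ)"
     "Hker N' (rker sY) = Hker N (rker sY)" "Hker N' (rker sZ) = Hker N (rker sZ)"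
    using H[of "\<lambda>(x, y, z). (x, y)"] H[of "\<lambda>(x, y, z). (x, z)"] H[of "\<lambda>(x, y, z). y"] H[of "\<lambda>(x, y, z). z"]
    by simp_all
  \<comment> \<open>The original law has density 1 with respect to itself, so both differences are
    expectations of the same function \<open>l K L\<close>.\<close>
  have d': "Hker N' K - Hker N' L = measure_pmf.expectation N' (l K L)"
    and d: "Hker N K - Hker N L = measure_pmf.expectation N (l K L)"
    if "equiv UNIV K" "equiv UNIV L" "K \<subseteq> rker sW" "L \<subseteq> rker sW" for K L
    unfolding l_def
    using Hker_diff_density[where t = t and S = sW, OF fin N'(1,2) that] Hker_diff_density[where t = "\<lambda>_. 1" and S = sW, OF fin _ _ that, of N] by simp_all
  have Ea: "measure_pmf.expectation M (\<lambda>\<omega>. \<beta> \<omega> + \<gamma> \<omega> + \<alpha> \<omega>) =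
      measure_pmf.expectation M \<beta> + measure_pmf.expectation M \<gamma> + measure_pmf.expectation M \<alpha>"
    if "finite (set_pmf M)" for M
    by (simp add: integrable_measure_pmf_finite[OF that])
  show thesis
  proof
    show "comp_law P N'" using fin' law' mP mk' by (simp add: comp_law_def)
    have "card (sX ` set_pmf N) \<le> CARD('x)" by (intro card_mono) auto
    then show "card (sW ` set_pmf N') \<le> CARD('x) + 3" using N'(4) by simp
    show "rate_Y N' \<le> rate_Y N"
      unfolding rate_Y_Hker[OF fin] rate_Y_Hker[OF fin'] HH
      using N'(6) by (subst d' d, auto)+ (auto simp: \<alpha>_def)
    have "measure_pmf.expectation N' (\<lambda>\<omega>. \<beta> \<omega> + \<gamma> \<omega> + \<alpha> \<omega>) = measure_pmf.expectation N (\<lambda>\<omega>. \<beta> \<omega> + \<gamma> \<omega> + \<alpha> \<omega>)"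
      using N'(5)[of 0] by (simp add: e_def)
    then show "rate_Z N' = rate_Z N"
      unfolding rate_Z_Hker[OF fin] rate_Z_Hker[OF fin'] HH Ea[OF fin] Ea[OF fin']
      by (subst d' d, auto)+ (auto simp: \<alpha>_def \<beta>_def \<gamma>_def)
    show "measure_pmf.expectation N' \<delta> = measure_pmf.expectation N \<delta>"
      using N'(5)[of 1] by (simp add: e_def)
    show "measure_pmf.expectation N' \<delta>' = measure_pmf.expectation N \<delta>'"
      using N'(5)[of 2] by (simp add: e_def)
  qed
qed

text \<open>The density now depends on U, and the law of (X, W) is kept at the price of at most
  \<open>CARD('x) * m\<close> constraints. Through the chain U - (X, W) - (Y, Z) this keeps the law
  of (X, Y, Z, W), hence the distortion of the weaker decoder and all entropies without U. The
  distortion of the stronger decoder is the one extra constraint. Both rates contain the same terms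
  in U, so a single objective decreases both.\<close>

lemma reduce_U:
  fixes N :: "('x::finite \<times> 'y \<times> 'z \<times> 'w \<times> 'u) pmf" and \<delta> :: "'x \<times> 'y \<times> 'z \<times> 'w \<times> 'u \<Rightarrow> real"
    and \<delta>' :: "'x \<times> 'y \<times> 'z \<times> 'w \<Rightarrow> real"
  assumes N: "comp_law P N" and cW: "card (sW ` set_pmf N) \<le> m"
  obtains N' where "comp_law P N'" "card (sW ` set_pmf N') \<le> m" "card (sU ` set_pmf N') \<le> CARD('x) * m + 1"
    "rate_Y N' \<le> rate_Y N" "rate_Z N' \<le> rate_Z N"
    "measure_pmf.expectation N' \<delta> = measure_pmf.expectation N \<delta>"
    "measure_pmf.expectation N' (\<lambda>\<omega>. \<delta>' (sX \<omega>, sY \<omega>, sZ \<omega>, sW \<omega>)) = measure_pmf.expectation N (\<lambda>\<omega>. \<delta>' (sX \<omega>, sY \<omega>, sZ \<omega>, sW \<omega>))"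
proof -
  have fin: "finite (set_pmf N)" and mP: "map_pmf (\<lambda>\<omega>. (sX \<omega>, sY \<omega>, sZ \<omega>)) N = P"
    and mk: "mis_markov N (\<lambda>\<omega>. (sW \<omega>, sU \<omega>)) sX (\<lambda>\<omega>. (sY \<omega>, sZ \<omega>))"
    using N by (auto simp: comp_law_def)
  let ?F = "\<lambda>\<omega>. (sX \<omega>, sW \<omega>)"
  define l where "l K L \<omega> = log 2 (measure_pmf.prob N (L `` {\<omega>})) - log 2 (measure_pmf.prob N (K `` {\<omega>}))"
    for K L and \<omega> :: "'x \<times> 'y \<times> 'z \<times> 'w \<times> 'u"
  define \<alpha> where "\<alpha> = l (rker sW \<inter> rker sU \<inter> rker sY) (rker sX \<inter> rker sW \<inter> rker sU \<inter> rker sY)"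
  obtain N' t where N': "\<And>\<omega>. pmf N' \<omega> = t (sU \<omega>) * pmf N \<omega>" "\<And>s. 0 \<le> t s"
    "map_pmf ?F N' = map_pmf ?F N"
    "card (sU ` set_pmf N') \<le> card (?F ` set_pmf N) + card {..<1::nat}"
    "\<And>i. i \<in> {..<1::nat} \<Longrightarrow> measure_pmf.expectation N' \<delta> = measure_pmf.expectation N \<delta>"
    "measure_pmf.expectation N' \<alpha> \<le> measure_pmf.expectation N \<alpha>"
    using reweight[OF fin, where I = "{..<1::nat}" and F = ?F and S = sU and e = "\<lambda>_. \<delta>" and h = \<alpha>] by auto
  have fin': "finite (set_pmf N')" using finite_density[where t = t and S = sU, OF fin N'(1,2)] .
  have mkI: "Iker N (rker sY \<inter> rker sZ) (rker sU \<inter> rker sW) (rker sX) = 0"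
    using mk unfolding mis_markov_iff_Iker[OF fin] by (subst Iker_sym) (simp add: Int_ac)
  \<comment> \<open>W moves from the outer variable into the condition, which gives the chain the
    shape that a density in U requires.\<close>
  have mkU: "mis_markov N sU ?F (\<lambda>\<omega>. (sY \<omega>, sZ \<omega>))"
  proof -
    have "Iker N (rker sY \<inter> rker sZ) (rker sU) (rker sW \<inter> rker sX) = 0"
      by (rule Iker_zero_mono[where L'' = UNIV]) (use mkI fin in auto)
    then show ?thesis
      unfolding mis_markov_iff_Iker[OF fin] by (subst Iker_sym) (simp add: Int_ac)
  qed
  have law0: "map_pmf (\<lambda>\<omega>. (?F \<omega>, (sY \<omega>, sZ \<omega>))) N' = map_pmf (\<lambda>\<omega>. (?F \<omega>, (sY \<omega>, sZ \<omega>))) N"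
    and mkU': "mis_markov N' sU ?F (\<lambda>\<omega>. (sY \<omega>, sZ \<omega>))"
    using markov_density[where t = t and S = sU and s = "\<lambda>u. u", OF fin N'(1,2) mkU _ N'(3)] by simp_all
  have law: "map_pmf (\<lambda>\<omega>. f (sX \<omega>, sY \<omega>, sZ \<omega>, sW \<omega>)) N' = map_pmf (\<lambda>\<omega>. f (sX \<omega>, sY \<omega>, sZ \<omega>, sW \<omega>)) N"
    for f :: "'x \<times> 'y \<times> 'z \<times> 'w \<Rightarrow> 'c"
    using map_pmf_factor[OF law0, of "\<lambda>((x, w), (y, z)). f (x, y, z, w)"] by simp
  have H: "Hker N' (rker (\<lambda>\<omega>. f (sX \<omega>, sY \<omega>, sZ \<omega>, sW \<omega>))) = Hker N (rker (\<lambda>\<omega>. f (sX \<omega>, sY \<omega>, sZ \<omega>, sW \<omega>)))"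
    for f :: "'x \<times> 'y \<times> 'z \<times> 'w \<Rightarrow> 'c"
    by (intro Hker_law fin fin' law)
  have HH: "Hker N' (rker sX \<inter> rker sY) = Hker N (rker sX \<inter> rker sY)"
     "Hker N' (rker sX \<inter> rker sZ) = Hker N (rker sX \<inter> rker sZ)"
     "Hker N' (rker sY) = Hker N (rker sY)" "Hker N' (rker sZ) = Hker N (rker sZ)"
     "Hker N' (rker sW \<inter> rker sZ) = Hker N (rker sW \<inter> rker sZ)"
     "Hker N' (rker sX \<inter> rker sW \<inter> rker sZ) = Hker N (rker sX \<inter> rker sW \<inter> rker sZ)"
     "Hker N' (rker sX \<inter> rker sY \<inter> rker sW) = Hker N (rker sX \<inter> rker sY \<inter> rker sW)"
     "Hker N' (rker sY \<inter> rker sW) = Hker N (rker sY \<inter> rker sW)"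
    using H[of "\<lambda>(x, y, z, w). (x, y)"] H[of "\<lambda>(x, y, z, w). (x, z)"] H[of "\<lambda>(x, y, z, w). y"]
      H[of "\<lambda>(x, y, z, w). z"] H[of "\<lambda>(x, y, z, w). (w, z)"] H[of "\<lambda>(x, y, z, w). ((x, w), z)"]
      H[of "\<lambda>(x, y, z, w). ((x, y), w)"] H[of "\<lambda>(x, y, z, w). (y, w)"]
    by simp_all
  have d': "Hker N' K - Hker N' L = measure_pmf.expectation N' (l K L)"
    and d: "Hker N K - Hker N L = measure_pmf.expectation N (l K L)"
    if "equiv UNIV K" "equiv UNIV L" "K \<subseteq> rker sU" "L \<subseteq> rker sU" for K L
    unfolding l_def
    using Hker_diff_density[where t = t and S = sU, OF fin N'(1,2) that] Hker_diff_density[where t = "\<lambda>_. 1" and S = sU, OF fin _ _ that, of N] by simp_all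
  have le: "Hker N' (rker sW \<inter> rker sU \<inter> rker sY) - Hker N' (rker sX \<inter> rker sW \<inter> rker sU \<inter> rker sY)
     \<le> Hker N (rker sW \<inter> rker sU \<inter> rker sY) - Hker N (rker sX \<inter> rker sW \<inter> rker sU \<inter> rker sY)"
    using N'(6) by (subst d' d, auto)+ (auto simp: \<alpha>_def)
  have sub: "set_pmf N' \<subseteq> set_pmf N" by (rule set_pmf_density[where t = t and S = sU, OF fin N'(1,2)])
  \<comment> \<open>By the chain rule I(W, U; Y, Z | X) = I(W; Y, Z | X) + I(U; Y, Z | X, W): the
    first term is inherited with the law of (X, Y, Z, W), the second vanishes by
    \<open>mkU'\<close>.\<close>
  have mk': "mis_markov N' (\<lambda>\<omega>. (sW \<omega>, sU \<omega>)) sX (\<lambda>\<omega>. (sY \<omega>, sZ \<omega>))"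
  proof -
    have HX: "Hker N' (rker sX) = Hker N (rker sX)"
      "Hker N' (rker sX \<inter> rker sW) = Hker N (rker sX \<inter> rker sW)"
      "Hker N' (rker sX \<inter> rker sY \<inter> rker sZ) = Hker N (rker sX \<inter> rker sY \<inter> rker sZ)"
      "Hker N' (rker sX \<inter> rker sY \<inter> rker sZ \<inter> rker sW) = Hker N (rker sX \<inter> rker sY \<inter> rker sZ \<inter> rker sW)"
      using H[of "\<lambda>(x, y, z, w). x"] H[of "\<lambda>(x, y, z, w). (x, w)"] H[of "\<lambda>(x, y, z, w). ((x, y), z)"]
       H[of "\<lambda>(x, y, z, w). (((x, y), z), w)"] by simp_all
    have "Iker N (rker sY \<inter> rker sZ) (rker sW) (UNIV \<inter> rker sX) = 0"
      by (rule Iker_zero_mono[where L'' = "rker sU"]) (use mkI fin in \<open>auto simp: Int_ac\<close>)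
    moreover have "Iker N' (rker sU) (rker sY \<inter> rker sZ) (rker sX \<inter> rker sW) = 0"
      using mkU' unfolding mis_markov_iff_Iker[OF fin'] by simp
    ultimately have "Iker N' (rker sW \<inter> rker sU) (rker sY \<inter> rker sZ) (rker sX) = 0"
      using HX unfolding Iker_def by (simp add: Int_ac)
    then show ?thesis unfolding mis_markov_iff_Iker[OF fin'] by simp
  qed
  show thesis
  proof
    have "map_pmf (\<lambda>\<omega>. (sX \<omega>, sY \<omega>, sZ \<omega>)) N' = P"
      using law[of "\<lambda>(x, y, z, w). (x, y, z)"] mP by simp
    then show "comp_law P N'" using fin' mk' by (simp add: comp_law_def)
    show "card (sW ` set_pmf N') \<le> m"
      using card_mono[OF _ image_mono[OF sub, of sW]] fin cW by (meson finite_imageI le_trans)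
    have "card (?F ` set_pmf N) \<le> card ((UNIV :: 'x set) \<times> sW ` set_pmf N)"
      using fin by (intro card_mono) auto
    also have "\<dots> \<le> CARD('x) * m" using cW by (simp add: card_cartesian_product)
    finally show "card (sU ` set_pmf N') \<le> CARD('x) * m + 1" using N'(4) by simp
    show "rate_Y N' \<le> rate_Y N"
      unfolding rate_Y_Hker[OF fin] rate_Y_Hker[OF fin'] HH using le by simp
    show "rate_Z N' \<le> rate_Z N"
      unfolding rate_Z_Hker[OF fin] rate_Z_Hker[OF fin'] HH using le by simp
    show "measure_pmf.expectation N' \<delta> = measure_pmf.expectation N \<delta>"
      using N'(5)[of 0] by simp
    have "measure_pmf.expectation M (\<lambda>\<omega>. \<delta>' (sX \<omega>, sY \<omega>, sZ \<omega>, sW \<omega>))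
      = measure_pmf.expectation (map_pmf (\<lambda>\<omega>. (sX \<omega>, sY \<omega>, sZ \<omega>, sW \<omega>)) M) \<delta>'" for M
      by simp
    then show "measure_pmf.expectation N' (\<lambda>\<omega>. \<delta>' (sX \<omega>, sY \<omega>, sZ \<omega>, sW \<omega>))
      = measure_pmf.expectation N (\<lambda>\<omega>. \<delta>' (sX \<omega>, sY \<omega>, sZ \<omega>, sW \<omega>))"
      using law[of "\<lambda>x. x"] by metis
  qed
qed

section \<open>Relabelling the auxiliary variables by initial segments of the naturals\<close>

lemma Iker_cong:
  assumes "\<And>\<omega> \<omega>'. \<omega> \<in> set_pmf M \<Longrightarrow> \<omega>' \<in> set_pmf M \<Longrightarrow> (\<omega>, \<omega>') \<in> K \<longleftrightarrow> (\<omega>, \<omega>') \<in> K'"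
    and "\<And>\<omega> \<omega>'. \<omega> \<in> set_pmf M \<Longrightarrow> \<omega>' \<in> set_pmf M \<Longrightarrow> (\<omega>, \<omega>') \<in> L \<longleftrightarrow> (\<omega>, \<omega>') \<in> L'"
    and "\<And>\<omega> \<omega>'. \<omega> \<in> set_pmf M \<Longrightarrow> \<omega>' \<in> set_pmf M \<Longrightarrow> (\<omega>, \<omega>') \<in> N \<longleftrightarrow> (\<omega>, \<omega>') \<in> N'"
  shows "Iker M K L N = Iker M K' L' N'"
proof -
  have "Hker M (K \<inter> N) = Hker M (K' \<inter> N')" "Hker M (L \<inter> N) = Hker M (L' \<inter> N')"
    "Hker M (K \<inter> L \<inter> N) = Hker M (K' \<inter> L' \<inter> N')" "Hker M N = Hker M N'"
    using assms by (auto intro!: Hker_cong)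
  then show ?thesis by (simp add: Iker_def)
qed

text \<open>Entropies see a variable only through its kernel on the support, so injectivity on the
  values taken there suffices.\<close>

lemma comp_relabel:
  fixes N :: "('x \<times> 'y \<times> 'z \<times> 'w \<times> 'u) pmf" and f :: "'w \<Rightarrow> 'v" and k :: "'u \<Rightarrow> 't"
  assumes N: "comp_law P N" and f: "inj_on f (sW ` set_pmf N)" and k: "inj_on k (sU ` set_pmf N)"
  defines "N' \<equiv> map_pmf (\<lambda>\<omega>. (sX \<omega>, sY \<omega>, sZ \<omega>, f (sW \<omega>), k (sU \<omega>))) N"
  shows "comp_law P N'" "rate_Y N' = rate_Y N" "rate_Z N' = rate_Z N"
proof -
  have fin: "finite (set_pmf N)" and mP: "map_pmf (\<lambda>\<omega>. (sX \<omega>, sY \<omega>, sZ \<omega>)) N = P"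
    and mk: "mis_markov N (\<lambda>\<omega>. (sW \<omega>, sU \<omega>)) sX (\<lambda>\<omega>. (sY \<omega>, sZ \<omega>))"
    using N by (auto simp: comp_law_def)
  let ?r = "\<lambda>\<omega>. (sX \<omega>, sY \<omega>, sZ \<omega>, f (sW \<omega>), k (sU \<omega>))"
  have proj: "sX (?r \<omega>) = sX \<omega>" "sY (?r \<omega>) = sY \<omega>" "sZ (?r \<omega>) = sZ \<omega>" "sW (?r \<omega>) = f (sW \<omega>)" "sU (?r \<omega>) = k (sU \<omega>)"
    for \<omega> by (simp_all add: s_defs)
  have W: "(\<omega>, \<omega>') \<in> rker (\<lambda>\<omega>. f (sW \<omega>)) \<longleftrightarrow> (\<omega>, \<omega>') \<in> rker sW"
    and U: "(\<omega>, \<omega>') \<in> rker (\<lambda>\<omega>. k (sU \<omega>)) \<longleftrightarrow> (\<omega>, \<omega>') \<in> rker sU"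
    if "\<omega> \<in> set_pmf N" "\<omega>' \<in> set_pmf N" for \<omega> \<omega>'
    using that inj_on_eq_iff[OF f, of "sW \<omega>" "sW \<omega>'"] inj_on_eq_iff[OF k, of "sU \<omega>" "sU \<omega>'"]
    by (simp_all add: rker_def)
  have "mis_markov N (\<lambda>\<omega>. (f (sW \<omega>), k (sU \<omega>))) sX (\<lambda>\<omega>. (sY \<omega>, sZ \<omega>))"
    using mk unfolding mis_markov_iff_Iker[OF fin]
    by (subst Iker_cong[where K' = "rker (\<lambda>\<omega>. (sW \<omega>, sU \<omega>))"]) (auto simp: W U)
  then show "comp_law P N'"
    using fin mP unfolding comp_law_def N'_def mis_markov_map map_pmf_comp proj by simp
  have "mis_I N sX (\<lambda>\<omega>. f (sW \<omega>)) C = mis_I N sX sW C" for C :: "_ \<Rightarrow> 'c"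
    unfolding mis_I_Iker[OF fin] by (intro Iker_cong) (auto simp: W)
  moreover have "mis_I N sX (\<lambda>\<omega>. k (sU \<omega>)) (\<lambda>\<omega>. (sY \<omega>, f (sW \<omega>))) = mis_I N sX sU (\<lambda>\<omega>. (sY \<omega>, sW \<omega>))"
    unfolding mis_I_Iker[OF fin] by (intro Iker_cong) (auto simp: W U)
  ultimately show "rate_Y N' = rate_Y N" "rate_Z N' = rate_Z N"
    unfolding rate_Y_def rate_Z_def N'_def mis_I_map proj by simp_all
qed

lemma inj_into_initial_segment:
  assumes "finite A" "card A \<le> m"
  obtains f :: "'a \<Rightarrow> nat" where "inj_on f A" "\<And>a. a \<in> A \<Longrightarrow> f a < m"
proof -
  obtain f where "bij_betw f A {..<card A}"
    using finite_same_card_bij[OF assms(1), of "{..<card A}"] by auto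
  then have "inj_on f A" "f ` A = {..<card A}" by (auto simp: bij_betw_def)
  then show thesis using assms(2) by (intro that[of f]) (auto dest!: equalityD1 simp: image_subset_iff)
qed

text \<open>W is reduced before U because the bound for U involves the number of values of W, and a
  density in U cannot enlarge the support of W. The new decoders undo the relabelling before they
  apply the old ones.\<close>

lemma cardinality_bound:
  fixes N :: "('x::finite \<times> 'y \<times> 'z \<times> 'w \<times> 'u) pmf"
    and d :: "'x \<Rightarrow> 'r \<Rightarrow> real" and d' :: "'x \<Rightarrow> 's \<Rightarrow> real"
    and g :: "'w \<Rightarrow> 'u \<Rightarrow> 'y \<Rightarrow> 'r" and g' :: "'w \<Rightarrow> 'z \<Rightarrow> 's"
  assumes N: "comp_law P N"
  obtains N' :: "('x \<times> 'y \<times> 'z \<times> nat \<times> nat) pmf" and G G' where "comp_law P N'"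
    "\<And>\<omega>. \<omega> \<in> set_pmf N' \<Longrightarrow> sW \<omega> < CARD('x) + 3"
    "\<And>\<omega>. \<omega> \<in> set_pmf N' \<Longrightarrow> sU \<omega> < CARD('x) * (CARD('x) + 3) + 1"
    "rate_Y N' \<le> rate_Y N" "rate_Z N' \<le> rate_Z N"
    "measure_pmf.expectation N' (\<lambda>\<omega>. d (sX \<omega>) (G (sW \<omega>) (sU \<omega>) (sY \<omega>)))
      = measure_pmf.expectation N (\<lambda>\<omega>. d (sX \<omega>) (g (sW \<omega>) (sU \<omega>) (sY \<omega>)))"
    "measure_pmf.expectation N' (\<lambda>\<omega>. d' (sX \<omega>) (G' (sW \<omega>) (sZ \<omega>)))
      = measure_pmf.expectation N (\<lambda>\<omega>. d' (sX \<omega>) (g' (sW \<omega>) (sZ \<omega>)))"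
proof -
  let ?\<delta> = "\<lambda>\<omega>. d (sX \<omega>) (g (sW \<omega>) (sU \<omega>) (sY \<omega>))"
  let ?\<delta>' = "\<lambda>\<omega> :: 'x \<times> 'y \<times> 'z \<times> 'w \<times> 'u. d' (sX \<omega>) (g' (sW \<omega>) (sZ \<omega>))"
  obtain N1 where N1: "comp_law P N1" "card (sW ` set_pmf N1) \<le> CARD('x) + 3"
    "rate_Y N1 \<le> rate_Y N" "rate_Z N1 = rate_Z N"
    "measure_pmf.expectation N1 ?\<delta> = measure_pmf.expectation N ?\<delta>"
    "measure_pmf.expectation N1 ?\<delta>' = measure_pmf.expectation N ?\<delta>'"
    using reduce_W[OF N, of ?\<delta> ?\<delta>'] by blast
  obtain N2 where N2: "comp_law P N2" "card (sW ` set_pmf N2) \<le> CARD('x) + 3"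
    "card (sU ` set_pmf N2) \<le> CARD('x) * (CARD('x) + 3) + 1"
    "rate_Y N2 \<le> rate_Y N1" "rate_Z N2 \<le> rate_Z N1"
    "measure_pmf.expectation N2 ?\<delta> = measure_pmf.expectation N1 ?\<delta>"
    "measure_pmf.expectation N2 ?\<delta>' = measure_pmf.expectation N1 ?\<delta>'"
    using reduce_U[OF N1(1,2), of ?\<delta> "\<lambda>(x, y, z, w). d' x (g' w z)"] by auto
  have fin: "finite (set_pmf N2)" using N2(1) by (simp add: comp_law_def)
  obtain f where f: "inj_on f (sW ` set_pmf N2)" "\<And>a. a \<in> sW ` set_pmf N2 \<Longrightarrow> f a < CARD('x) + 3"
    using inj_into_initial_segment[OF _ N2(2)] fin by blast
  obtain k where k: "inj_on k (sU ` set_pmf N2)" "\<And>a. a \<in> sU ` set_pmf N2 \<Longrightarrow> k a < CARD('x) * (CARD('x) + 3) + 1"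
    using inj_into_initial_segment[OF _ N2(3)] fin by blast
  let ?r = "\<lambda>\<omega>. (sX \<omega>, sY \<omega>, sZ \<omega>, f (sW \<omega>), k (sU \<omega>))"
  have proj: "sX (?r \<omega>) = sX \<omega>" "sY (?r \<omega>) = sY \<omega>" "sZ (?r \<omega>) = sZ \<omega>" "sW (?r \<omega>) = f (sW \<omega>)" "sU (?r \<omega>) = k (sU \<omega>)"
    for \<omega> by (simp_all add: s_defs)
  define fi where "fi = inv_into (sW ` set_pmf N2) f"
  define ki where "ki = inv_into (sU ` set_pmf N2) k"
  have fi: "fi (f (sW \<omega>)) = sW \<omega>" and ki: "ki (k (sU \<omega>)) = sU \<omega>" if "\<omega> \<in> set_pmf N2" for \<omega>
    using that f(1) k(1) by (auto simp: fi_def ki_def)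
  note rel = comp_relabel[OF N2(1) f(1) k(1)]
  show thesis
  proof (rule that[of "map_pmf ?r N2" "\<lambda>w u. g (fi w) (ki u)" "\<lambda>w. g' (fi w)"])
    show "comp_law P (map_pmf ?r N2)" by (rule rel)
    show "rate_Y (map_pmf ?r N2) \<le> rate_Y N" "rate_Z (map_pmf ?r N2) \<le> rate_Z N"
      unfolding rel using N1 N2 by auto
    show "sW \<omega> < CARD('x) + 3" "sU \<omega> < CARD('x) * (CARD('x) + 3) + 1" if "\<omega> \<in> set_pmf (map_pmf ?r N2)" for \<omega>
    proof -
      from that obtain \<eta> where "\<eta> \<in> set_pmf N2" "\<omega> = ?r \<eta>" by auto
      then show "sW \<omega> < CARD('x) + 3" "sU \<omega> < CARD('x) * (CARD('x) + 3) + 1"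
        using f(2)[of "sW \<eta>"] k(2)[of "sU \<eta>"] by (auto simp: s_defs)
    qed
    show "measure_pmf.expectation (map_pmf ?r N2) (\<lambda>\<omega>. d (sX \<omega>) (g (fi (sW \<omega>)) (ki (sU \<omega>)) (sY \<omega>)))
      = measure_pmf.expectation N ?\<delta>"
      unfolding N1(5)[symmetric] N2(6)[symmetric] integral_map_pmf proj
      by (intro integral_cong_AE) (auto simp: AE_measure_pmf_iff fi ki)
    show "measure_pmf.expectation (map_pmf ?r N2) (\<lambda>\<omega>. d' (sX \<omega>) (g' (fi (sW \<omega>)) (sZ \<omega>)))
      = measure_pmf.expectation N ?\<delta>'"
      unfolding N1(6)[symmetric] N2(7)[symmetric] integral_map_pmf proj
      by (intro integral_cong_AE) (auto simp: AE_measure_pmf_iff fi)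
  qed
qed

section \<open>Compactness\<close>

lemma tendsto_mult_log:
  fixes p :: "nat \<Rightarrow> real"
  assumes "p \<longlonglongrightarrow> l" "\<And>n. 0 \<le> p n"
  shows "(\<lambda>n. p n * log 2 (p n)) \<longlonglongrightarrow> l * log 2 l"
proof (cases "l = 0")
  case False
  have "0 \<le> l" using assms by (intro LIMSEQ_le_const) auto
  then show ?thesis using False assms(1) by (auto intro!: tendsto_intros)
next
  case True
  \<comment> \<open>Both bounds come from \<open>ln y \<le> y - 1\<close>, with y = 1 / sqrt x for
    the lower one and y = x for the upper one; they squeeze \<open>x * ln x\<close> to 0, its value
    at 0.\<close>
  have lower: "- (2 * sqrt x) \<le> x * ln x" and upper: "x * ln x \<le> x * x" if "0 \<le> x" for x :: real
  proof -
    have "- (2 * sqrt x) \<le> x * ln x \<and> x * ln x \<le> x * x"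
    proof (cases "x = 0")
      case False
      with that have x: "0 < x" by simp
      have "ln (1 / sqrt x) \<le> 1 / sqrt x - 1" using x by (intro ln_le_minus_one) simp
      then have "- ln x \<le> 2 / sqrt x" using x by (simp add: ln_div ln_sqrt)
      then have "x * (- ln x) \<le> x * (2 / sqrt x)" using x by (intro mult_left_mono) auto
      also have "x * (2 / sqrt x) = 2 * (x / sqrt x)" by simp
      also have "\<dots> = 2 * sqrt x" using x real_div_sqrt[of x] by simp
      finally have "- (2 * sqrt x) \<le> x * ln x" by simp
      moreover have "x * ln x \<le> x * x" using x ln_le_minus_one[OF x] by (intro mult_left_mono) auto
      ultimately show ?thesis ..
    qed simp
    then show "- (2 * sqrt x) \<le> x * ln x" "x * ln x \<le> x * x" by auto
  qed
  have "(\<lambda>n. - (2 * sqrt (p n))) \<longlonglongrightarrow> 0" "(\<lambda>n. p n * p n) \<longlonglongrightarrow> 0"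
    using assms(1) True by (auto intro!: tendsto_eq_intros)
  then have "(\<lambda>n. p n * ln (p n)) \<longlonglongrightarrow> 0"
    by (rule tendsto_sandwich[rotated 2]) (auto simp: lower upper assms(2))
  then have "(\<lambda>n. p n * ln (p n) / ln 2) \<longlonglongrightarrow> 0 / ln 2" by (intro tendsto_divide) auto
  then show ?thesis using True by (simp add: log_def)
qed

lemma mis_H_superset:
  assumes "finite S" "set_pmf M \<subseteq> S"
  shows "mis_H M A = - (\<Sum>a\<in>A ` S. mis_pr M A a * log 2 (mis_pr M A a))"
  unfolding mis_H_def using assms
  by (intro arg_cong[of _ _ uminus] sum.mono_neutral_left) (auto simp: mis_pr_eq_0)

context
  fixes S :: "'o set" and Ns :: "nat \<Rightarrow> 'o pmf" and N :: "'o pmf"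
  assumes fS: "finite S" and subs: "\<And>n. set_pmf (Ns n) \<subseteq> S" and sub: "set_pmf N \<subseteq> S"
    and lim: "\<And>\<omega>. (\<lambda>n. pmf (Ns n) \<omega>) \<longlonglongrightarrow> pmf N \<omega>"
begin

lemma tendsto_mis_pr: "(\<lambda>n. mis_pr (Ns n) A a) \<longlonglongrightarrow> mis_pr N A a"
  unfolding mis_pr_def prob_sum[OF fS subs] prob_sum[OF fS sub] by (intro tendsto_intros lim)

lemma tendsto_mis_H: "(\<lambda>n. mis_H (Ns n) A) \<longlonglongrightarrow> mis_H N A"
  unfolding mis_H_superset[OF fS subs] mis_H_superset[OF fS sub]
  by (intro tendsto_intros tendsto_mult_log tendsto_mis_pr) auto

lemma tendsto_mis_I: "(\<lambda>n. mis_I (Ns n) A B C) \<longlonglongrightarrow> mis_I N A B C"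
proof -
  have *: "mis_I M A B C = mis_H M (\<lambda>\<omega>. (A \<omega>, C \<omega>)) + mis_H M (\<lambda>\<omega>. (B \<omega>, C \<omega>))
      - mis_H M (\<lambda>\<omega>. ((A \<omega>, B \<omega>), C \<omega>)) - mis_H M C" if "set_pmf M \<subseteq> S" for M
  proof -
    have "finite (set_pmf M)" using that fS finite_subset by blast
    then show ?thesis by (simp add: mis_I_Iker mis_H_Hker Iker_def)
  qed
  show ?thesis unfolding *[OF subs] *[OF sub] by (intro tendsto_intros tendsto_mis_H)
qed

lemma tendsto_expectation:
  fixes f :: "'o \<Rightarrow> real"
  shows "(\<lambda>n. measure_pmf.expectation (Ns n) f) \<longlonglongrightarrow> measure_pmf.expectation N f"
  unfolding expectation_sum[OF fS subs] expectation_sum[OF fS sub] by (intro tendsto_intros lim)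

end

section \<open>Convergent subsequences of laws\<close>

lemma convergent_subsequence_pointwise:
  fixes f :: "nat \<Rightarrow> 'a \<Rightarrow> real"
  assumes "finite S" "\<And>n a. a \<in> S \<Longrightarrow> 0 \<le> f n a \<and> f n a \<le> 1"
  shows "\<exists>r::nat \<Rightarrow> nat. strict_mono r \<and> (\<forall>a\<in>S. convergent (\<lambda>n. f (r n) a))"
  using assms
proof (induction S rule: finite_induct)
  case empty
  then show ?case by (intro exI[of _ id]) (auto simp: strict_mono_def)
next
  case (insert a S)
  then obtain r :: "nat \<Rightarrow> nat" where r: "strict_mono r" "\<forall>a\<in>S. convergent (\<lambda>n. f (r n) a)" by auto
  have "bounded (range (\<lambda>n. f (r n) a))"
    using insert.prems by (intro boundedI[of _ 1]) auto
  then obtain l q where q: "strict_mono q" "((\<lambda>n. f (r n) a) \<circ> q) \<longlonglongrightarrow> l"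
    using bounded_imp_convergent_subsequence by blast
  have "convergent (\<lambda>n. f ((r \<circ> q) n) b)" if "b \<in> S" for b
    using convergent_subseq_convergent[OF _ q(1), of "\<lambda>n. f (r n) b"] r(2) that by (auto simp: o_def)
  moreover have "convergent (\<lambda>n. f ((r \<circ> q) n) a)" using q(2) by (auto simp: o_def convergent_def)
  ultimately have "\<forall>b\<in>insert a S. convergent (\<lambda>n. f ((r \<circ> q) n) b)" by blast
  then show ?case using strict_mono_o[OF r(1) q(1)] by blast
qed

text \<open>On a common finite support no mass can escape, so the pointwise limit is again a
  probability law.\<close>

lemma pmf_convergent_subsequence:
  fixes Ns :: "nat \<Rightarrow> 'o pmf"
  assumes fS: "finite S" and subs: "\<And>n. set_pmf (Ns n) \<subseteq> S"
  obtains r N where "strict_mono (r :: nat \<Rightarrow> nat)" "set_pmf N \<subseteq> S" "\<And>\<omega>. (\<lambda>n. pmf (Ns (r n)) \<omega>) \<longlonglongrightarrow> pmf N \<omega>"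
proof -
  obtain r :: "nat \<Rightarrow> nat" where r: "strict_mono r" "\<forall>\<omega>\<in>S. convergent (\<lambda>n. pmf (Ns (r n)) \<omega>)"
    using convergent_subsequence_pointwise[OF fS, of "\<lambda>n. pmf (Ns n)"] by (auto simp: pmf_le_1)
  define l where "l \<omega> = lim (\<lambda>n. pmf (Ns (r n)) \<omega>)" for \<omega>
  have z: "pmf (Ns n) \<omega> = 0" if "\<omega> \<notin> S" for n \<omega> using that subs[of n] by (auto simp: set_pmf_iff)
  have l: "(\<lambda>n. pmf (Ns (r n)) \<omega>) \<longlonglongrightarrow> l \<omega>" for \<omega>
    using r(2) z[of \<omega>] by (cases "\<omega> \<in> S") (simp_all add: l_def flip: convergent_LIMSEQ_iff)
  have l0: "0 \<le> l \<omega>" for \<omega> by (rule LIMSEQ_le_const[OF l]) auto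
  have lz: "l \<omega> = 0" if "\<omega> \<notin> S" for \<omega> using LIMSEQ_unique[OF l[of \<omega>]] z[OF that] by simp
  have "(\<lambda>n. \<Sum>\<omega>\<in>S. pmf (Ns (r n)) \<omega>) \<longlonglongrightarrow> (\<Sum>\<omega>\<in>S. l \<omega>)" by (intro tendsto_sum l)
  moreover have "(\<Sum>\<omega>\<in>S. pmf (Ns (r n)) \<omega>) = 1" for n using fS subs by (intro sum_pmf_eq_1)
  ultimately have "(\<Sum>\<omega>\<in>S. l \<omega>) = 1" by (simp add: LIMSEQ_const_iff)
  then obtain N where N: "\<And>\<omega>. pmf N \<omega> = l \<omega>" using pmf_of_weights[of S l] fS l0 lz by blast
  show thesis using r(1) l lz by (intro that[of r N]) (force simp: N set_pmf_iff)+
qed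

lemma constant_subsequence:
  fixes F :: "nat \<Rightarrow> 'a"
  assumes "finite (range F)"
  obtains r c where "strict_mono (r :: nat \<Rightarrow> nat)" "\<And>n. F (r n) = c"
proof -
  obtain m where "infinite {n \<in> UNIV. F n = F m}"
    using pigeonhole_infinite[of "UNIV :: nat set" F] assms by auto
  then obtain r :: "nat \<Rightarrow> nat" where "strict_mono r" "\<forall>n. r n \<in> {n \<in> UNIV. F n = F m}"
    using infinite_enumerate by blast
  then show thesis by (intro that[of r "F m"]) auto
qed

text \<open>The decoders \<open>G n\<close> and \<open>G' n\<close> change along the sequence. Only
  their restrictions to the bounded alphabets matter and there are finitely many of these, so a
  subsequence has one fixed pair of decoders, to which continuity of the expectation
  applies.\<close>

lemma comp_compact:
  fixes Ns :: "nat \<Rightarrow> ('x::finite \<times> 'y::finite \<times> 'z::finite \<times> nat \<times> nat) pmf"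
    and d :: "'x \<Rightarrow> 'r::finite \<Rightarrow> real" and d' :: "'x \<Rightarrow> 's::finite \<Rightarrow> real"
    and G :: "nat \<Rightarrow> nat \<Rightarrow> nat \<Rightarrow> 'y \<Rightarrow> 'r" and G' :: "nat \<Rightarrow> nat \<Rightarrow> 'z \<Rightarrow> 's"
  assumes law: "\<And>n. comp_law P (Ns n)"
    and bW: "\<And>n \<omega>. \<omega> \<in> set_pmf (Ns n) \<Longrightarrow> sW \<omega> < m"
    and bU: "\<And>n \<omega>. \<omega> \<in> set_pmf (Ns n) \<Longrightarrow> sU \<omega> < k"
  obtains r N g g' where "strict_mono (r :: nat \<Rightarrow> nat)" "comp_law P N"
    "\<And>\<omega>. \<omega> \<in> set_pmf N \<Longrightarrow> sW \<omega> < m" "\<And>\<omega>. \<omega> \<in> set_pmf N \<Longrightarrow> sU \<omega> < k"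
    "(\<lambda>n. rate_Y (Ns (r n))) \<longlonglongrightarrow> rate_Y N" "(\<lambda>n. rate_Z (Ns (r n))) \<longlonglongrightarrow> rate_Z N"
    "(\<lambda>n. measure_pmf.expectation (Ns (r n)) (\<lambda>\<omega>. d (sX \<omega>) (G (r n) (sW \<omega>) (sU \<omega>) (sY \<omega>))))
       \<longlonglongrightarrow> measure_pmf.expectation N (\<lambda>\<omega>. d (sX \<omega>) (g (sW \<omega>) (sU \<omega>) (sY \<omega>)))"
    "(\<lambda>n. measure_pmf.expectation (Ns (r n)) (\<lambda>\<omega>. d' (sX \<omega>) (G' (r n) (sW \<omega>) (sZ \<omega>))))
       \<longlonglongrightarrow> measure_pmf.expectation N (\<lambda>\<omega>. d' (sX \<omega>) (g' (sW \<omega>) (sZ \<omega>)))"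
proof -
  define S :: "('x \<times> 'y \<times> 'z \<times> nat \<times> nat) set" where "S = UNIV \<times> UNIV \<times> UNIV \<times> {..<m} \<times> {..<k}"
  have fS: "finite S" by (simp add: S_def)
  have S: "\<omega> \<in> S \<longleftrightarrow> sW \<omega> < m \<and> sU \<omega> < k" for \<omega> by (cases \<omega>) (auto simp: S_def s_defs)
  have subs: "set_pmf (Ns n) \<subseteq> S" for n using bW[of _ n] bU[of _ n] by (intro subsetI) (simp add: S)
  define F where "F n = (restrict (\<lambda>(w, u, y). G n w u y) ({..<m} \<times> {..<k} \<times> UNIV),
      restrict (\<lambda>(w, z). G' n w z) ({..<m} \<times> UNIV))" for n
  have "finite (PiE ({..<m} \<times> {..<k} \<times> (UNIV :: 'y set)) (\<lambda>_. UNIV :: 'r set) \<times>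
      PiE ({..<m} \<times> (UNIV :: 'z set)) (\<lambda>_. UNIV :: 's set))" (is "finite ?T")
    by (intro finite_cartesian_product finite_PiE) auto
  moreover have "range F \<subseteq> ?T"
    unfolding F_def by (intro image_subsetI SigmaI restrict_PiE_iff[THEN iffD2] ballI UNIV_I)
  ultimately have "finite (range F)" by (rule finite_subset[rotated])
  then obtain r1 :: "nat \<Rightarrow> nat" and c where r1: "strict_mono r1" "\<And>n. F (r1 n) = c"
    using constant_subsequence by blast
  obtain r2 :: "nat \<Rightarrow> nat" and N where r2: "strict_mono r2" "set_pmf N \<subseteq> S" "\<And>\<omega>. (\<lambda>n. pmf (Ns (r1 (r2 n))) \<omega>) \<longlonglongrightarrow> pmf N \<omega>"
    using pmf_convergent_subsequence[OF fS, of "\<lambda>n. Ns (r1 n)"] subs by metis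
  define r where "r n = r1 (r2 n)" for n
  define g where "g = G (r 0)"
  define g' where "g' = G' (r 0)"
  have FF: "F (r n) = F (r 0)" for n by (simp add: r_def r1)
  have Geq: "G (r n) w u y = g w u y" if "w < m" "u < k" for n w u y
    using arg_cong[OF FF[of n], of "\<lambda>f. fst f (w, u, y)"] that by (simp add: F_def g_def)
  have Geq': "G' (r n) w z = g' w z" if "w < m" for n w z
    using arg_cong[OF FF[of n], of "\<lambda>f. snd f (w, z)"] that by (simp add: F_def g'_def)
  have limr: "(\<lambda>n. pmf (Ns (r n)) \<omega>) \<longlonglongrightarrow> pmf N \<omega>" for \<omega> using r2(3) by (simp add: r_def)
  note lims = fS subs r2(2) limr
  have finN: "finite (set_pmf N)" using r2(2) fS finite_subset by blast
  show thesis
  proof (rule that[of r N g g'])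
    show "strict_mono r" using strict_mono_o[OF r1(1) r2(1)] unfolding r_def o_def .
    show "sW \<omega> < m" "sU \<omega> < k" if "\<omega> \<in> set_pmf N" for \<omega>
      using that r2(2) S[of \<omega>] by (simp_all add: subset_eq)
    have "map_pmf (\<lambda>\<omega>. (sX \<omega>, sY \<omega>, sZ \<omega>)) N = P"
    proof (rule pmf_eqI)
      fix a
      have "(\<lambda>n. mis_pr (Ns (r n)) (\<lambda>\<omega>. (sX \<omega>, sY \<omega>, sZ \<omega>)) a) \<longlonglongrightarrow> mis_pr N (\<lambda>\<omega>. (sX \<omega>, sY \<omega>, sZ \<omega>)) a"
        by (rule tendsto_mis_pr[OF lims])
      moreover have "mis_pr (Ns (r n)) (\<lambda>\<omega>. (sX \<omega>, sY \<omega>, sZ \<omega>)) a = pmf P a" for n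
        using law[of "r n"] by (simp add: mis_pr_eq_pmf comp_law_def)
      ultimately show "pmf (map_pmf (\<lambda>\<omega>. (sX \<omega>, sY \<omega>, sZ \<omega>)) N) a = pmf P a"
        by (simp add: LIMSEQ_const_iff mis_pr_eq_pmf)
    qed
    \<comment> \<open>The chain is a closed condition: it says that a continuous function of the
      law, the conditional mutual information, is zero.\<close>
    moreover have "mis_markov N (\<lambda>\<omega>. (sW \<omega>, sU \<omega>)) sX (\<lambda>\<omega>. (sY \<omega>, sZ \<omega>))"
    proof -
      have "(\<lambda>n. mis_I (Ns (r n)) (\<lambda>\<omega>. (sW \<omega>, sU \<omega>)) (\<lambda>\<omega>. (sY \<omega>, sZ \<omega>)) sX)
         \<longlonglongrightarrow> mis_I N (\<lambda>\<omega>. (sW \<omega>, sU \<omega>)) (\<lambda>\<omega>. (sY \<omega>, sZ \<omega>)) sX"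
        by (rule tendsto_mis_I[OF lims])
      moreover have "mis_I (Ns (r n)) (\<lambda>\<omega>. (sW \<omega>, sU \<omega>)) (\<lambda>\<omega>. (sY \<omega>, sZ \<omega>)) sX = 0" for n
        using law[of "r n"] by (intro mis_markov_imp_mis_I) (simp add: comp_law_def)
      ultimately have "mis_I N (\<lambda>\<omega>. (sW \<omega>, sU \<omega>)) (\<lambda>\<omega>. (sY \<omega>, sZ \<omega>)) sX = 0"
        by (simp add: LIMSEQ_const_iff)
      then show ?thesis by (rule mis_I_eq_0_imp_markov[OF finN])
    qed
    ultimately show "comp_law P N" using finN by (simp add: comp_law_def)
    show "(\<lambda>n. rate_Y (Ns (r n))) \<longlonglongrightarrow> rate_Y N" "(\<lambda>n. rate_Z (Ns (r n))) \<longlonglongrightarrow> rate_Z N"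
      unfolding rate_Y_def rate_Z_def by (intro tendsto_add tendsto_mis_I[OF lims])+
    have "measure_pmf.expectation (Ns (r n)) (\<lambda>\<omega>. d (sX \<omega>) (G (r n) (sW \<omega>) (sU \<omega>) (sY \<omega>)))
        = measure_pmf.expectation (Ns (r n)) (\<lambda>\<omega>. d (sX \<omega>) (g (sW \<omega>) (sU \<omega>) (sY \<omega>)))" for n
      by (intro integral_cong_AE) (auto simp: AE_measure_pmf_iff Geq bW bU)
    then show "(\<lambda>n. measure_pmf.expectation (Ns (r n)) (\<lambda>\<omega>. d (sX \<omega>) (G (r n) (sW \<omega>) (sU \<omega>) (sY \<omega>))))
       \<longlonglongrightarrow> measure_pmf.expectation N (\<lambda>\<omega>. d (sX \<omega>) (g (sW \<omega>) (sU \<omega>) (sY \<omega>)))"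
      by (simp add: tendsto_expectation[OF lims])
    have "measure_pmf.expectation (Ns (r n)) (\<lambda>\<omega>. d' (sX \<omega>) (G' (r n) (sW \<omega>) (sZ \<omega>)))
        = measure_pmf.expectation (Ns (r n)) (\<lambda>\<omega>. d' (sX \<omega>) (g' (sW \<omega>) (sZ \<omega>)))" for n
      by (intro integral_cong_AE) (auto simp: AE_measure_pmf_iff Geq' bW)
    then show "(\<lambda>n. measure_pmf.expectation (Ns (r n)) (\<lambda>\<omega>. d' (sX \<omega>) (G' (r n) (sW \<omega>) (sZ \<omega>))))
       \<longlonglongrightarrow> measure_pmf.expectation N (\<lambda>\<omega>. d' (sX \<omega>) (g' (sW \<omega>) (sZ \<omega>)))"
      by (simp add: tendsto_expectation[OF lims])
  qed
qed

section \<open>Converse\<close>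

text \<open>In the second component decoder 2 has the stronger side information. Exchanging the two
  side informations brings it into the form of one component, in which the stronger one comes
  first.\<close>

definition sswap :: "'x \<times> 'y \<times> 'z \<times> 'w \<times> 'u \<Rightarrow> 'x \<times> 'z \<times> 'y \<times> 'w \<times> 'u" where
  "sswap \<omega> = (sX \<omega>, sZ \<omega>, sY \<omega>, sW \<omega>, sU \<omega>)"

lemma s_sswap [simp]: "sX (sswap \<omega>) = sX \<omega>" "sY (sswap \<omega>) = sZ \<omega>" "sZ (sswap \<omega>) = sY \<omega>"
  "sW (sswap \<omega>) = sW \<omega>" "sU (sswap \<omega>) = sU \<omega>"
  by (simp_all add: sswap_def s_defs)

lemma m_eq_s:
  "mX1 = (\<lambda>\<omega>. sX (fst \<omega>))" "mY11 = (\<lambda>\<omega>. sY (fst \<omega>))" "mY21 = (\<lambda>\<omega>. sZ (fst \<omega>))"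
  "mW1 = (\<lambda>\<omega>. sW (fst \<omega>))" "mU1 = (\<lambda>\<omega>. sU (fst \<omega>))"
  "mX2 = (\<lambda>\<omega>. sX (snd \<omega>))" "mY12 = (\<lambda>\<omega>. sY (snd \<omega>))" "mY22 = (\<lambda>\<omega>. sZ (snd \<omega>))"
  "mW2 = (\<lambda>\<omega>. sW (snd \<omega>))" "mU2 = (\<lambda>\<omega>. sU (snd \<omega>))"
  by (auto simp: mX1_def mY11_def mY21_def mW1_def mU1_def mX2_def mY12_def mY22_def mW2_def mU2_def s_defs)

abbreviation "swap_YZ P \<equiv> map_pmf (\<lambda>(x, y, z). (x, z, y)) P"

lemma mis_I_fst: "mis_I (pair_pmf N M) (\<lambda>\<omega>. A (fst \<omega>)) (\<lambda>\<omega>. B (fst \<omega>)) (\<lambda>\<omega>. C (fst \<omega>)) = mis_I N A B C"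
  using mis_I_map[of fst "pair_pmf N M" A B C] by (simp add: map_fst_pair_pmf)

lemma mis_I_snd: "mis_I (pair_pmf N M) (\<lambda>\<omega>. A (snd \<omega>)) (\<lambda>\<omega>. B (snd \<omega>)) (\<lambda>\<omega>. C (snd \<omega>)) = mis_I M A B C"
  using mis_I_map[of snd "pair_pmf N M" A B C] by (simp add: map_snd_pair_pmf)

lemma mis_markov_fst: "mis_markov (pair_pmf N M) (\<lambda>\<omega>. A (fst \<omega>)) (\<lambda>\<omega>. B (fst \<omega>)) (\<lambda>\<omega>. C (fst \<omega>)) = mis_markov N A B C"
  using mis_markov_map[of fst "pair_pmf N M" A B C] by (simp add: map_fst_pair_pmf)

lemma mis_markov_snd: "mis_markov (pair_pmf N M) (\<lambda>\<omega>. A (snd \<omega>)) (\<lambda>\<omega>. B (snd \<omega>)) (\<lambda>\<omega>. C (snd \<omega>)) = mis_markov M A B C"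
  using mis_markov_map[of snd "pair_pmf N M" A B C] by (simp add: map_snd_pair_pmf)

lemma expectation_fst:
  fixes f :: "'a \<Rightarrow> real"
  shows "measure_pmf.expectation (pair_pmf N M) (\<lambda>\<omega>. f (fst \<omega>)) = measure_pmf.expectation N f"
  using integral_map_pmf[of fst "pair_pmf N M" f] by (simp add: map_fst_pair_pmf)

lemma expectation_snd:
  fixes f :: "'b \<Rightarrow> real"
  shows "measure_pmf.expectation (pair_pmf N M) (\<lambda>\<omega>. f (snd \<omega>)) = measure_pmf.expectation M f"
  using integral_map_pmf[of snd "pair_pmf N M" f] by (simp add: map_snd_pair_pmf)

lemma mis_markov_swap:
  assumes "finite (set_pmf M)" "mis_markov M A B (\<lambda>\<omega>. (C \<omega>, D \<omega>))"
  shows "mis_markov M A B (\<lambda>\<omega>. (D \<omega>, C \<omega>))"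
  using assms(2) unfolding mis_markov_iff_Iker[OF assms(1)] by (simp add: Int_commute)

text \<open>Each information term and each distortion involves a single component, so the product of
  two component laws has the rates and distortions of its factors and satisfies (2) by
  construction.\<close>

lemma RM_product:
  fixes N1 :: "('x1::finite \<times> 'y11 \<times> 'y21 \<times> nat \<times> nat) pmf"
    and N2 :: "('x2::finite \<times> 'y22 \<times> 'y12 \<times> nat \<times> nat) pmf"
  assumes N1: "comp_law P1 N1" and N2: "comp_law (swap_YZ P2) N2"
    and b1: "\<And>\<omega>. \<omega> \<in> set_pmf N1 \<Longrightarrow> sW \<omega> < CARD('x1) + 3"
      "\<And>\<omega>. \<omega> \<in> set_pmf N1 \<Longrightarrow> sU \<omega> < CARD('x1) * (CARD('x1) + 3) + 1"
    and b2: "\<And>\<omega>. \<omega> \<in> set_pmf N2 \<Longrightarrow> sW \<omega> < CARD('x2) + 3"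
      "\<And>\<omega>. \<omega> \<in> set_pmf N2 \<Longrightarrow> sU \<omega> < CARD('x2) * (CARD('x2) + 3) + 1"
    and "measure_pmf.expectation N1 (\<lambda>\<omega>. d11 (sX \<omega>) (g11 (sW \<omega>) (sU \<omega>) (sY \<omega>))) \<le> D 1 1"
    and "measure_pmf.expectation N1 (\<lambda>\<omega>. d21 (sX \<omega>) (g21 (sW \<omega>) (sZ \<omega>))) \<le> D 2 1"
    and "measure_pmf.expectation N2 (\<lambda>\<omega>. d22 (sX \<omega>) (g22 (sW \<omega>) (sU \<omega>) (sY \<omega>))) \<le> D 2 2"
    and "measure_pmf.expectation N2 (\<lambda>\<omega>. d12 (sX \<omega>) (g12 (sW \<omega>) (sZ \<omega>))) \<le> D 1 2"
  shows "RM P1 P2 d11 d12 d21 d22 D \<le> ereal (max (rate_Y N1 + rate_Z N2) (rate_Z N1 + rate_Y N2))"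
proof -
  let ?M = "map_pmf sswap N2"
  define Q where "Q = pair_pmf N1 ?M"
  have Q: "map_pmf fst Q = N1" "map_pmf snd Q = map_pmf sswap N2"
    by (simp_all add: Q_def map_fst_pair_pmf map_snd_pair_pmf)
  have "RM_1 Q = rate_Y N1 + rate_Z N2" "RM_2 Q = rate_Z N1 + rate_Y N2"
    unfolding RM_1_def RM_2_def m_eq_s Q_def rate_Y_def rate_Z_def
    using mis_I_fst[of N1 ?M sX sW sY] mis_I_fst[of N1 ?M sX sW sZ] mis_I_fst[of N1 ?M sX sU "\<lambda>\<omega>. (sY \<omega>, sW \<omega>)"]
      mis_I_snd[of N1 ?M sX sW sY] mis_I_snd[of N1 ?M sX sW sZ] mis_I_snd[of N1 ?M sX sU "\<lambda>\<omega>. (sZ \<omega>, sW \<omega>)"]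
      mis_I_map[of sswap N2 sX sW sY] mis_I_map[of sswap N2 sX sW sZ] mis_I_map[of sswap N2 sX sU "\<lambda>\<omega>. (sZ \<omega>, sW \<omega>)"]
    by simp_all
  moreover have "RM_feasible P1 P2 d11 d12 d21 d22 D Q"
    unfolding RM_feasible_def
  proof (intro conjI)
    have "map_pmf (\<lambda>(x, y, y', w, u). (x, y, y')) N1 = map_pmf (\<lambda>\<omega>. (sX \<omega>, sY \<omega>, sZ \<omega>)) N1"
      by (intro map_pmf_cong) (auto simp: s_defs)
    then show "map_pmf (\<lambda>(x, y, y', w, u). (x, y, y')) (map_pmf fst Q) = P1"
      using N1 by (simp add: Q comp_law_def)
    have "map_pmf (\<lambda>(x, y, y', w, u). (x, y, y')) (map_pmf snd Q)
      = swap_YZ (map_pmf (\<lambda>\<omega>. (sX \<omega>, sY \<omega>, sZ \<omega>)) N2)"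
      unfolding Q map_pmf_comp by (intro map_pmf_cong) (auto simp: sswap_def)
    also have "\<dots> = swap_YZ (swap_YZ P2)" using N2 by (simp add: comp_law_def)
    also have "\<dots> = P2" by (simp add: map_pmf_comp case_prod_unfold)
    finally show "map_pmf (\<lambda>(x, y, y', w, u). (x, y, y')) (map_pmf snd Q) = P2" .
    show "mis_markov Q (\<lambda>\<omega>. (mW1 \<omega>, mU1 \<omega>)) mX1 (\<lambda>\<omega>. (mY11 \<omega>, mY21 \<omega>))"
      using N1 mis_markov_fst[of N1 ?M "\<lambda>\<omega>. (sW \<omega>, sU \<omega>)" sX "\<lambda>\<omega>. (sY \<omega>, sZ \<omega>)"]
      unfolding m_eq_s Q_def comp_law_def by blast
    have "mis_markov N2 (\<lambda>\<omega>. (sW \<omega>, sU \<omega>)) sX (\<lambda>\<omega>. (sZ \<omega>, sY \<omega>))"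
      using N2 unfolding comp_law_def by (blast intro: mis_markov_swap)
    then show "mis_markov Q (\<lambda>\<omega>. (mW2 \<omega>, mU2 \<omega>)) mX2 (\<lambda>\<omega>. (mY12 \<omega>, mY22 \<omega>))"
      using mis_markov_snd[of N1 ?M "\<lambda>\<omega>. (sW \<omega>, sU \<omega>)" sX "\<lambda>\<omega>. (sY \<omega>, sZ \<omega>)"]
      unfolding m_eq_s Q_def mis_markov_map s_sswap by blast
    show "Q = pair_pmf (map_pmf fst Q) (map_pmf snd Q)" unfolding Q by (simp add: Q_def)
    show "\<exists>g11. measure_pmf.expectation Q (\<lambda>\<omega>. d11 (mX1 \<omega>) (g11 (mW1 \<omega>) (mU1 \<omega>) (mY11 \<omega>))) \<le> D 1 1"
      using assms(7) expectation_fst[of N1 "map_pmf sswap N2" "\<lambda>\<omega>. d11 (sX \<omega>) (g11 (sW \<omega>) (sU \<omega>) (sY \<omega>))"]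
      unfolding m_eq_s Q_def by (intro exI[of _ g11]) simp
    show "\<exists>g12. measure_pmf.expectation Q (\<lambda>\<omega>. d12 (mX2 \<omega>) (g12 (mW2 \<omega>) (mY12 \<omega>))) \<le> D 1 2"
      using assms(10) expectation_snd[of N1 "map_pmf sswap N2" "\<lambda>\<omega>. d12 (sX \<omega>) (g12 (sW \<omega>) (sY \<omega>))"]
      unfolding m_eq_s Q_def by (intro exI[of _ g12]) simp
    show "\<exists>g21. measure_pmf.expectation Q (\<lambda>\<omega>. d21 (mX1 \<omega>) (g21 (mW1 \<omega>) (mY21 \<omega>))) \<le> D 2 1"
      using assms(8) expectation_fst[of N1 "map_pmf sswap N2" "\<lambda>\<omega>. d21 (sX \<omega>) (g21 (sW \<omega>) (sZ \<omega>))"]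
      unfolding m_eq_s Q_def by (intro exI[of _ g21]) simp
    show "\<exists>g22. measure_pmf.expectation Q (\<lambda>\<omega>. d22 (mX2 \<omega>) (g22 (mW2 \<omega>) (mU2 \<omega>) (mY22 \<omega>))) \<le> D 2 2"
      using assms(9) expectation_snd[of N1 "map_pmf sswap N2" "\<lambda>\<omega>. d22 (sX \<omega>) (g22 (sW \<omega>) (sU \<omega>) (sZ \<omega>))"]
      unfolding m_eq_s Q_def by (intro exI[of _ g22]) simp
    show "\<forall>\<omega>\<in>set_pmf Q. mW1 \<omega> < CARD('x1) + 3 \<and> mU1 \<omega> < CARD('x1) * (CARD('x1) + 3) + 1 \<and>
        mW2 \<omega> < CARD('x2) + 3 \<and> mU2 \<omega> < CARD('x2) * (CARD('x2) + 3) + 1"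
    proof
      fix \<omega> assume "\<omega> \<in> set_pmf Q"
      then obtain \<omega>1 \<omega>2 where "\<omega>1 \<in> set_pmf N1" "\<omega>2 \<in> set_pmf N2" "\<omega> = (\<omega>1, sswap \<omega>2)"
        by (auto simp: Q_def)
      then show "mW1 \<omega> < CARD('x1) + 3 \<and> mU1 \<omega> < CARD('x1) * (CARD('x1) + 3) + 1 \<and>
        mW2 \<omega> < CARD('x2) + 3 \<and> mU2 \<omega> < CARD('x2) * (CARD('x2) + 3) + 1"
        using b1[of \<omega>1] b2[of \<omega>2] by (simp add: m_eq_s)
    qed
  qed
  ultimately show ?thesis unfolding RM_def by (intro INF_lower2[of Q]) auto
qed

section \<open>From an admissible triple of the lower bound to two component laws\<close>

lemma rker_prod: "rker A = rker (\<lambda>\<omega>. fst (A \<omega>)) \<inter> rker (\<lambda>\<omega>. snd (A \<omega>))"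
  by (auto simp: rker_def prod_eq_iff)

lemma Iker_pair_pmf:
  assumes "finite (set_pmf A)" "finite (set_pmf B)"
  shows "Iker (pair_pmf A B) (rker fst) (rker snd) UNIV = 0"
proof -
  have fin: "finite (set_pmf (pair_pmf A B))" using assms by simp
  have "mis_markov (pair_pmf A B) fst (\<lambda>_. ()) snd"
    unfolding mis_markov_def
  proof (intro allI)
    fix a b and u :: unit
    have "mis_pr (pair_pmf A B) (\<lambda>\<omega>. (fst \<omega>, (), snd \<omega>)) (a, u, b) = pmf (pair_pmf A B) (a, b)"
      unfolding mis_pr_def measure_pmf_single[symmetric]
      by (intro arg_cong[of _ _ "measure_pmf.prob _"]) auto
    moreover have "mis_pr (pair_pmf A B) (\<lambda>\<omega>. (fst \<omega>, ())) (a, u) = pmf (map_pmf fst (pair_pmf A B)) a"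
      unfolding mis_pr_eq_pmf[symmetric] by (simp add: mis_pr_def)
    moreover have "mis_pr (pair_pmf A B) (\<lambda>\<omega>. ((), snd \<omega>)) (u, b) = pmf (map_pmf snd (pair_pmf A B)) b"
      unfolding mis_pr_eq_pmf[symmetric] by (simp add: mis_pr_def)
    moreover have "mis_pr (pair_pmf A B) (\<lambda>_. ()) u = 1" by (simp add: mis_pr_def)
    ultimately show "mis_pr (pair_pmf A B) (\<lambda>\<omega>. (fst \<omega>, (), snd \<omega>)) (a, u, b) * mis_pr (pair_pmf A B) (\<lambda>_. ()) u
      = mis_pr (pair_pmf A B) (\<lambda>\<omega>. (fst \<omega>, ())) (a, u) * mis_pr (pair_pmf A B) (\<lambda>\<omega>. ((), snd \<omega>)) (u, b)"
      by (simp add: pmf_pair map_fst_pair_pmf map_snd_pair_pmf)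
  qed
  then show ?thesis unfolding mis_markov_iff_Iker[OF fin] by simp
qed

lemma Iker_map:
  assumes "finite (set_pmf M)"
  shows "Iker (map_pmf f M) (rker A) (rker B) (rker C) = Iker M (rker (\<lambda>\<omega>. A (f \<omega>))) (rker (\<lambda>\<omega>. B (f \<omega>))) (rker (\<lambda>\<omega>. C (f \<omega>)))"
  using mis_I_map[of f M A B C] assms by (simp add: mis_I_Iker)

lemma converse_components:
  fixes P1 :: "('x1::finite \<times> 'y11::finite \<times> 'y21::finite) pmf"
    and P2 :: "('x2::finite \<times> 'y12::finite \<times> 'y22::finite) pmf"
    and D :: "nat \<Rightarrow> nat \<Rightarrow> real"
  assumes dg1: "mis_markov P1 (\<lambda>(x, y11, y21). x) (\<lambda>(x, y11, y21). y11) (\<lambda>(x, y11, y21). y21)"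
    and dg2: "mis_markov P2 (\<lambda>(x, y12, y22). x) (\<lambda>(x, y12, y22). y22) (\<lambda>(x, y12, y22). y12)"
    and Q: "Q \<in> Cbar d11 d12 d21 d22 D \<epsilon> (mis_src P1 P2)"
  obtains N1 :: "('x1 \<times> 'y11 \<times> 'y21 \<times> nat \<times> nat) pmf" and N2 :: "('x2 \<times> 'y22 \<times> 'y12 \<times> nat \<times> nat) pmf"
    and g11 g21 g22 g12 where
    "comp_law P1 N1" "comp_law (swap_YZ P2) N2"
    "\<And>\<omega>. \<omega> \<in> set_pmf N1 \<Longrightarrow> sW \<omega> < CARD('x1) + 3"
    "\<And>\<omega>. \<omega> \<in> set_pmf N1 \<Longrightarrow> sU \<omega> < CARD('x1) * (CARD('x1) + 3) + 1"
    "\<And>\<omega>. \<omega> \<in> set_pmf N2 \<Longrightarrow> sW \<omega> < CARD('x2) + 3"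
    "\<And>\<omega>. \<omega> \<in> set_pmf N2 \<Longrightarrow> sU \<omega> < CARD('x2) * (CARD('x2) + 3) + 1"
    "measure_pmf.expectation N1 (\<lambda>\<omega>. d11 (sX \<omega>) (g11 (sW \<omega>) (sU \<omega>) (sY \<omega>))) \<le> D 1 1 + \<epsilon>"
    "measure_pmf.expectation N1 (\<lambda>\<omega>. d21 (sX \<omega>) (g21 (sW \<omega>) (sZ \<omega>))) \<le> D 2 1 + \<epsilon>"
    "measure_pmf.expectation N2 (\<lambda>\<omega>. d22 (sX \<omega>) (g22 (sW \<omega>) (sU \<omega>) (sY \<omega>))) \<le> D 2 2 + \<epsilon>"
    "measure_pmf.expectation N2 (\<lambda>\<omega>. d12 (sX \<omega>) (g12 (sW \<omega>) (sZ \<omega>))) \<le> D 1 2 + \<epsilon>"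
    "rate_Y N1 + rate_Z N2 \<le> Rbar_lb Q" "rate_Z N1 + rate_Y N2 \<le> Rbar_lb Q"
proof -
  from Q obtain g11 g12 g21 g22 where fin: "finite (set_pmf Q)" and src: "map_pmf fst Q = mis_src P1 P2"
    and mk0: "mis_markov Q (\<lambda>\<omega>. (lY1 \<omega>, lY2 \<omega>)) lX snd"
    and g11: "measure_pmf.expectation Q (\<lambda>\<omega>. d11 (fst (lX \<omega>)) (g11 (lA \<omega>) (lB \<omega>) (lY1 \<omega>))) \<le> D 1 1 + \<epsilon>"
    and g12: "measure_pmf.expectation Q (\<lambda>\<omega>. d12 (snd (lX \<omega>)) (g12 (lA \<omega>) (lB \<omega>) (lY1 \<omega>))) \<le> D 1 2 + \<epsilon>"
    and g21: "measure_pmf.expectation Q (\<lambda>\<omega>. d21 (fst (lX \<omega>)) (g21 (lA \<omega>) (lC \<omega>) (lY2 \<omega>))) \<le> D 2 1 + \<epsilon>"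
    and g22: "measure_pmf.expectation Q (\<lambda>\<omega>. d22 (snd (lX \<omega>)) (g22 (lA \<omega>) (lC \<omega>) (lY2 \<omega>))) \<le> D 2 2 + \<epsilon>"
    unfolding Cbar_def by blast
  define x1 where "x1 = (\<lambda>\<omega> :: (('x1 \<times> 'x2) \<times> ('y11 \<times> 'y12) \<times> ('y21 \<times> 'y22)) \<times> (nat \<times> nat \<times> nat). fst (lX \<omega>))"
  define x2 where "x2 = (\<lambda>\<omega> :: (('x1 \<times> 'x2) \<times> ('y11 \<times> 'y12) \<times> ('y21 \<times> 'y22)) \<times> (nat \<times> nat \<times> nat). snd (lX \<omega>))"
  define y11 where "y11 = (\<lambda>\<omega> :: (('x1 \<times> 'x2) \<times> ('y11 \<times> 'y12) \<times> ('y21 \<times> 'y22)) \<times> (nat \<times> nat \<times> nat). fst (lY1 \<omega>))"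
  define y12 where "y12 = (\<lambda>\<omega> :: (('x1 \<times> 'x2) \<times> ('y11 \<times> 'y12) \<times> ('y21 \<times> 'y22)) \<times> (nat \<times> nat \<times> nat). snd (lY1 \<omega>))"
  define y21 where "y21 = (\<lambda>\<omega> :: (('x1 \<times> 'x2) \<times> ('y11 \<times> 'y12) \<times> ('y21 \<times> 'y22)) \<times> (nat \<times> nat \<times> nat). fst (lY2 \<omega>))"
  define y22 where "y22 = (\<lambda>\<omega> :: (('x1 \<times> 'x2) \<times> ('y11 \<times> 'y12) \<times> ('y21 \<times> 'y22)) \<times> (nat \<times> nat \<times> nat). snd (lY2 \<omega>))"
  have kX: "rker lX = rker x1 \<inter> rker x2" and kY1: "rker lY1 = rker y11 \<inter> rker y12"
    and kY2: "rker lY2 = rker y21 \<inter> rker y22"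
    unfolding x1_def x2_def y11_def y12_def y21_def y22_def by (rule rker_prod)+
  have kV: "rker snd = rker lA \<inter> rker lB \<inter> rker lC"
    by (auto simp: rker_def lA_def lB_def lC_def prod_eq_iff)

  have pr: "map_pmf (\<lambda>\<omega>. ((x1 \<omega>, y11 \<omega>, y21 \<omega>), (x2 \<omega>, y12 \<omega>, y22 \<omega>))) Q = pair_pmf P1 P2"
  proof -
    have "map_pmf (\<lambda>\<omega>. ((x1 \<omega>, y11 \<omega>, y21 \<omega>), (x2 \<omega>, y12 \<omega>, y22 \<omega>))) Q
      = map_pmf (\<lambda>((x1, x2), (y11, y12), (y21, y22)). ((x1, y11, y21), (x2, y12, y22))) (map_pmf fst Q)"
      unfolding map_pmf_comp
      by (intro map_pmf_cong) (auto simp: x1_def x2_def y11_def y12_def y21_def y22_def lX_def lY1_def lY2_def)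
    also have "\<dots> = pair_pmf P1 P2"
      unfolding src mis_src_def map_pmf_comp by (simp add: case_prod_unfold)
    finally show ?thesis .
  qed
  have law1: "map_pmf (\<lambda>\<omega>. (x1 \<omega>, y11 \<omega>, y21 \<omega>)) Q = P1"
    using arg_cong[OF pr, of "map_pmf fst"] by (simp add: map_pmf_comp map_fst_pair_pmf)
  have law2: "map_pmf (\<lambda>\<omega>. (x2 \<omega>, y12 \<omega>, y22 \<omega>)) Q = P2"
    using arg_cong[OF pr, of "map_pmf snd"] by (simp add: map_pmf_comp map_snd_pair_pmf)
  have ind: "Iker Q (rker x1 \<inter> (rker y11 \<inter> rker y21)) (rker x2 \<inter> (rker y12 \<inter> rker y22)) UNIV = 0"
  proof -
    have "finite (set_pmf P1)" "finite (set_pmf P2)" by simp_all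
    from Iker_pair_pmf[OF this] have "Iker (pair_pmf P1 P2) (rker fst) (rker snd) (rker (\<lambda>_. ())) = 0" by simp
    then show ?thesis unfolding pr[symmetric] Iker_map[OF fin] by simp
  qed
  have mk: "Iker Q ((rker y11 \<inter> rker y21) \<inter> (rker y12 \<inter> rker y22)) (rker lA \<inter> rker lB \<inter> rker lC) (rker x1 \<inter> rker x2) = 0"
    using mk0 unfolding mis_markov_iff_Iker[OF fin] rker_pair kX kY1 kY2 kV by (simp add: Int_ac)
  have d1: "Iker Q (rker x1) (rker y21) (rker y11) = 0"
    using dg1 unfolding law1[symmetric] mis_markov_map mis_markov_iff_Iker[OF fin] by simp
  have d2: "Iker Q (rker x2) (rker y12) (rker y22) = 0"
    using dg2 unfolding law2[symmetric] mis_markov_map mis_markov_iff_Iker[OF fin] by simp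
  \<comment> \<open>The second order of decoding is the first one with the two components and the
    two decoders exchanged.\<close>
  have ind': "Iker Q (rker x2 \<inter> (rker y22 \<inter> rker y12)) (rker x1 \<inter> (rker y21 \<inter> rker y11)) UNIV = 0"
    using ind by (subst Iker_sym) (simp add: Int_ac)
  have mk': "Iker Q ((rker y22 \<inter> rker y12) \<inter> (rker y21 \<inter> rker y11)) (rker lA \<inter> rker lC \<inter> rker lB) (rker x2 \<inter> rker x1) = 0"
    using mk by (simp add: Int_ac)
  \<comment> \<open>The auxiliary variables chosen for the first component are functions of the
    second component and of (V, U1, U2), so (1) follows from this by coarsening; \<open>m2\<close>
    serves the second component.\<close>
  have m1: "Iker Q (rker y11 \<inter> rker y21) (rker x2 \<inter> (rker y12 \<inter> rker y22) \<inter> (rker lA \<inter> rker lB \<inter> rker lC)) (rker x1) = 0"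
    by (rule component_markov[OF fin _ _ _ _ _ ind mk]) auto
  have m2: "Iker Q (rker y22 \<inter> rker y12) (rker x1 \<inter> (rker y21 \<inter> rker y11) \<inter> (rker lA \<inter> rker lC \<inter> rker lB)) (rker x2) = 0"
    by (rule component_markov[OF fin _ _ _ _ _ ind' mk']) auto

  define N1 where "N1 = map_pmf (\<lambda>\<omega>. (x1 \<omega>, y11 \<omega>, y21 \<omega>, (lA \<omega>, lC \<omega>, y22 \<omega>), (lB \<omega>, y12 \<omega>))) Q"
  define N2 where "N2 = map_pmf (\<lambda>\<omega>. (x2 \<omega>, y22 \<omega>, y12 \<omega>, (lA \<omega>, lB \<omega>, y11 \<omega>), (lC \<omega>, y21 \<omega>))) Q"
  have s: "sX (a, b, c, d, e) = a" "sY (a, b, c, d, e) = b" "sZ (a, b, c, d, e) = c" "sW (a, b, c, d, e) = d"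
    "sU (a, b, c, d, e) = e" for a b c d e by (simp_all add: s_defs)
  have c1: "comp_law P1 N1"
    unfolding comp_law_def N1_def map_pmf_comp mis_markov_map s
  proof (intro conjI)
    show "mis_markov Q (\<lambda>\<omega>. ((lA \<omega>, lC \<omega>, y22 \<omega>), lB \<omega>, y12 \<omega>)) x1 (\<lambda>\<omega>. (y11 \<omega>, y21 \<omega>))"
      unfolding mis_markov_iff_Iker[OF fin]
      by (subst Iker_sym, rule Iker_zero_mono_both[OF fin _ _ _ _ _ m1]) auto
  qed (use fin law1 in auto)
  have c2: "comp_law (swap_YZ P2) N2"
    unfolding comp_law_def N2_def map_pmf_comp mis_markov_map s
  proof (intro conjI)
    show "mis_markov Q (\<lambda>\<omega>. ((lA \<omega>, lB \<omega>, y11 \<omega>), lC \<omega>, y21 \<omega>)) x2 (\<lambda>\<omega>. (y22 \<omega>, y12 \<omega>))"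
      unfolding mis_markov_iff_Iker[OF fin]
      by (subst Iker_sym, rule Iker_zero_mono_both[OF fin _ _ _ _ _ m2]) auto
    show "map_pmf (\<lambda>\<omega>. (x2 \<omega>, y22 \<omega>, y12 \<omega>)) Q = swap_YZ P2"
      unfolding law2[symmetric] map_pmf_comp by simp
  qed (use fin in auto)
  have "rate_Y N1 + rate_Z N2 \<le> mis_I Q lX (\<lambda>\<omega>. (lA \<omega>, lB \<omega>)) lY1 +
      mis_I Q lX lC (\<lambda>\<omega>. (lA \<omega>, lB \<omega>, lY1 \<omega>, lY2 \<omega>))"
    using converse_inequality[OF fin equiv_rker equiv_rker equiv_rker equiv_rker equiv_rker equiv_rker equiv_rker equiv_rker equiv_rker ind mk d1 d2]
    unfolding rate_Y_def rate_Z_def N1_def N2_def mis_I_map s mis_I_Iker[OF fin] rker_pair kX kY1 kY2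
    by (simp add: Int_ac)
  then have r1: "rate_Y N1 + rate_Z N2 \<le> Rbar_lb Q" by (simp add: Rbar_lb_def)
  have "rate_Z N1 + rate_Y N2 \<le> mis_I Q lX (\<lambda>\<omega>. (lA \<omega>, lC \<omega>)) lY2 +
      mis_I Q lX lB (\<lambda>\<omega>. (lA \<omega>, lC \<omega>, lY1 \<omega>, lY2 \<omega>))"
    using converse_inequality[OF fin equiv_rker equiv_rker equiv_rker equiv_rker equiv_rker equiv_rker equiv_rker equiv_rker equiv_rker ind' mk' d2 d1]
    unfolding rate_Y_def rate_Z_def N1_def N2_def mis_I_map s mis_I_Iker[OF fin] rker_pair kX kY1 kY2
    by (simp add: Int_ac)
  then have r2: "rate_Z N1 + rate_Y N2 \<le> Rbar_lb Q" by (simp add: Rbar_lb_def)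
  let ?h11 = "\<lambda>(v, u2, y22) (u1, y12) y11. g11 v u1 (y11, y12)"
  let ?h21 = "\<lambda>(v, u2, y22) y21. g21 v u2 (y21, y22)"
  let ?h22 = "\<lambda>(v, u1, y11) (u2, y21) y22. g22 v u2 (y21, y22)"
  let ?h12 = "\<lambda>(v, u1, y11) y12. g12 v u1 (y11, y12)"
  have e11: "measure_pmf.expectation N1 (\<lambda>\<omega>. d11 (sX \<omega>) (?h11 (sW \<omega>) (sU \<omega>) (sY \<omega>))) \<le> D 1 1 + \<epsilon>"
    using g11 unfolding N1_def integral_map_pmf s by (simp add: x1_def y11_def y12_def)
  have e21: "measure_pmf.expectation N1 (\<lambda>\<omega>. d21 (sX \<omega>) (?h21 (sW \<omega>) (sZ \<omega>))) \<le> D 2 1 + \<epsilon>"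
    using g21 unfolding N1_def integral_map_pmf s by (simp add: x1_def y21_def y22_def)
  have e22: "measure_pmf.expectation N2 (\<lambda>\<omega>. d22 (sX \<omega>) (?h22 (sW \<omega>) (sU \<omega>) (sY \<omega>))) \<le> D 2 2 + \<epsilon>"
    using g22 unfolding N2_def integral_map_pmf s by (simp add: x2_def y21_def y22_def)
  have e12: "measure_pmf.expectation N2 (\<lambda>\<omega>. d12 (sX \<omega>) (?h12 (sW \<omega>) (sZ \<omega>))) \<le> D 1 2 + \<epsilon>"
    using g12 unfolding N2_def integral_map_pmf s by (simp add: x2_def y11_def y12_def)
  show thesis
  proof (rule cardinality_bound[OF c1, of d11 ?h11 d21 ?h21], rule cardinality_bound[OF c2, of d22 ?h22 d12 ?h12], goal_cases)
    case (1 N1' G11 G21 N2' G22 G12)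
    show thesis
      by (rule that[OF 1(1) 1(8) 1(2,3) 1(9,10), of G11 G21 G22 G12])
        (use 1 e11 e21 e22 e12 r1 r2 in linarith)+
  qed
qed

text \<open>Each \<open>Q n\<close> yields two component laws with bounded alphabets, whose slack
  \<open>\<epsilon> n\<close> in the distortions and in the rates disappears in the limit of a
  common subsequence.\<close>

lemma converse_limit:
  fixes P1 :: "('x1::finite \<times> 'y11::finite \<times> 'y21::finite) pmf"
    and P2 :: "('x2::finite \<times> 'y12::finite \<times> 'y22::finite) pmf"
    and d11 :: "'x1 \<Rightarrow> 'z11::finite \<Rightarrow> real"
    and d12 :: "'x2 \<Rightarrow> 'z12::finite \<Rightarrow> real"
    and d21 :: "'x1 \<Rightarrow> 'z21::finite \<Rightarrow> real"
    and d22 :: "'x2 \<Rightarrow> 'z22::finite \<Rightarrow> real"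
    and D :: "nat \<Rightarrow> nat \<Rightarrow> real"
  assumes dg: "mis_markov P1 (\<lambda>(x, y11, y21). x) (\<lambda>(x, y11, y21). y11) (\<lambda>(x, y11, y21). y21)"
      "mis_markov P2 (\<lambda>(x, y12, y22). x) (\<lambda>(x, y12, y22). y22) (\<lambda>(x, y12, y22). y12)"
    and Q: "\<And>n. Q n \<in> Cbar d11 d12 d21 d22 D (\<epsilon> n) (mis_src P1 P2)" "\<And>n. Rbar_lb (Q n) \<le> c + \<epsilon> n"
    and eps: "\<epsilon> \<longlonglongrightarrow> 0"
  shows "RM P1 P2 d11 d12 d21 d22 D \<le> ereal c"
proof -
  define good where "good n N1 N2 g11 g21 g22 g12 \<longleftrightarrow> comp_law P1 N1 \<and> comp_law (swap_YZ P2) N2 \<and>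
    (\<forall>\<omega>\<in>set_pmf N1. sW \<omega> < CARD('x1) + 3 \<and> sU \<omega> < CARD('x1) * (CARD('x1) + 3) + 1) \<and>
    (\<forall>\<omega>\<in>set_pmf N2. sW \<omega> < CARD('x2) + 3 \<and> sU \<omega> < CARD('x2) * (CARD('x2) + 3) + 1) \<and>
    measure_pmf.expectation N1 (\<lambda>\<omega>. d11 (sX \<omega>) (g11 (sW \<omega>) (sU \<omega>) (sY \<omega>))) \<le> D 1 1 + \<epsilon> n \<and>
    measure_pmf.expectation N1 (\<lambda>\<omega>. d21 (sX \<omega>) (g21 (sW \<omega>) (sZ \<omega>))) \<le> D 2 1 + \<epsilon> n \<and>
    measure_pmf.expectation N2 (\<lambda>\<omega>. d22 (sX \<omega>) (g22 (sW \<omega>) (sU \<omega>) (sY \<omega>))) \<le> D 2 2 + \<epsilon> n \<and>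
    measure_pmf.expectation N2 (\<lambda>\<omega>. d12 (sX \<omega>) (g12 (sW \<omega>) (sZ \<omega>))) \<le> D 1 2 + \<epsilon> n \<and>
    rate_Y N1 + rate_Z N2 \<le> c + \<epsilon> n \<and> rate_Z N1 + rate_Y N2 \<le> c + \<epsilon> n"
    for n N1 N2 g11 g21 g22 g12
  have "\<exists>N1 N2 g11 g21 g22 g12. good n N1 N2 g11 g21 g22 g12" for n
  proof (rule converse_components[OF dg Q(1)[of n]], goal_cases)
    case (1 N1 N2 g11 g21 g22 g12)
    then have "good n N1 N2 g11 g21 g22 g12" unfolding good_def using Q(2)[of n] by auto
    then show ?case by blast
  qed
  then obtain N1 N2 g11 g21 g22 g12 where "\<And>n. good n (N1 n) (N2 n) (g11 n) (g21 n) (g22 n) (g12 n)"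
    by metis
  note G = this[unfolded good_def]
  obtain r1 M1 h11 h21 where M1: "strict_mono (r1 :: nat \<Rightarrow> nat)" "comp_law P1 M1"
    "\<And>\<omega>. \<omega> \<in> set_pmf M1 \<Longrightarrow> sW \<omega> < CARD('x1) + 3"
    "\<And>\<omega>. \<omega> \<in> set_pmf M1 \<Longrightarrow> sU \<omega> < CARD('x1) * (CARD('x1) + 3) + 1"
    "(\<lambda>n. rate_Y (N1 (r1 n))) \<longlonglongrightarrow> rate_Y M1" "(\<lambda>n. rate_Z (N1 (r1 n))) \<longlonglongrightarrow> rate_Z M1"
    "(\<lambda>n. measure_pmf.expectation (N1 (r1 n)) (\<lambda>\<omega>. d11 (sX \<omega>) (g11 (r1 n) (sW \<omega>) (sU \<omega>) (sY \<omega>))))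
       \<longlonglongrightarrow> measure_pmf.expectation M1 (\<lambda>\<omega>. d11 (sX \<omega>) (h11 (sW \<omega>) (sU \<omega>) (sY \<omega>)))"
    "(\<lambda>n. measure_pmf.expectation (N1 (r1 n)) (\<lambda>\<omega>. d21 (sX \<omega>) (g21 (r1 n) (sW \<omega>) (sZ \<omega>))))
       \<longlonglongrightarrow> measure_pmf.expectation M1 (\<lambda>\<omega>. d21 (sX \<omega>) (h21 (sW \<omega>) (sZ \<omega>)))"
    by (rule comp_compact[of P1 N1 "CARD('x1) + 3" "CARD('x1) * (CARD('x1) + 3) + 1" d11 g11 d21 g21])
      (use G in blast)+
  \<comment> \<open>The subsequence for the second component is taken inside the one for the first,
    so both components converge along \<open>r1 (r2 n)\<close>.\<close>
  obtain r2 M2 h22 h12 where M2: "strict_mono (r2 :: nat \<Rightarrow> nat)" "comp_law (swap_YZ P2) M2"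
    "\<And>\<omega>. \<omega> \<in> set_pmf M2 \<Longrightarrow> sW \<omega> < CARD('x2) + 3"
    "\<And>\<omega>. \<omega> \<in> set_pmf M2 \<Longrightarrow> sU \<omega> < CARD('x2) * (CARD('x2) + 3) + 1"
    "(\<lambda>n. rate_Y (N2 (r1 (r2 n)))) \<longlonglongrightarrow> rate_Y M2" "(\<lambda>n. rate_Z (N2 (r1 (r2 n)))) \<longlonglongrightarrow> rate_Z M2"
    "(\<lambda>n. measure_pmf.expectation (N2 (r1 (r2 n))) (\<lambda>\<omega>. d22 (sX \<omega>) (g22 (r1 (r2 n)) (sW \<omega>) (sU \<omega>) (sY \<omega>))))
       \<longlonglongrightarrow> measure_pmf.expectation M2 (\<lambda>\<omega>. d22 (sX \<omega>) (h22 (sW \<omega>) (sU \<omega>) (sY \<omega>)))"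
    "(\<lambda>n. measure_pmf.expectation (N2 (r1 (r2 n))) (\<lambda>\<omega>. d12 (sX \<omega>) (g12 (r1 (r2 n)) (sW \<omega>) (sZ \<omega>))))
       \<longlonglongrightarrow> measure_pmf.expectation M2 (\<lambda>\<omega>. d12 (sX \<omega>) (h12 (sW \<omega>) (sZ \<omega>)))"
    by (rule comp_compact[of "swap_YZ P2" "\<lambda>n. N2 (r1 n)" "CARD('x2) + 3" "CARD('x2) * (CARD('x2) + 3) + 1"
          d22 "\<lambda>n. g22 (r1 n)" d12 "\<lambda>n. g12 (r1 n)"])
      (use G in blast)+
  note sub = LIMSEQ_subseq_LIMSEQ[OF _ M2(1), unfolded o_def]
  have "(\<lambda>n. \<epsilon> (r1 (r2 n))) \<longlonglongrightarrow> 0"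
    using sub[OF LIMSEQ_subseq_LIMSEQ[OF eps M1(1), unfolded o_def]] .
  then have lime: "(\<lambda>n. a + \<epsilon> (r1 (r2 n))) \<longlonglongrightarrow> a" for a by (auto intro!: tendsto_eq_intros)
  have "RM P1 P2 d11 d12 d21 d22 D \<le> ereal (max (rate_Y M1 + rate_Z M2) (rate_Z M1 + rate_Y M2))"
  proof (rule RM_product[OF M1(2) M2(2) M1(3,4) M2(3,4)])
    show "measure_pmf.expectation M1 (\<lambda>\<omega>. d11 (sX \<omega>) (h11 (sW \<omega>) (sU \<omega>) (sY \<omega>))) \<le> D 1 1"
      by (rule LIMSEQ_le[OF sub[OF M1(7)] lime]) (use G in blast)
    show "measure_pmf.expectation M1 (\<lambda>\<omega>. d21 (sX \<omega>) (h21 (sW \<omega>) (sZ \<omega>))) \<le> D 2 1"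
      by (rule LIMSEQ_le[OF sub[OF M1(8)] lime]) (use G in blast)
    show "measure_pmf.expectation M2 (\<lambda>\<omega>. d22 (sX \<omega>) (h22 (sW \<omega>) (sU \<omega>) (sY \<omega>))) \<le> D 2 2"
      by (rule LIMSEQ_le[OF M2(7) lime]) (use G in blast)
    show "measure_pmf.expectation M2 (\<lambda>\<omega>. d12 (sX \<omega>) (h12 (sW \<omega>) (sZ \<omega>))) \<le> D 1 2"
      by (rule LIMSEQ_le[OF M2(8) lime]) (use G in blast)
  qed
  also have "rate_Y M1 + rate_Z M2 \<le> c"
    by (rule LIMSEQ_le[OF tendsto_add[OF sub[OF M1(5)] M2(6)] lime]) (use G in blast)
  moreover have "rate_Z M1 + rate_Y M2 \<le> c"
    by (rule LIMSEQ_le[OF tendsto_add[OF sub[OF M1(6)] M2(5)] lime]) (use G in blast)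
  ultimately show ?thesis by (auto elim: order_trans)
qed

lemma mis_src_in_Pbar: "mis_src P1 P2 \<in> Pbar P1 P2"
  by (simp add: Pbar_def)

lemma RM_le_Liminf_Rlb:
  fixes P1 :: "('x1::finite \<times> 'y11::finite \<times> 'y21::finite) pmf"
    and P2 :: "('x2::finite \<times> 'y12::finite \<times> 'y22::finite) pmf"
    and d11 :: "'x1 \<Rightarrow> 'z11::finite \<Rightarrow> real"
    and d12 :: "'x2 \<Rightarrow> 'z12::finite \<Rightarrow> real"
    and d21 :: "'x1 \<Rightarrow> 'z21::finite \<Rightarrow> real"
    and d22 :: "'x2 \<Rightarrow> 'z22::finite \<Rightarrow> real"
    and D :: "nat \<Rightarrow> nat \<Rightarrow> real"
  assumes dg: "mis_markov P1 (\<lambda>(x, y11, y21). x) (\<lambda>(x, y11, y21). y11) (\<lambda>(x, y11, y21). y21)"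
      "mis_markov P2 (\<lambda>(x, y12, y22). x) (\<lambda>(x, y12, y22). y22) (\<lambda>(x, y12, y22). y12)"
  shows "RM P1 P2 d11 d12 d21 d22 D \<le> Liminf (at_right 0) (\<lambda>\<epsilon>. Rlb P1 P2 d11 d12 d21 d22 D \<epsilon>)"
  unfolding le_Liminf_iff
proof (intro allI impI)
  fix y assume y: "y < RM P1 P2 d11 d12 d21 d22 D"
  let ?R = "Rlb P1 P2 d11 d12 d21 d22 D"
  show "eventually (\<lambda>\<epsilon>. y < ?R \<epsilon>) (at_right 0)"
  proof (rule ccontr)
    assume "\<not> eventually (\<lambda>\<epsilon>. y < ?R \<epsilon>) (at_right 0)"
    then have ex: "\<exists>\<epsilon>>0. \<epsilon> < b \<and> ?R \<epsilon> \<le> y" if "0 < b" for b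
      using that unfolding eventually_at_right_field by (auto simp: not_less dest!: spec[of _ b])
    \<comment> \<open>The room between \<open>y\<close> and \<open>c\<close> yields admissible laws
      although the infimum in \<open>Rlb\<close> need not be attained. The term subtracted in
      \<open>Rlb\<close> reappears as the slack in \<open>c + \<epsilon>\<close>.\<close>
    obtain c where c: "y < ereal c" "ereal c < RM P1 P2 d11 d12 d21 d22 D"
      using ereal_dense2[OF y] by auto
    have "\<exists>\<epsilon> Q. 0 < \<epsilon> \<and> \<epsilon> < inverse (real (Suc n)) \<and>
        Q \<in> Cbar d11 d12 d21 d22 D \<epsilon> (mis_src P1 P2) \<and> Rbar_lb Q \<le> c + \<epsilon>" for n
    proof -
      obtain \<epsilon> where e: "0 < \<epsilon>" "\<epsilon> < inverse (real (Suc n))" "?R \<epsilon> \<le> y"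
        using ex[of "inverse (real (Suc n))"] by auto
      let ?S = "SUP Pb \<in> Pbar P1 P2. INF Q \<in> Cbar d11 d12 d21 d22 D \<epsilon> Pb. ereal (Rbar_lb Q)"
      have "?S - ereal \<epsilon> < ereal c" using e(3) c(1) unfolding Rlb_def by (rule order_le_less_trans)
      then have "?S < ereal (c + \<epsilon>)" by (cases ?S) auto
      moreover have "(INF Q \<in> Cbar d11 d12 d21 d22 D \<epsilon> (mis_src P1 P2). ereal (Rbar_lb Q)) \<le> ?S"
        by (rule SUP_upper[OF mis_src_in_Pbar])
      ultimately have "(INF Q \<in> Cbar d11 d12 d21 d22 D \<epsilon> (mis_src P1 P2). ereal (Rbar_lb Q)) < ereal (c + \<epsilon>)"
        by (rule order_le_less_trans[rotated])
      then obtain Q where "Q \<in> Cbar d11 d12 d21 d22 D \<epsilon> (mis_src P1 P2)" "Rbar_lb Q < c + \<epsilon>"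
        unfolding INF_less_iff by auto
      then show ?thesis using e by (intro exI[of _ \<epsilon>] exI[of _ Q]) auto
    qed
    then obtain \<epsilon> Q where eQ: "\<And>n. 0 < \<epsilon> n" "\<And>n. \<epsilon> n < inverse (real (Suc n))"
        "\<And>n. Q n \<in> Cbar d11 d12 d21 d22 D (\<epsilon> n) (mis_src P1 P2)" "\<And>n. Rbar_lb (Q n) \<le> c + \<epsilon> n"
      by metis
    have "\<epsilon> \<longlonglongrightarrow> 0"
      by (rule real_tendsto_sandwich[OF _ _ tendsto_const LIMSEQ_inverse_real_of_nat])
        (use eQ(1,2) in \<open>auto intro!: always_eventually less_imp_le\<close>)
    from converse_limit[OF dg eQ(3,4) this] c(2) show False by simp
  qed
qed

section \<open>Achievability\<close>

text \<open>\<open>E1\<close> and \<open>E2\<close> are the relations of two independent components;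
  any \<open>K\<close> and \<open>L\<close> that are functions of them are independent too, and
  their entropies add.\<close>

lemma Hker_add:
  assumes "finite (set_pmf M)" "equiv UNIV E1" "equiv UNIV E2" "Iker M E1 E2 UNIV = 0"
    and "equiv UNIV K" "equiv UNIV L" "E1 \<subseteq> K" "E2 \<subseteq> L"
  shows "Hker M (K \<inter> L) = Hker M K + Hker M L"
proof -
  have "Iker M K L UNIV = 0" using assms by (intro Iker_zero_mono_both[of M K E1 L E2]) auto
  then show ?thesis by (simp add: Iker_def)
qed

text \<open>The side information \<open>y\<close> has no effect on the conditional entropy of
  \<open>w\<close> given \<open>x\<close>, nor on that of \<open>u\<close> given \<open>x\<close>
  and \<open>w\<close>.\<close>

lemma component_markov_rates:
  assumes fin: "finite (set_pmf M)"
    and eq: "equiv UNIV x" "equiv UNIV y" "equiv UNIV w" "equiv UNIV u" "equiv UNIV z"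
    and mk: "Iker M (w \<inter> u) (y \<inter> z) x = 0"
  shows "Hker M (x \<inter> y) - Hker M (x \<inter> w \<inter> y) = Hker M x - Hker M (x \<inter> w)"
    and "Hker M (x \<inter> w \<inter> y) - Hker M (x \<inter> w \<inter> u \<inter> y) = Hker M (x \<inter> w) - Hker M (x \<inter> w \<inter> u)"
proof -
  have *: "Iker M (w \<inter> u) y x = 0"
    by (rule Iker_zero_mono_both[OF fin _ _ _ _ _ mk]) (use eq in auto)
  have "Iker M y (w \<inter> UNIV \<inter> u) x = 0" using * by (subst Iker_sym) simp
  then have "Iker M y w (UNIV \<inter> x) = 0"
    by (rule Iker_zero_mono[rotated -1]) (use fin eq in auto)
  then show "Hker M (x \<inter> y) - Hker M (x \<inter> w \<inter> y) = Hker M x - Hker M (x \<inter> w)"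
    by (simp add: Iker_def Int_ac)
  have "Iker M y (u \<inter> w \<inter> UNIV) x = 0" using * by (subst Iker_sym) (simp add: Int_ac)
  then have "Iker M y u (w \<inter> x) = 0"
    by (rule Iker_zero_mono[rotated -1]) (use fin eq in auto)
  then show "Hker M (x \<inter> w \<inter> y) - Hker M (x \<inter> w \<inter> u \<inter> y) = Hker M (x \<inter> w) - Hker M (x \<inter> w \<inter> u)"
    by (simp add: Iker_def Int_ac)
qed

text \<open>The Wyner-Ziv identity I(X; W) - I(W; Y) = I(X; W | Y) for a chain W - X - Y, applied to
  the common layer and, given that layer, to each private one. Entropies add over the independent
  components, so the common layer splits into two terms while the terms of the other component
  cancel in a private layer. In the last identity \<open>u1\<close> joins the source because it is
  encoded before \<open>u2\<close>.\<close>

lemma achievable_rates: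
  assumes fin: "finite (set_pmf M)"
    and eq: "equiv UNIV x1" "equiv UNIV y11" "equiv UNIV y21" "equiv UNIV w1" "equiv UNIV u1"
      "equiv UNIV x2" "equiv UNIV y12" "equiv UNIV y22" "equiv UNIV w2" "equiv UNIV u2"
    and ind: "Iker M (x1 \<inter> y11 \<inter> y21 \<inter> w1 \<inter> u1) (x2 \<inter> y12 \<inter> y22 \<inter> w2 \<inter> u2) UNIV = 0"
    and mk1: "Iker M (w1 \<inter> u1) (y11 \<inter> y21) x1 = 0" and mk2: "Iker M (w2 \<inter> u2) (y12 \<inter> y22) x2 = 0"
  shows "Iker M (u1 \<inter> u2 \<inter> w1 \<inter> w2) (y11 \<inter> y12 \<inter> y21 \<inter> y22) (x1 \<inter> x2) = 0"
    and "Iker M (x1 \<inter> x2) (w1 \<inter> w2) UNIV - Iker M (w1 \<inter> w2) (y11 \<inter> y12) UNIV = Iker M x1 w1 y11 + Iker M x2 w2 y12"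
    and "Iker M (x1 \<inter> x2) (w1 \<inter> w2) UNIV - Iker M (w1 \<inter> w2) (y21 \<inter> y22) UNIV = Iker M x1 w1 y21 + Iker M x2 w2 y22"
    and "Iker M (x1 \<inter> x2 \<inter> w1 \<inter> w2) u1 UNIV - Iker M u1 (w1 \<inter> w2 \<inter> y11 \<inter> y12) UNIV = Iker M x1 u1 (y11 \<inter> w1)"
    and "Iker M (x1 \<inter> x2 \<inter> w1 \<inter> w2 \<inter> u1) u2 UNIV - Iker M u2 (w1 \<inter> w2 \<inter> y21 \<inter> y22) UNIV = Iker M x2 u2 (y22 \<inter> w2)"
proof -
  note add = Hker_add[OF fin _ _ ind]
  have mk1': "Iker M (w1 \<inter> u1) (y21 \<inter> y11) x1 = 0" and mk2': "Iker M (w2 \<inter> u2) (y22 \<inter> y12) x2 = 0"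
    using mk1 mk2 by (simp_all add: Int_commute)
  note mm = component_markov_rates[OF fin eq(1,2,4,5,3) mk1] component_markov_rates[OF fin eq(1,3,4,5,2) mk1']
    component_markov_rates[OF fin eq(6,7,9,10,8) mk2] component_markov_rates[OF fin eq(6,8,9,10,7) mk2']
  have a: "Hker M (K \<inter> L) = Hker M K + Hker M L"
    if "equiv UNIV K" "equiv UNIV L" "x1 \<inter> y11 \<inter> y21 \<inter> w1 \<inter> u1 \<subseteq> K" "x2 \<inter> y12 \<inter> y22 \<inter> w2 \<inter> u2 \<subseteq> L" for K L
    using that eq by (intro add) auto
  have ax: "Hker M (x1 \<inter> x2) = Hker M x1 + Hker M x2"
    and aw: "Hker M (w1 \<inter> w2) = Hker M w1 + Hker M w2"
    and axw: "Hker M ((x1 \<inter> w1) \<inter> (x2 \<inter> w2)) = Hker M (x1 \<inter> w1) + Hker M (x2 \<inter> w2)"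
    and ay1: "Hker M (y11 \<inter> y12) = Hker M y11 + Hker M y12"
    and ay2: "Hker M (y21 \<inter> y22) = Hker M y21 + Hker M y22"
    and awy1: "Hker M ((w1 \<inter> y11) \<inter> (w2 \<inter> y12)) = Hker M (w1 \<inter> y11) + Hker M (w2 \<inter> y12)"
    and awy2: "Hker M ((w1 \<inter> y21) \<inter> (w2 \<inter> y22)) = Hker M (w1 \<inter> y21) + Hker M (w2 \<inter> y22)"
    and axwu1: "Hker M ((x1 \<inter> w1 \<inter> u1) \<inter> (x2 \<inter> w2)) = Hker M (x1 \<inter> w1 \<inter> u1) + Hker M (x2 \<inter> w2)"
    and axwu: "Hker M ((x1 \<inter> w1 \<inter> u1) \<inter> (x2 \<inter> w2 \<inter> u2)) = Hker M (x1 \<inter> w1 \<inter> u1) + Hker M (x2 \<inter> w2 \<inter> u2)"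
    and au1wy: "Hker M ((u1 \<inter> w1 \<inter> y11) \<inter> (w2 \<inter> y12)) = Hker M (u1 \<inter> w1 \<inter> y11) + Hker M (w2 \<inter> y12)"
    and au2wy: "Hker M ((w1 \<inter> y21) \<inter> (u2 \<inter> w2 \<inter> y22)) = Hker M (w1 \<inter> y21) + Hker M (u2 \<inter> w2 \<inter> y22)"
    and axy: "Hker M ((x1 \<inter> y11 \<inter> y21) \<inter> (x2 \<inter> y12 \<inter> y22)) = Hker M (x1 \<inter> y11 \<inter> y21) + Hker M (x2 \<inter> y12 \<inter> y22)"
    and aall: "Hker M ((x1 \<inter> y11 \<inter> y21 \<inter> w1 \<inter> u1) \<inter> (x2 \<inter> y12 \<inter> y22 \<inter> w2 \<inter> u2))
       = Hker M (x1 \<inter> y11 \<inter> y21 \<inter> w1 \<inter> u1) + Hker M (x2 \<inter> y12 \<inter> y22 \<inter> w2 \<inter> u2)"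
    using eq by (intro a; auto)+
  show "Iker M (u1 \<inter> u2 \<inter> w1 \<inter> w2) (y11 \<inter> y12 \<inter> y21 \<inter> y22) (x1 \<inter> x2) = 0"
    using mk1 mk2 ax axwu axy aall unfolding Iker_def by (simp only: Int_ac)
  show "Iker M (x1 \<inter> x2) (w1 \<inter> w2) UNIV - Iker M (w1 \<inter> w2) (y11 \<inter> y12) UNIV = Iker M x1 w1 y11 + Iker M x2 w2 y12"
    using ax aw axw ay1 awy1 mm unfolding Iker_def Int_UNIV_right Hker_UNIV by (simp only: Int_ac)
  show "Iker M (x1 \<inter> x2) (w1 \<inter> w2) UNIV - Iker M (w1 \<inter> w2) (y21 \<inter> y22) UNIV = Iker M x1 w1 y21 + Iker M x2 w2 y22"
    using ax aw axw ay2 awy2 mm unfolding Iker_def Int_UNIV_right Hker_UNIV by (simp only: Int_ac)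
  show "Iker M (x1 \<inter> x2 \<inter> w1 \<inter> w2) u1 UNIV - Iker M u1 (w1 \<inter> w2 \<inter> y11 \<inter> y12) UNIV = Iker M x1 u1 (y11 \<inter> w1)"
    using axw axwu1 awy1 au1wy mm unfolding Iker_def Int_UNIV_right Hker_UNIV by (simp only: Int_ac)
  show "Iker M (x1 \<inter> x2 \<inter> w1 \<inter> w2 \<inter> u1) u2 UNIV - Iker M u2 (w1 \<inter> w2 \<inter> y21 \<inter> y22) UNIV = Iker M x2 u2 (y22 \<inter> w2)"
    using axwu1 axwu awy2 au2wy mm unfolding Iker_def Int_UNIV_right Hker_UNIV by (simp only: Int_ac)
qed

section \<open>Rates of the coding scheme\<close>

lemma mis_H_map: "mis_H (map_pmf f M) A = mis_H M (\<lambda>\<omega>. A (f \<omega>))"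
  by (simp add: mis_H_def mis_pr_map image_image)

lemma mis_condH_map: "mis_condH (map_pmf f M) A C = mis_condH M (\<lambda>\<omega>. A (f \<omega>)) (\<lambda>\<omega>. C (f \<omega>))"
  by (simp add: mis_condH_def mis_pr_map image_image)

lemma rker_UU_insert: "rker (\<lambda>\<omega>. UU (insert S T) (f \<omega>)) = rker (\<lambda>\<omega>. usel S (f \<omega>)) \<inter> rker (\<lambda>\<omega>. UU T (f \<omega>))"
  by (auto simp: rker_def UU_def restrict_def fun_eq_iff)

lemma rker_UU_empty: "rker (\<lambda>\<omega>. UU {} (f \<omega>)) = UNIV"
  by (auto simp: rker_def UU_def)

lemma rker_inj: "inj g \<Longrightarrow> rker (\<lambda>\<omega>. g (A \<omega>)) = rker A"
  by (auto simp: rker_def dest: injD)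

lemma rker_fst: "rker fst = rker mX1 \<inter> rker mY11 \<inter> rker mY21 \<inter> rker mW1 \<inter> rker mU1"
  and rker_snd: "rker snd = rker mX2 \<inter> rker mY12 \<inter> rker mY22 \<inter> rker mW2 \<inter> rker mU2"
  by (auto simp: rker_def m_eq_s s_defs prod_eq_iff)

lemma RM_feasible_imp_Rach0:
  fixes P1 :: "('x1::finite \<times> 'y11::finite \<times> 'y21::finite) pmf"
    and P2 :: "('x2::finite \<times> 'y12::finite \<times> 'y22::finite) pmf"
    and D :: "nat \<Rightarrow> nat \<Rightarrow> real"
  assumes feas: "RM_feasible P1 P2 d11 d12 d21 d22 D Q"
  shows "Rach0 P1 P2 d11 d12 d21 d22 D \<le> ereal (max (RM_1 Q) (RM_2 Q))"
proof -
  have m1: "map_pmf (\<lambda>(x, y, y', w, u). (x, y, y')) (map_pmf fst Q) = P1"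
    and m2: "map_pmf (\<lambda>(x, y, y', w, u). (x, y, y')) (map_pmf snd Q) = P2"
    and mk1: "mis_markov Q (\<lambda>\<omega>. (mW1 \<omega>, mU1 \<omega>)) mX1 (\<lambda>\<omega>. (mY11 \<omega>, mY21 \<omega>))"
    and mk2: "mis_markov Q (\<lambda>\<omega>. (mW2 \<omega>, mU2 \<omega>)) mX2 (\<lambda>\<omega>. (mY12 \<omega>, mY22 \<omega>))"
    and ind: "Q = pair_pmf (map_pmf fst Q) (map_pmf snd Q)"
    and bd: "\<forall>\<omega> \<in> set_pmf Q.
        mW1 \<omega> < CARD('x1) + 3 \<and> mU1 \<omega> < CARD('x1) * (CARD('x1) + 3) + 1 \<and>
        mW2 \<omega> < CARD('x2) + 3 \<and> mU2 \<omega> < CARD('x2) * (CARD('x2) + 3) + 1"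
    using feas unfolding RM_feasible_def by - (elim conjE, assumption)+
  have e11: "\<exists>g11. measure_pmf.expectation Q (\<lambda>\<omega>. d11 (mX1 \<omega>) (g11 (mW1 \<omega>) (mU1 \<omega>) (mY11 \<omega>))) \<le> D 1 1"
    and e12: "\<exists>g12. measure_pmf.expectation Q (\<lambda>\<omega>. d12 (mX2 \<omega>) (g12 (mW2 \<omega>) (mY12 \<omega>))) \<le> D 1 2"
    and e21: "\<exists>g21. measure_pmf.expectation Q (\<lambda>\<omega>. d21 (mX1 \<omega>) (g21 (mW1 \<omega>) (mY21 \<omega>))) \<le> D 2 1"
    and e22: "\<exists>g22. measure_pmf.expectation Q (\<lambda>\<omega>. d22 (mX2 \<omega>) (g22 (mW2 \<omega>) (mU2 \<omega>) (mY22 \<omega>))) \<le> D 2 2"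
    using feas unfolding RM_feasible_def by - (elim conjE, assumption)+
  from e11 obtain g11 where g11: "measure_pmf.expectation Q (\<lambda>\<omega>. d11 (mX1 \<omega>) (g11 (mW1 \<omega>) (mU1 \<omega>) (mY11 \<omega>))) \<le> D 1 1" ..
  from e12 obtain g12 where g12: "measure_pmf.expectation Q (\<lambda>\<omega>. d12 (mX2 \<omega>) (g12 (mW2 \<omega>) (mY12 \<omega>))) \<le> D 1 2" ..
  from e21 obtain g21 where g21: "measure_pmf.expectation Q (\<lambda>\<omega>. d21 (mX1 \<omega>) (g21 (mW1 \<omega>) (mY21 \<omega>))) \<le> D 2 1" ..
  from e22 obtain g22 where g22: "measure_pmf.expectation Q (\<lambda>\<omega>. d22 (mX2 \<omega>) (g22 (mW2 \<omega>) (mU2 \<omega>) (mY22 \<omega>))) \<le> D 2 2" ..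
  \<comment> \<open>Finiteness of the support comes from the cardinality bounds together with the
    finite source and side information alphabets.\<close>
  have fin: "finite (set_pmf Q)"
  proof (rule finite_subset)
    show "set_pmf Q \<subseteq> (UNIV \<times> UNIV \<times> UNIV \<times> {..<CARD('x1) + 3} \<times> {..<CARD('x1) * (CARD('x1) + 3) + 1}) \<times>
      (UNIV \<times> UNIV \<times> UNIV \<times> {..<CARD('x2) + 3} \<times> {..<CARD('x2) * (CARD('x2) + 3) + 1})"
      using bd by (auto simp: mW1_def mU1_def mW2_def mU2_def)
  qed simp
  \<comment> \<open>The pair (W1, W2) is packed into one natural number, since every auxiliary
    variable of the scheme has values in \<open>nat\<close>.\<close>
  define \<phi> where "\<phi> \<omega> = (((mX1 \<omega>, mX2 \<omega>), (mY11 \<omega>, mY12 \<omega>), (mY21 \<omega>, mY22 \<omega>)),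
      (mU1 \<omega>, mU2 \<omega>, prod_encode (mW1 \<omega>, mW2 \<omega>)))"
    for \<omega> :: "('x1 \<times> 'y11 \<times> 'y21 \<times> nat \<times> nat) \<times> ('x2 \<times> 'y12 \<times> 'y22 \<times> nat \<times> nat)"
  define Q' where "Q' = map_pmf \<phi> Q"
  have \<phi>: "lX (\<phi> \<omega>) = (mX1 \<omega>, mX2 \<omega>)" "lY1 (\<phi> \<omega>) = (mY11 \<omega>, mY12 \<omega>)" "lY2 (\<phi> \<omega>) = (mY21 \<omega>, mY22 \<omega>)"
    "lA (\<phi> \<omega>) = mU1 \<omega>" "lB (\<phi> \<omega>) = mU2 \<omega>" "lC (\<phi> \<omega>) = prod_encode (mW1 \<omega>, mW2 \<omega>)" for \<omega>
    by (simp_all add: \<phi>_def lX_def lY1_def lY2_def lA_def lB_def lC_def)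
  have S: "{1} \<noteq> {2::nat}" "{1} \<noteq> {1, 2::nat}" "{2} \<noteq> {1, 2::nat}"
    "{2} \<noteq> {1::nat}" "{1, 2} \<noteq> {1::nat}" "{1, 2} \<noteq> {2::nat}" by auto
  have u: "usel {1} (\<phi> \<omega>) = mU1 \<omega>" "usel {2} (\<phi> \<omega>) = mU2 \<omega>" "usel {1, 2} (\<phi> \<omega>) = prod_encode (mW1 \<omega>, mW2 \<omega>)" for \<omega>
    using S by (simp_all add: usel_def \<phi>)
  let ?x1 = "rker mX1" and ?x2 = "rker mX2" and ?w1 = "rker mW1" and ?w2 = "rker mW2" and ?u1 = "rker mU1" and ?u2 = "rker mU2"
    and ?y11 = "rker mY11" and ?y12 = "rker mY12" and ?y21 = "rker mY21" and ?y22 = "rker mY22"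
  have kW: "rker (\<lambda>\<omega>. prod_encode (mW1 \<omega>, mW2 \<omega>)) = ?w1 \<inter> ?w2"
    using rker_inj[OF inj_prod_encode, of "\<lambda>\<omega>. (mW1 \<omega>, mW2 \<omega>)"] by simp
  have "Iker (pair_pmf (map_pmf fst Q) (map_pmf snd Q)) (rker fst) (rker snd) UNIV = 0"
    using fin by (intro Iker_pair_pmf) auto
  then have I0: "Iker Q (?x1 \<inter> ?y11 \<inter> ?y21 \<inter> ?w1 \<inter> ?u1) (?x2 \<inter> ?y12 \<inter> ?y22 \<inter> ?w2 \<inter> ?u2) UNIV = 0"
    unfolding ind[symmetric] rker_fst rker_snd .
  have M1: "Iker Q (?w1 \<inter> ?u1) (?y11 \<inter> ?y21) ?x1 = 0" and M2: "Iker Q (?w2 \<inter> ?u2) (?y12 \<inter> ?y22) ?x2 = 0"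
    using mk1 mk2 unfolding mis_markov_iff_Iker[OF fin] by simp_all
  note rates = achievable_rates[OF fin equiv_rker equiv_rker equiv_rker equiv_rker equiv_rker
      equiv_rker equiv_rker equiv_rker equiv_rker equiv_rker I0 M1 M2]
  have "Rach_feasible P1 P2 d11 d12 d21 d22 D Q'"
    unfolding Rach_feasible_def
  proof (intro conjI)
    show "finite (set_pmf Q')" using fin by (simp add: Q'_def)
    show "map_pmf fst Q' = mis_src P1 P2"
    proof -
      have "mis_src P1 P2 = map_pmf (\<lambda>\<omega>. ((mX1 \<omega>, mX2 \<omega>), (mY11 \<omega>, mY12 \<omega>), (mY21 \<omega>, mY22 \<omega>)))
          (pair_pmf (map_pmf fst Q) (map_pmf snd Q))"
        unfolding mis_src_def m1[symmetric] m2[symmetric] pair_map_pmf1 pair_map_pmf2 map_pmf_comp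
        by (intro map_pmf_cong) (auto simp: m_eq_s s_defs)
      then show ?thesis unfolding ind[symmetric] Q'_def map_pmf_comp by (simp add: \<phi>_def)
    qed
    show "mis_markov Q' (UU subsets12) lX (\<lambda>\<omega>. (lY1 \<omega>, lY2 \<omega>))"
      using rates(1)
      unfolding Q'_def mis_markov_map mis_markov_iff_Iker[OF fin] subsets12_def rker_UU_insert rker_UU_empty u \<phi> rker_pair kW
      by (simp add: Int_ac)
    show "\<exists>g11. measure_pmf.expectation Q' (\<lambda>\<omega>. d11 (fst (lX \<omega>)) (g11 (lA \<omega>) (lC \<omega>) (lY1 \<omega>))) \<le> D 1 1"
      by (rule exI[of _ "\<lambda>u c y. g11 (fst (prod_decode c)) u (fst y)"]) (use g11 in \<open>simp add: Q'_def \<phi>\<close>)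
    show "\<exists>g12. measure_pmf.expectation Q' (\<lambda>\<omega>. d12 (snd (lX \<omega>)) (g12 (lA \<omega>) (lC \<omega>) (lY1 \<omega>))) \<le> D 1 2"
      by (rule exI[of _ "\<lambda>u c y. g12 (snd (prod_decode c)) (snd y)"]) (use g12 in \<open>simp add: Q'_def \<phi>\<close>)
    show "\<exists>g21. measure_pmf.expectation Q' (\<lambda>\<omega>. d21 (fst (lX \<omega>)) (g21 (lB \<omega>) (lC \<omega>) (lY2 \<omega>))) \<le> D 2 1"
      by (rule exI[of _ "\<lambda>u c y. g21 (fst (prod_decode c)) (fst y)"]) (use g21 in \<open>simp add: Q'_def \<phi>\<close>)
    show "\<exists>g22. measure_pmf.expectation Q' (\<lambda>\<omega>. d22 (snd (lX \<omega>)) (g22 (lB \<omega>) (lC \<omega>) (lY2 \<omega>))) \<le> D 2 2"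
      by (rule exI[of _ "\<lambda>u c y. g22 (snd (prod_decode c)) u (snd y)"]) (use g22 in \<open>simp add: Q'_def \<phi>\<close>)
  qed
  moreover
  let ?W = "?w1 \<inter> ?w2" and ?Y1 = "?y11 \<inter> ?y12" and ?Y2 = "?y21 \<inter> ?y22" and ?X = "?x1 \<inter> ?x2"
  \<comment> \<open>The private binning rates are the largest that decoding a private layer after
    the common one allows. The common layer needs the minimum over the two decoders.\<close>
  define R12' where "R12' = min (Iker Q ?W ?Y1 UNIV) (Iker Q ?W ?Y2 UNIV)"
  define R1' where "R1' = Iker Q ?u1 (?w1 \<inter> ?w2 \<inter> ?y11 \<inter> ?y12) UNIV"
  define R2' where "R2' = Iker Q ?u2 (?w1 \<inter> ?w2 \<inter> ?y21 \<inter> ?y22) UNIV"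
  define R12 where "R12 = Iker Q ?X ?W UNIV - R12'"
  define R1 where "R1 = Iker Q ?x1 ?u1 (?y11 \<inter> ?w1)"
  define R2 where "R2 = Iker Q ?x2 ?u2 (?y22 \<inter> ?w2)"
  define R where "R S = (if S = {1} then R1 else if S = {2} then R2 else R12)" for S :: "nat set"
  define R' where "R' S = (if S = {1} then R1' else if S = {2} then R2' else R12')" for S :: "nat set"
  have RS: "R {1} = R1" "R {2} = R2" "R {1, 2} = R12" "R' {1} = R1'" "R' {2} = R2'" "R' {1, 2} = R12'"
    unfolding R_def R'_def by (simp_all only: S if_True if_False simp_thms)
  note nn = Iker_nonneg[OF fin]
  \<comment> \<open>Subtracting a minimum leaves the maximum of the two differences, which the
    Wyner-Ziv identities turn into conditional informations. The private rates are common to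
    \<open>RM_1\<close> and \<open>RM_2\<close>, so the total rate is their maximum.\<close>
  have R12_eq: "R12 = max (Iker Q ?x1 ?w1 ?y11 + Iker Q ?x2 ?w2 ?y12) (Iker Q ?x1 ?w1 ?y21 + Iker Q ?x2 ?w2 ?y22)"
    unfolding rates(2,3)[symmetric] R12_def R12'_def by (simp add: min_def max_def)
  have nonneg: "0 \<le> R12'" "0 \<le> R1'" "0 \<le> R2'" "0 \<le> R1" "0 \<le> R2"
    unfolding R12'_def R1'_def R2'_def R1_def R2_def by (auto intro!: nn simp: min_def)
  have nonneg12: "0 \<le> R12"
    unfolding R12_eq by (intro max.coboundedI1 add_nonneg_nonneg nn) auto
  \<comment> \<open>These cover the constraint for the common layer alone, where the decoder already
    knows its private layer: I(W; U1, Y1) = I(W; Y1) + I(W; U1 | Y1) is at least I(W; Y1), and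
    similarly for decoder 2.\<close>
  have sub1: "0 \<le> Iker Q ?W ?u1 ?Y1" and sub2: "0 \<le> Iker Q ?W ?u2 ?Y2" by (auto intro!: nn)
  let ?v = "[{1, 2}, {1}, {2}] :: nat set list"
  have v: "set (take 0 ?v) = {}" "set (take 1 ?v) = {{1, 2}}" "set (take 2 ?v) = {{1, 2}, {1}}"
    "?v ! 0 = {1, 2}" "?v ! 1 = {1}" "?v ! 2 = {2}"
    by simp_all
  have D1: "Dset 1 = {{1}, {1, 2}}" and D2: "Dset 2 = {{2}, {1, 2}}"
    by (auto simp: Dset_def subsets12_def)
  have two: "D' = {a} \<or> D' = {b} \<or> D' = {a, b}" if "D' \<subseteq> {a, b}" "D' \<noteq> {}" for D' and a b :: "nat set"
    using that by blast
  have sum2: "(\<Sum>S\<in>{a, b}. f S) = f a + f b" if "a \<noteq> b" for a b and f :: "nat set \<Rightarrow> real"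
    using that by simp
  have diff2: "{a, b} - {a} = {b}" "{a, b} - {b} = {a}" if "a \<noteq> b" for a b :: "nat set"
    using that by auto
  have sum1: "(\<Sum>S\<in>{a}. f S) = f a" for a and f :: "nat set \<Rightarrow> real" by simp
  note kers = Q'_def mis_I_map mis_H_map mis_condH_map mis_I_Iker[OF fin] mis_H_Hker[OF fin] mis_condH_Hker[OF fin]
     rker_pair rker_UU_insert rker_UU_empty u \<phi> kW rker_const
  have "Rach_rates ?v Q' R R'"
    unfolding Rach_rates_def
  proof (intro conjI allI impI)
    show "\<forall>S\<in>subsets12. 0 \<le> R S \<and> 0 \<le> R' S"
      using nonneg nonneg12 by (auto simp: R_def R'_def)
  next
    fix j assume "j < length ?v"
    then consider "j = 0" | "j = 1" | "j = 2" by (auto simp: less_Suc_eq)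
    then show "mis_I Q' (\<lambda>\<omega>. (lX \<omega>, UU (set (take j ?v)) \<omega>)) (usel (?v ! j)) (\<lambda>_. ()) \<le> R (?v ! j) + R' (?v ! j)"
    proof cases
      case 1
      have "mis_I Q' (\<lambda>\<omega>. (lX \<omega>, UU {} \<omega>)) (usel {1, 2}) (\<lambda>_. ()) \<le> R12 + R12'"
        unfolding kers R12_def by simp
      then show ?thesis unfolding 1 v RS .
    next
      case 2
      have "mis_I Q' (\<lambda>\<omega>. (lX \<omega>, UU {{1, 2}} \<omega>)) (usel {1}) (\<lambda>_. ()) \<le> R1 + R1'"
        using rates(4) unfolding kers R1_def R1'_def by (simp add: Int_ac)
      then show ?thesis unfolding 2 v RS .
    next
      case 3
      have "mis_I Q' (\<lambda>\<omega>. (lX \<omega>, UU {{1, 2}, {1}} \<omega>)) (usel {2}) (\<lambda>_. ()) \<le> R2 + R2'"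
        using rates(5) unfolding kers R2_def R2'_def by (simp add: Int_ac)
      then show ?thesis unfolding 3 v RS .
    qed
  next
    fix D' assume D': "D' \<subseteq> Dset 1 \<and> D' \<noteq> {}"
    let ?goal = "\<lambda>D' E. (\<Sum>S\<in>D'. R' S) \<le> (\<Sum>S\<in>D'. mis_H Q' (usel S)) - mis_condH Q' (UU D') (\<lambda>\<omega>. (UU E \<omega>, lY1 \<omega>))"
    have le: "R12' \<le> Iker Q ?W ?Y1 UNIV" by (simp add: R12'_def)
    have a: "?goal {{1}} {{1, 2}}"
      unfolding sum1 RS kers R1'_def Iker_def Int_UNIV_right Int_UNIV_left Hker_UNIV by (simp only: Int_ac)
    have b: "?goal {{1, 2}} {{1}}"
      using le sub1 unfolding sum1 RS kers Iker_def Int_UNIV_right Int_UNIV_left Hker_UNIV by (simp only: Int_ac)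
    have c: "?goal {{1}, {1, 2}} {}"
      using le unfolding sum2[OF S(2)] RS kers R1'_def Iker_def Int_UNIV_right Int_UNIV_left Hker_UNIV by (simp only: Int_ac)
    note e = diff2[OF S(2)]
    have "D' \<subseteq> {{1}, {1, 2}}" "D' \<noteq> {}" using D' unfolding D1 by blast+
    then show "?goal D' (Dset 1 - D')"
      unfolding D1 by (rule two[THEN disjE], simp only: e a) (erule disjE, simp_all only: e b c Diff_cancel)
  next
    fix D' assume D': "D' \<subseteq> Dset 2 \<and> D' \<noteq> {}"
    let ?goal = "\<lambda>D' E. (\<Sum>S\<in>D'. R' S) \<le> (\<Sum>S\<in>D'. mis_H Q' (usel S)) - mis_condH Q' (UU D') (\<lambda>\<omega>. (UU E \<omega>, lY2 \<omega>))"
    have le: "R12' \<le> Iker Q ?W ?Y2 UNIV" by (simp add: R12'_def)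
    have a: "?goal {{2}} {{1, 2}}"
      unfolding sum1 RS kers R2'_def Iker_def Int_UNIV_right Int_UNIV_left Hker_UNIV by (simp only: Int_ac)
    have b: "?goal {{1, 2}} {{2}}"
      using le sub2 unfolding sum1 RS kers Iker_def Int_UNIV_right Int_UNIV_left Hker_UNIV by (simp only: Int_ac)
    have c: "?goal {{2}, {1, 2}} {}"
      using le unfolding sum2[OF S(3)] RS kers R2'_def Iker_def Int_UNIV_right Int_UNIV_left Hker_UNIV by (simp only: Int_ac)
    note e = diff2[OF S(3)]
    have "D' \<subseteq> {{2}, {1, 2}}" "D' \<noteq> {}" using D' unfolding D2 by blast+
    then show "?goal D' (Dset 2 - D')"
      unfolding D2 by (rule two[THEN disjE], simp only: e a) (erule disjE, simp_all only: e b c Diff_cancel)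
  qed
  moreover have "distinct ?v" using S by (simp only: distinct.simps list.set insert_iff empty_iff) simp
  moreover have "set ?v = subsets12" by (simp add: subsets12_def insert_commute)
  moreover have "(\<Sum>S\<in>subsets12. R S) = max (RM_1 Q) (RM_2 Q)"
  proof -
    have "(\<Sum>S\<in>subsets12. R S) = R {1} + (R {2} + R {1, 2})"
      unfolding subsets12_def sum2[OF S(3), symmetric] using S(1,2) by (subst sum.insert) (simp_all only: finite.intros insert_iff empty_iff simp_thms)
    then show ?thesis
      unfolding R12_eq RM_1_def RM_2_def mis_I_Iker[OF fin] rker_pair R1_def R2_def RS by simp
  qed
  ultimately show ?thesis
    unfolding Rach0_def
    by (intro INF_lower2[of ?v] INF_lower2[of Q'] INF_lower2[of "(R, R')"]) auto
qed

text \<open>A single point with weight 1 is an admissible convex combination, so the scheme needs no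
  time sharing.\<close>

lemma lower_convex_envelope_le: "lower_convex_envelope f D \<le> f D"
  unfolding lower_convex_envelope_def
proof (rule Inf_lower, rule CollectI, intro exI conjI)
  show "f D = (\<Sum>t<1::nat. ereal ((\<lambda>_. 1) t) * f ((\<lambda>_. D) t))" by (simp flip: one_ereal_def)
qed auto

lemma Rach_le_RM:
  fixes P1 :: "('x1::finite \<times> 'y11::finite \<times> 'y21::finite) pmf"
    and P2 :: "('x2::finite \<times> 'y12::finite \<times> 'y22::finite) pmf"
  shows "Rach P1 P2 d11 d12 d21 d22 D \<le> RM P1 P2 d11 d12 d21 d22 D"
  unfolding Rach_def RM_def
  by (intro INF_greatest order_trans[OF lower_convex_envelope_le] RM_feasible_imp_Rach0) simp

theorem theorem9:
  fixes P1 :: "('x1::finite \<times> 'y11::finite \<times> 'y21::finite) pmf"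
    and P2 :: "('x2::finite \<times> 'y12::finite \<times> 'y22::finite) pmf"
    and d11 :: "'x1 \<Rightarrow> 'z11::finite \<Rightarrow> real"
    and d12 :: "'x2 \<Rightarrow> 'z12::finite \<Rightarrow> real"
    and d21 :: "'x1 \<Rightarrow> 'z21::finite \<Rightarrow> real"
    and d22 :: "'x2 \<Rightarrow> 'z22::finite \<Rightarrow> real"
    and D :: "nat \<Rightarrow> nat \<Rightarrow> real"
  assumes "mis_markov P1 (\<lambda>(x, y11, y21). x) (\<lambda>(x, y11, y21). y11) (\<lambda>(x, y11, y21). y21)"
    and "mis_markov P2 (\<lambda>(x, y12, y22). x) (\<lambda>(x, y12, y22). y22) (\<lambda>(x, y12, y22). y12)"
  shows "Liminf (at_right 0) (\<lambda>\<epsilon>. Rlb P1 P2 d11 d12 d21 d22 D \<epsilon>) \<ge> RM P1 P2 d11 d12 d21 d22 D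
       \<and> Rach P1 P2 d11 d12 d21 d22 D \<le> RM P1 P2 d11 d12 d21 d22 D"
  using RM_le_Liminf_Rlb[OF assms] Rach_le_RM by blast

end
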